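(* Let $(S)$ be a connected Hopf SDSE (with $F_i(0,\ldots,0)=1$ for all $i$) such that every vertex of $(S)$ has a finite level. Then $(S)$ is obtained from a fundamental system by a finite number (possibly $0$) of extensions.
   Context: $K$ is a field of characteristic zero and $I$ a finite non-empty set. $\mathcal{H}_I$ is the (Connes-Kreimer) polynomial algebra generated by the set of (isomorphism classes of non-planar) rooted trees whose vertices are decorated by elements of $I$; monomials are forests; it is graded by the number of vertices, and $\widehat{\mathcal H_I}=\prod_n\mathcal H_I(n)$ is its completion. The coproduct is the algebra morphism with $\Delta(t)=t\otimes1+1\otimes t+\sum_cP^c(t)\otimes R^c(t)$ for each tree $t$, where $c$ runs over non-empty sets of edges of $t$ such that every path from the root to a leaf meets at most one edge of $c$; after deleting the edges of $c$, $R^c(t)$ is the component containing the root and $P^c(t)$ is the product of the other components. This makes $\mathcal H_I$ a Hopf algebra. $B_i^+$ is the linear (continuous) operator sending a forest to the tree obtained by grafting its trees on a common root decorated by $i$. The SDSE $(S)$ associated to non-constant series $(F_i)_{i\in I}$, $F_i\in K[[h_j,j\in I]]$, is the system $X_i=B_i^+(F_i(X_j,j\in I))$, $i\in I$; it has a unique solution $(X_i)_{i\in I}\in\widehat{\mathcal H_I}^{\,I}$. $X_i(n)$ is the homogeneous component of degree $n$ of $X_i$, and $\mathcal H_{(S)}$ is the subalgebra of $\mathcal H_I$ generated by all the $X_i(n)$. $(S)$ is Hopf if $\mathcal H_{(S)}$ is a Hopf subalgebra of $\mathcal H_I$. The graph of $(S)$ has vertex set $I$ and an oriented edge $i\to j$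 iff $\partial F_i/\partial h_j\ne0$; $(S)$ is connected if this graph is connected (as an undirected graph). Level. Write $X_i=\sum_ta_tt$ (sum over trees with root decorated by $i$), $\mathcal T_i(n)$ the set of trees with $n$ vertices and root decorated by $i$. For a Hopf SDSE, $\lambda_n^{(i,j)}$ is the unique scalar with $\sum_{t\in\mathcal T_i(n+1)}n_j(t,t')a_t=\lambda_n^{(i,j)}a_{t'}$ for all $t'\in\mathcal T_i(n)$, where $n_j(t,t')$ is the number of leaves of $t$ decorated by $j$ whose removal gives $t'$. A vertex $i$ has finite level if there is $M\in\mathbb N$ such that for every $j\in I$ there are scalars $b_j,\tilde a_j$ with $\lambda_n^{(i,j)}=b_j(n-1)+\tilde a_j$ for all $n>M$. Operations. A change of variables replaces $(F_i(h_j,j\in I))_{i}$ by $(F_i(\lambda_jh_j,j\in I))_{i}$ with all $\lambda_j\in K-\{0\}$. A dilatation of the system $(F_i)_{i\in I}$ is a system $(F'_x)_{x\in J}$, $J$ finite with a partition $J=\bigcup_{i\in I}J_i$ into non-empty sets, with $F'_x=F_i\big(\sum_{y\in J_j}h_y,\ j\in I\big)$ for $x\in J_i$. An extension of a Hopf SDSE $(F_i)_{i\in I}$ is a system $(F_i)_{i\in I\cup\{0\}}$, $0\notin I$, with $F_0=1+\sum_{i\in I}a^{(0)}_ih_i$ non-constant and $F_i=F_j$ whenever $a^{(0)}_i\ne0$ and $a^{(0)}_j\neq0$. Fundamental: up to a change of variables, a dilatation of a basic system of the following form. For $\beta\in K$, $f_\beta(h)=\sum_{k\ge0}\frac{(1+\beta)\cdots(1+(k-1)\beta)}{k!}h^k$;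 $f_{\beta/\lambda}(\lambda h)$ means $\sum_{k\ge0}\frac{\lambda(\lambda+\beta)\cdots(\lambda+(k-1)\beta)}{k!}h^k$ (equal to $1$ if $\lambda=0$); $-\frac a\beta\ln(1-\beta h)$ means $ah$ if $\beta=0$. The index set is a disjoint union $I_0\cup J_0\cup K_0\cup I_1\cup J_1$ (parts possibly empty) with $I_0\cup J_0\ne\emptyset$, all series are non-constant, and: (1) for $i\in I_0$ there is $\beta_i\in K$ with $F_i=f_{\beta_i}(h_i)\prod_{j\in I_0-\{i\}}f_{\frac{\beta_j}{1+\beta_j}}((1+\beta_j)h_j)\prod_{j\in J_0}f_1(h_j)$; (2) for $i\in J_0$, $F_i=\prod_{j\in I_0}f_{\frac{\beta_j}{1+\beta_j}}((1+\beta_j)h_j)\prod_{j\in J_0-\{i\}}f_1(h_j)$; (3) for $i\in K_0$, $F_i=\prod_{j\in I_0}f_{\frac{\beta_j}{1+\beta_j}}((1+\beta_j)h_j)\prod_{j\in J_0}f_1(h_j)$; (4) for $i\in I_1$ there are $\nu_i\in K$ and scalars $(a^{(i)}_j)_{j\in I_0\cup J_0\cup K_0}$, with $\nu_i\ne1$ or $a^{(i)}_j\ne1+\beta_j$ for some $j\in I_0$ or $a^{(i)}_j\neq1$ for some $j\in J_0$ or $a^{(i)}_j\neq0$ for some $j\in K_0$, such that if $\nu_i\ne0$, $F_i=\frac1{\nu_i}\prod_{j\in I_0}f_{\frac{\beta_j}{\nu_ia^{(i)}_j}}(\nu_ia^{(i)}_jh_j)\prod_{j\in J_0}f_{\frac1{\nu_ia^{(i)}_j}}(\nu_ia^{(i)}_jh_j)\prod_{j\in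 K_0}f_0(\nu_ia^{(i)}_jh_j)+1-\frac1{\nu_i}$, and if $\nu_i=0$, $F_i=1-\sum_{j\in I_0}\frac{a^{(i)}_j}{\beta_j}\ln(1-\beta_jh_j)-\sum_{j\in J_0}a^{(i)}_j\ln(1-h_j)+\sum_{j\in K_0}a^{(i)}_jh_j$; (5) for $i\in J_1$ there are $\nu_i\in K-\{0\}$ and scalars $(a^{(i)}_j)_{j\in I_1}$ such that $I_1^{(i)}=\{j\in I_1:a^{(i)}_j\ne0\}\neq\emptyset$, $\nu_j=1$ for $j\in I_1^{(i)}$, $F_j=F_k$ for $j,k\in I_1^{(i)}$, and, with $b^{(i)}_t=a^{(j)}_t$ for any $j\in I_1^{(i)}$, $F_i=\frac1{\nu_i}\prod_{j\in I_0}f_{\frac{\beta_j}{b^{(i)}_j-1-\beta_j}}((b^{(i)}_j-1-\beta_j)h_j)\prod_{j\in J_0}f_{\frac1{b^{(i)}_j-1}}((b^{(i)}_j-1)h_j)\prod_{j\in K_0}f_0(b^{(i)}_jh_j)+\sum_{j\in I_1^{(i)}}a^{(i)}_jh_j+1-\frac1{\nu_i}$. *)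

theory Defs
  imports
    "HOL-Library.Multiset"
    "HOL-Library.Poly_Mapping"
    "HOL-Library.Product_Plus"
    "HOL-Library.Sublist"
    "HOL-Library.Disjoint_Sets"
    "HOL-Computational_Algebra.Formal_Power_Series"
begin

section \<open>Formal power series in several commuting variables\<close>

text \<open>
  A monomial is the multiset of its variables. The variables may form an infinite type, since every
  monomial has only finitely many factorisations.
\<close>

typedef ('v, 'k) mps = "UNIV :: ('v multiset \<Rightarrow> 'k) set"
  morphisms mcoeff Abs_mps by simp

setup_lifting type_definition_mps

lemma mps_eqI: "(\<And>m. mcoeff F m = mcoeff G m) \<Longrightarrow> F = G"
  by transfer auto

lemma finite_submultisets [simp, intro]: "finite {a. a \<subseteq># (m :: 'v multiset)}"
proof -
  have "{a. a \<subseteq># m} \<subseteq> (\<Union>n\<le>size m. {a. set_mset a \<subseteq> set_mset m \<and> size a = n})"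
    using set_mset_mono size_mset_mono by fastforce
  thus ?thesis
    by (rule finite_subset) (use finite_multisets_of_size[of "set_mset m"] in \<open>auto simp: multisets_of_size_def\<close>)
qed

instantiation mps :: (type, comm_ring_1) comm_ring_1
begin

lift_definition zero_mps :: "('a, 'b) mps" is "\<lambda>_. 0" .
lift_definition one_mps :: "('a, 'b) mps" is "\<lambda>m. if m = {#} then 1 else 0" .
lift_definition plus_mps :: "('a, 'b) mps \<Rightarrow> ('a, 'b) mps \<Rightarrow> ('a, 'b) mps"
  is "\<lambda>F G m. F m + G m" .
lift_definition minus_mps :: "('a, 'b) mps \<Rightarrow> ('a, 'b) mps \<Rightarrow> ('a, 'b) mps"
  is "\<lambda>F G m. F m - G m" .
lift_definition uminus_mps :: "('a, 'b) mps \<Rightarrow> ('a, 'b) mps" is "\<lambda>F m. - F m" .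
lift_definition times_mps :: "('a, 'b) mps \<Rightarrow> ('a, 'b) mps \<Rightarrow> ('a, 'b) mps"
  is "\<lambda>F G m. \<Sum>a\<in>{a. a \<subseteq># m}. F a * G (m - a)" .

instance
proof
  fix F G H :: "('a, 'b) mps"
  show "F * G * H = F * (G * H)"
  proof (transfer, rule ext)
    fix F G H :: "'a multiset \<Rightarrow> 'b" and m
    have "(\<Sum>a\<in>{a. a \<subseteq># m}. (\<Sum>b\<in>{b. b \<subseteq># a}. F b * G (a - b)) * H (m - a)) =
          (\<Sum>(a, b)\<in>Sigma {a. a \<subseteq># m} (\<lambda>a. {b. b \<subseteq># a}). F b * G (a - b) * H (m - a))"
      by (simp add: sum_distrib_right sum.Sigma)
    also have "\<dots> = (\<Sum>(b, c)\<in>Sigma {b. b \<subseteq># m} (\<lambda>b. {c. c \<subseteq># m - b}). F b * G c * H (m - b - c))"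
      by (rule sum.reindex_bij_witness[where j = "\<lambda>(a, b). (b, a - b)" and i = "\<lambda>(b, c). (b + c, b)"])
         (auto simp: subset_mset.le_diff_conv2 add.commute
               intro: subset_mset.order_trans diff_subset_eq_self dest: subset_mset.diff_add)
    also have "\<dots> = (\<Sum>a\<in>{a. a \<subseteq># m}. F a * (\<Sum>b\<in>{b. b \<subseteq># m - a}. G b * H (m - a - b)))"
      by (simp add: sum_distrib_left sum.Sigma mult.assoc)
    finally show "(\<Sum>a\<in>{a. a \<subseteq># m}. (\<Sum>b\<in>{b. b \<subseteq># a}. F b * G (a - b)) * H (m - a)) =
      (\<Sum>a\<in>{a. a \<subseteq># m}. F a * (\<Sum>b\<in>{b. b \<subseteq># m - a}. G b * H (m - a - b)))" .
  qed
  show "F * G = G * F"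
  proof (transfer, rule ext)
    fix F G :: "'a multiset \<Rightarrow> 'b" and m
    show "(\<Sum>a\<in>{a. a \<subseteq># m}. F a * G (m - a)) = (\<Sum>a\<in>{a. a \<subseteq># m}. G a * F (m - a))"
      by (rule sum.reindex_bij_witness[where i = "\<lambda>a. m - a" and j = "\<lambda>a. m - a"])
         (auto simp: subset_mset.diff_diff_right mult.commute)
  qed
  show "1 * F = F"
  proof (transfer, rule ext)
    fix F :: "'a multiset \<Rightarrow> 'b" and m
    have "(\<Sum>a\<in>{a. a \<subseteq># m}. (if a = {#} then 1 else 0) * F (m - a)) =
          (\<Sum>a\<in>{{#}}. (if a = {#} then 1 else 0) * F (m - a))"
      by (rule sum.mono_neutral_right) auto
    thus "(\<Sum>a\<in>{a. a \<subseteq># m}. (if a = {#} then 1 else 0) * F (m - a)) = F m" by simp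
  qed
  show "(F + G) * H = F * H + G * H"
    by transfer (simp add: sum.distrib distrib_right)
  show "(0 :: ('a, 'b) mps) \<noteq> 1"
    by transfer (metis zero_neq_one)
qed (transfer; simp add: algebra_simps; fail)+

end

lift_definition mps_const :: "'k \<Rightarrow> ('v, 'k :: comm_ring_1) mps"
  is "\<lambda>c m. if m = {#} then c else 0" .

lift_definition mps_var :: "'v \<Rightarrow> ('v, 'k :: comm_ring_1) mps"
  is "\<lambda>j m. if m = {#j#} then 1 else 0" .

text \<open>\<open>mps_in g j\<close> is the series \<open>g(h\<^sub>j)\<close> for a series \<open>g\<close> in one variable.\<close>

lift_definition mps_in :: "'k fps \<Rightarrow> 'v \<Rightarrow> ('v, 'k :: comm_ring_1) mps"
  is "\<lambda>g j m. if set_mset m \<subseteq> {j} then fps_nth g (size m) else 0" .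

lift_definition mps_deriv :: "'v \<Rightarrow> ('v, 'k :: comm_ring_1) mps \<Rightarrow> ('v, 'k) mps"
  is "\<lambda>j F m. of_nat (Suc (count m j)) * F (add_mset j m)" .

text \<open>
  Substitution \<open>F(G\<^sub>v, v)\<close>. The sum below has finite support, as it should, if \<open>F\<close> involves only
  finitely many variables \<open>v\<close> and the corresponding \<open>G\<^sub>v\<close> have no constant term.
\<close>

lift_definition mps_subst ::
    "('v, 'k :: comm_ring_1) mps \<Rightarrow> ('v \<Rightarrow> ('w, 'k) mps) \<Rightarrow> ('w, 'k) mps"
  is "\<lambda>F G m. Sum_any (\<lambda>n. F n * mcoeff (\<Prod>v\<in>#n. G v) m)" .

definition mps_over :: "'v set \<Rightarrow> ('v, 'k :: zero) mps \<Rightarrow> bool" where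
  "mps_over V F \<longleftrightarrow> (\<forall>m. mcoeff F m \<noteq> 0 \<longrightarrow> set_mset m \<subseteq> V)"

definition mps_nonconstant :: "('v, 'k :: zero) mps \<Rightarrow> bool" where
  "mps_nonconstant F \<longleftrightarrow> (\<exists>m. m \<noteq> {#} \<and> mcoeff F m \<noteq> 0)"


section \<open>Decorated rooted trees\<close>

datatype 'i rtree = Node (root: 'i) (branches: "'i rtree multiset")

type_synonym 'i forest = "'i rtree multiset"

primrec vertices :: "'i rtree \<Rightarrow> nat" where
  "vertices (Node i ts) = Suc (\<Sum>\<^sub># (image_mset vertices ts))"

definition forest_vertices :: "'i forest \<Rightarrow> nat" where
  "forest_vertices f = (\<Sum>t\<in>#f. vertices t)"

definition trees :: "'i set \<Rightarrow> 'i \<Rightarrow> nat \<Rightarrow> 'i rtree set" where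
  "trees I i n = {t. set_rtree t \<subseteq> I \<and> root t = i \<and> vertices t = n}"

lemma vertices_pos [simp]: "vertices t > 0"
  by (cases t) simp

lemma vertices_member: "t \<in># f \<Longrightarrow> vertices t \<le> forest_vertices f"
  by (auto simp: forest_vertices_def dest!: multi_member_split)

lemma size_le_forest_vertices: "size f \<le> forest_vertices f"
proof (induction f)
  case (add t f)
  thus ?case using vertices_pos[of t] unfolding forest_vertices_def
    by (simp del: vertices_pos)
qed (simp add: forest_vertices_def)

lemma forest_vertices_mono: "g \<subseteq># f \<Longrightarrow> forest_vertices g \<le> forest_vertices f"
  by (auto simp: forest_vertices_def subset_mset.le_iff_add)

lemma finite_multisets_le:
  assumes "finite A"
  shows "finite {m. set_mset m \<subseteq> A \<and> size m \<le> n}"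
proof -
  have "{m. set_mset m \<subseteq> A \<and> size m \<le> n} = (\<Union>k\<le>n. multisets_of_size A k)"
    by (auto simp: multisets_of_size_def)
  thus ?thesis using assms by auto
qed

lemma finite_rtrees:
  assumes "finite I"
  shows "finite {t. set_rtree t \<subseteq> I \<and> vertices t \<le> n}"
proof (induction n)
  case 0
  have "{t. set_rtree t \<subseteq> I \<and> vertices t \<le> 0} = {}"
    using vertices_pos by (metis (no_types, lifting) Collect_empty_eq le_zero_eq less_irrefl)
  thus ?case by (metis finite.emptyI)
next
  case (Suc n)
  let ?T = "{t. set_rtree t \<subseteq> I \<and> vertices t \<le> n}"
  have "{t. set_rtree t \<subseteq> I \<and> vertices t \<le> Suc n}
        \<subseteq> case_prod Node ` (I \<times> {f. set_mset f \<subseteq> ?T \<and> size f \<le> n})"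
  proof
    fix t assume t: "t \<in> {t. set_rtree t \<subseteq> I \<and> vertices t \<le> Suc n}"
    obtain i f where [simp]: "t = Node i f" by (cases t)
    have "forest_vertices f \<le> n" using t by (simp add: forest_vertices_def)
    moreover have "\<forall>s\<in>#f. set_rtree s \<subseteq> I" "i \<in> I" using t by auto
    ultimately have "(i, f) \<in> I \<times> {f. set_mset f \<subseteq> ?T \<and> size f \<le> n}"
      using vertices_member[of _ f] size_le_forest_vertices[of f] by fastforce
    thus "t \<in> case_prod Node ` (I \<times> {f. set_mset f \<subseteq> ?T \<and> size f \<le> n})" by force
  qed
  thus ?case
    by (rule finite_subset) (use Suc assms in \<open>auto intro: finite_multisets_le\<close>)
qed

lemma finite_trees: "finite I \<Longrightarrow> finite (trees I i n)"
  by (rule finite_subset[OF _ finite_rtrees[of I n]]) (auto simp: trees_def)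

lemma finite_forests:
  assumes "finite I"
  shows "finite {f. (\<forall>t\<in>#f. set_rtree t \<subseteq> I) \<and> forest_vertices f = n}"
proof (rule finite_subset)
  show "{f. (\<forall>t\<in>#f. set_rtree t \<subseteq> I) \<and> forest_vertices f = n}
        \<subseteq> {f. set_mset f \<subseteq> {t. set_rtree t \<subseteq> I \<and> vertices t \<le> n} \<and> size f \<le> n}"
    using vertices_member size_le_forest_vertices by fastforce
qed (use assms in \<open>auto intro: finite_multisets_le finite_rtrees\<close>)

text \<open>
  Isomorphism classes of trees have no individual vertices. To speak about sets of edges and leaves we
  use a planar representative: its vertices are the paths (lists of branch numbers) from the
  root, and an edge is named by its lower end, a nonempty path. The choice of the representative is
  immaterial, as permuting branches permutes the edges and leaves accordingly.
\<close>

datatype 'i ptree = PNode (proot: 'i) (pbranches: "'i ptree list")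

primrec shape :: "'i ptree \<Rightarrow> 'i rtree" where
  "shape (PNode i ts) = Node i (mset (map shape ts))"

lemma shape_surj: "\<exists>p. shape p = t"
proof (induction t)
  case (Node i ts)
  have "\<exists>ps. mset (map shape ps) = ts"
    using Node
  proof (induction ts)
    case (add t ts)
    have "\<exists>ps. mset (map shape ps) = ts" by (rule add.IH) (simp add: add.prems)
    moreover have "\<exists>p. shape p = t" by (rule add.prems) simp
    ultimately obtain ps p where "mset (map shape ps) = ts" "shape p = t" by blast
    thus ?case by (intro exI[of _ "p # ps"]) simp
  qed auto
  thus ?case by (metis shape.simps)
qed

definition planar_rep :: "'i rtree \<Rightarrow> 'i ptree" where
  "planar_rep t = (SOME p. shape p = t)"

primrec is_vertex :: "'i ptree \<Rightarrow> nat list \<Rightarrow> bool" where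
  "is_vertex t [] \<longleftrightarrow> True"
| "is_vertex t (k # p) \<longleftrightarrow> k < length (pbranches t) \<and> is_vertex (pbranches t ! k) p"

primrec subtree :: "'i ptree \<Rightarrow> nat list \<Rightarrow> 'i ptree" where
  "subtree t [] = t"
| "subtree t (k # p) = subtree (pbranches t ! k) p"

definition edges :: "'i ptree \<Rightarrow> nat list set" where
  "edges t = {p. is_vertex t p \<and> p \<noteq> []}"

definition leaves :: "'i ptree \<Rightarrow> nat list set" where
  "leaves t = {p. is_vertex t p \<and> pbranches (subtree t p) = []}"

text \<open>\<open>prune c t\<close> is the component containing the root after deleting the edges in \<open>c\<close>.\<close>

function prune :: "nat list set \<Rightarrow> 'i ptree \<Rightarrow> 'i ptree" where
  "prune c (PNode i ts) =
     PNode i (map (\<lambda>k. prune {p. k # p \<in> c} (ts ! k)) (filter (\<lambda>k. [k] \<notin> c) [0..<length ts]))"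
  by pat_completeness auto
termination
proof (relation "measure (\<lambda>(c, t). size t)")
  fix c :: "nat list set" and i :: 'a and ts :: "'a ptree list" and k
  assume "k \<in> set (filter (\<lambda>k. [k] \<notin> c) [0..<length ts])"
  hence "ts ! k \<in> set ts" by simp
  hence "size (ts ! k) \<le> size_list size ts" by (rule size_list_estimation') simp
  thus "(({p. k # p \<in> c}, ts ! k), (c, PNode i ts)) \<in> measure (\<lambda>(c, t). size t)" by simp
qed simp

text \<open>The component containing the vertex \<open>v\<close>, which is the root or the lower end of an edge in \<open>c\<close>.\<close>

definition component :: "nat list set \<Rightarrow> 'i ptree \<Rightarrow> nat list \<Rightarrow> 'i rtree" where
  "component c t v = shape (prune {p. v @ p \<in> c} (subtree t v))"

text \<open>The edges on the path from the root to a leaf \<open>l\<close> are the nonempty prefixes of \<open>l\<close>.\<close>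

definition admissible_cuts :: "'i ptree \<Rightarrow> nat list set set" where
  "admissible_cuts t =
     {c. c \<noteq> {} \<and> c \<subseteq> edges t \<and> (\<forall>l\<in>leaves t. card {e \<in> c. prefix e l} \<le> 1)}"

definition cut_root :: "nat list set \<Rightarrow> 'i ptree \<Rightarrow> 'i rtree" where
  "cut_root c t = component c t []"

definition cut_forest :: "nat list set \<Rightarrow> 'i ptree \<Rightarrow> 'i forest" where
  "cut_forest c t = {#component c t e. e \<in># mset_set c#}"

definition leaf_count :: "'i \<Rightarrow> 'i rtree \<Rightarrow> 'i rtree \<Rightarrow> nat" where
  "leaf_count j t t' =
     (let p = planar_rep t in
      card {l \<in> leaves p. l \<noteq> [] \<and> proot (subtree p l) = j \<and> shape (prune {l} p) = t'})"


section \<open>The Connes-Kreimer Hopf algebra\<close>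

text \<open>
  The elements are finite linear combinations of forests over the whole decoration type, and the
  algebra over a decoration set \<open>I\<close> is a subset of these; the structure maps restrict to it. The
  convolution product of \<open>poly_mapping\<close> is induced by addition of multisets, i.e. by disjoint union of
  forests. Likewise, the tensor square has the pairs of forests as a basis.
\<close>

type_synonym ('i, 'k) ck = "'i forest \<Rightarrow>\<^sub>0 'k"
type_synonym ('i, 'k) ck2 = "('i forest \<times> 'i forest) \<Rightarrow>\<^sub>0 'k"

definition scale :: "'k :: field \<Rightarrow> ('m :: comm_monoid_add \<Rightarrow>\<^sub>0 'k) \<Rightarrow> ('m \<Rightarrow>\<^sub>0 'k)" where
  "scale c x = Poly_Mapping.single 0 c * x"

lemma vector_space_scale: "vector_space scale"
  by unfold_locales
     (simp_all add: scale_def algebra_simps mult_single single_add flip: mult.assoc)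

definition tensor :: "('i, 'k :: field) ck \<Rightarrow> ('i, 'k) ck \<Rightarrow> ('i, 'k) ck2" where
  "tensor x y = (\<Sum>f\<in>Poly_Mapping.keys x. \<Sum>g\<in>Poly_Mapping.keys y.
     Poly_Mapping.single (f, g) (Poly_Mapping.lookup x f * Poly_Mapping.lookup y g))"

definition of_forest :: "'i forest \<Rightarrow> ('i, 'k :: field) ck" where
  "of_forest f = Poly_Mapping.single f 1"

definition coprod_tree :: "'i rtree \<Rightarrow> ('i, 'k :: field) ck2" where
  "coprod_tree t =
     tensor (of_forest {#t#}) 1 + tensor 1 (of_forest {#t#}) +
     (let p = planar_rep t in
      \<Sum>c\<in>admissible_cuts p. tensor (of_forest (cut_forest c p)) (of_forest {#cut_root c p#}))"

definition coprod :: "('i, 'k :: field) ck \<Rightarrow> ('i, 'k) ck2" where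
  "coprod x = (\<Sum>f\<in>Poly_Mapping.keys x. scale (Poly_Mapping.lookup x f) (\<Prod>t\<in>#f. coprod_tree t))"

definition counit :: "('i, 'k :: field) ck \<Rightarrow> 'k" where
  "counit x = Poly_Mapping.lookup x {#}"

text \<open>\<open>mult_tensor u v\<close> is the composition of \<open>u \<otimes> v\<close> with the multiplication map.\<close>

definition mult_tensor ::
    "(('i, 'k) ck \<Rightarrow> ('i, 'k) ck) \<Rightarrow> (('i, 'k) ck \<Rightarrow> ('i, 'k) ck) \<Rightarrow> ('i, 'k :: field) ck2 \<Rightarrow> ('i, 'k) ck"
  where "mult_tensor u v z = (\<Sum>(f, g)\<in>Poly_Mapping.keys z.
    scale (Poly_Mapping.lookup z (f, g)) (u (of_forest f) * v (of_forest g)))"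

definition is_antipode :: "(('i, 'k :: field) ck \<Rightarrow> ('i, 'k) ck) \<Rightarrow> bool" where
  "is_antipode S \<longleftrightarrow> Vector_Spaces.linear scale scale S \<and>
     (\<forall>x. mult_tensor S id (coprod x) = scale (counit x) 1 \<and>
          mult_tensor id S (coprod x) = scale (counit x) 1)"

definition ck_over :: "'i set \<Rightarrow> ('i, 'k :: field) ck set" where
  "ck_over I = {x. \<forall>f\<in>Poly_Mapping.keys x. \<forall>t\<in>#f. set_rtree t \<subseteq> I}"

definition subalgebra :: "('i, 'k :: field) ck set \<Rightarrow> bool" where
  "subalgebra A \<longleftrightarrow> module.subspace scale A \<and> 1 \<in> A \<and> (\<forall>x\<in>A. \<forall>y\<in>A. x * y \<in> A)"

text \<open>Since an antipode is unique, \<open>\<exists>S\<close> below refers to the antipode of the whole algebra.\<close>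

definition hopf_subalgebra :: "'i set \<Rightarrow> ('i, 'k :: field) ck set \<Rightarrow> bool" where
  "hopf_subalgebra I A \<longleftrightarrow> A \<subseteq> ck_over I \<and> subalgebra A \<and>
     (\<forall>x\<in>A. coprod x \<in> module.span scale {tensor y z | y z. y \<in> A \<and> z \<in> A}) \<and>
     (\<exists>S. is_antipode S \<and> S ` A \<subseteq> A)"


section \<open>Systems of Dyson-Schwinger equations\<close>

text \<open>
  For finite \<open>I\<close> there are finitely many forests of each degree over \<open>I\<close>, so the elements of the
  completion are the arbitrary formal sums of such forests, i.e. the formal power series in
  the trees over \<open>I\<close>.
\<close>

type_synonym ('i, 'k) cck = "('i rtree, 'k) mps"

definition cck_over :: "'i set \<Rightarrow> ('i, 'k :: zero) cck set" where
  "cck_over I = {X. mps_over {t. set_rtree t \<subseteq> I} X}"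

lift_definition graft :: "'i \<Rightarrow> ('i, 'k :: comm_monoid_add) cck \<Rightarrow> ('i, 'k) cck"
  is "\<lambda>i X f. Sum_any (\<lambda>g. X g when f = {#Node i g#})" .

definition homogeneous_part :: "nat \<Rightarrow> ('i, 'k :: zero) cck \<Rightarrow> ('i, 'k) ck" where
  "homogeneous_part n X = Abs_poly_mapping (\<lambda>f. mcoeff X f when forest_vertices f = n)"

lemma lookup_homogeneous_part:
  assumes "finite I" "X \<in> cck_over I"
  shows "Poly_Mapping.lookup (homogeneous_part n X) f = (mcoeff X f when forest_vertices f = n)"
proof -
  have "{f. (mcoeff X f when forest_vertices f = n) \<noteq> 0}
        \<subseteq> {f. (\<forall>t\<in>#f. set_rtree t \<subseteq> I) \<and> forest_vertices f = n}"
    using assms(2) by (auto simp: cck_over_def mps_over_def)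
  hence "finite {f. (mcoeff X f when forest_vertices f = n) \<noteq> 0}"
    by (rule finite_subset) (rule finite_forests[OF assms(1)])
  thus ?thesis by (simp add: homogeneous_part_def)
qed

definition sdse :: "'i set \<Rightarrow> ('i \<Rightarrow> ('i, 'k :: field_char_0) mps) \<Rightarrow> bool" where
  "sdse I F \<longleftrightarrow> finite I \<and> I \<noteq> {} \<and> (\<forall>i\<in>I. mps_over I (F i) \<and> mps_nonconstant (F i))"

text \<open>Outside \<open>I\<close> a solution is set to \<open>0\<close>, so that the family is unique as a total function.\<close>

definition is_solution ::
    "'i set \<Rightarrow> ('i \<Rightarrow> ('i, 'k :: field_char_0) mps) \<Rightarrow> ('i \<Rightarrow> ('i, 'k) cck) \<Rightarrow> bool" where
  "is_solution I F X \<longleftrightarrow>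
     (\<forall>i\<in>I. X i \<in> cck_over I \<and> X i = graft i (mps_subst (F i) X)) \<and> (\<forall>i. i \<notin> I \<longrightarrow> X i = 0)"

definition solution ::
    "'i set \<Rightarrow> ('i \<Rightarrow> ('i, 'k :: field_char_0) mps) \<Rightarrow> 'i \<Rightarrow> ('i, 'k) cck" where
  "solution I F = (THE X. is_solution I F X)"

lemma mcoeff_graft_Node: "mcoeff (graft i X) {#Node i g#} = mcoeff X g"
proof -
  have "(\<lambda>h. mcoeff X h when {#Node i g#} = {#Node i h#}) = (\<lambda>h. mcoeff X h when h = g)"
    by (intro ext when_cong) auto
  thus ?thesis unfolding graft.rep_eq by (metis Sum_any_when_equal)
qed

lemma mcoeff_graft_other: "(\<And>g. f \<noteq> {#Node i g#}) \<Longrightarrow> mcoeff (graft i X) f = 0"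
  by (simp add: graft.rep_eq)

definition agree :: "nat \<Rightarrow> ('i, 'k :: zero) cck \<Rightarrow> ('i, 'k) cck \<Rightarrow> bool" where
  "agree n X Y \<longleftrightarrow> (\<forall>f. forest_vertices f < n \<longrightarrow> mcoeff X f = mcoeff Y f)"

lemma agree_mult:
  assumes "agree n X Y" "agree n X' Y'"
  shows "agree n (X * X') (Y * Y')"
  unfolding agree_def
proof (intro allI impI)
  fix f :: "'a forest" assume f: "forest_vertices f < n"
  have "mcoeff X a = mcoeff Y a \<and> mcoeff X' (f - a) = mcoeff Y' (f - a)" if "a \<subseteq># f" for a
    using assms f forest_vertices_mono[OF that] forest_vertices_mono[of "f - a" f]
    by (simp add: agree_def)
  thus "mcoeff (X * X') f = mcoeff (Y * Y') f"
    by (simp add: times_mps.rep_eq)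
qed

lemma agree_graft_subst:
  fixes X Y :: "'v \<Rightarrow> ('i, 'k :: comm_ring_1) cck" and F :: "('v, 'k) mps"
  assumes "\<And>j. agree n (X j) (Y j)"
  shows "agree (Suc n) (graft i (mps_subst F X)) (graft i (mps_subst F Y))"
  unfolding agree_def
proof (intro allI impI)
  fix f :: "'i forest" assume f: "forest_vertices f < Suc n"
  have prod: "agree n (\<Prod>v\<in>#m. X v) (\<Prod>v\<in>#m. Y v)" for m
    by (induction m) (auto intro: agree_mult assms simp: agree_def[of n 1])
  show "mcoeff (graft i (mps_subst F X)) f = mcoeff (graft i (mps_subst F Y)) f"
  proof (cases "\<exists>g. f = {#Node i g#}")
    case True
    then obtain g where [simp]: "f = {#Node i g#}" by blast
    have "forest_vertices g < n" using f by (simp add: forest_vertices_def)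
    thus ?thesis using prod by (simp add: mcoeff_graft_Node mps_subst.rep_eq agree_def)
  qed (simp add: mcoeff_graft_other)
qed

lemma cck_over_mult:
  assumes "X \<in> cck_over I" "Y \<in> cck_over I"
  shows "X * Y \<in> cck_over I"
  unfolding cck_over_def mps_over_def
proof (intro CollectI allI impI)
  fix f assume "mcoeff (X * Y) f \<noteq> 0"
  then obtain a where "a \<subseteq># f" "mcoeff X a \<noteq> 0" "mcoeff Y (f - a) \<noteq> 0"
    by (auto simp: times_mps.rep_eq elim!: sum.not_neutral_contains_not_neutral
          dest: mult_not_zero)
  moreover from this have "set_mset f = set_mset a \<union> set_mset (f - a)"
    by (metis set_mset_union subset_mset.add_diff_inverse)
  ultimately show "set_mset f \<subseteq> {t. set_rtree t \<subseteq> I}"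
    using assms by (auto simp: cck_over_def mps_over_def)
qed

lemma cck_over_graft_subst:
  assumes "\<And>j. X j \<in> cck_over I" "i \<in> I"
  shows "graft i (mps_subst F X) \<in> cck_over I"
  unfolding cck_over_def mps_over_def
proof (intro CollectI allI impI)
  fix f assume f: "mcoeff (graft i (mps_subst F X)) f \<noteq> 0"
  have prod: "(\<Prod>v\<in>#m. X v) \<in> cck_over I" for m
  proof (induction m)
    case (add v m)
    thus ?case using cck_over_mult[OF assms(1)[of v] add] by simp
  qed (simp add: cck_over_def mps_over_def one_mps.rep_eq)
  have "\<exists>g. f = {#Node i g#}"
  proof (rule ccontr)
    assume "\<nexists>g. f = {#Node i g#}"
    hence "mcoeff (graft i (mps_subst F X)) f = 0" by (intro mcoeff_graft_other) simp
    thus False using f by simp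
  qed
  then obtain g where [simp]: "f = {#Node i g#}" by (elim exE)
  have "Sum_any (\<lambda>n. mcoeff F n * mcoeff (\<Prod>v\<in>#n. X v) g) \<noteq> 0"
    using f by (simp add: mcoeff_graft_Node mps_subst.rep_eq)
  then obtain n where "mcoeff F n * mcoeff (\<Prod>v\<in>#n. X v) g \<noteq> 0"
    by (rule Sum_any.not_neutral_obtains_not_neutral)
  hence "set_mset g \<subseteq> {t. set_rtree t \<subseteq> I}"
    using prod[of n] mult_not_zero unfolding cck_over_def mps_over_def by blast
  thus "set_mset f \<subseteq> {t. set_rtree t \<subseteq> I}" using assms(2) by auto
qed

theorem solution_exists_unique:
  fixes F :: "'i \<Rightarrow> ('i, 'k :: field_char_0) mps"
  shows "\<exists>!X. is_solution I F X"
proof (rule ex_ex1I)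
  define step where "step X i = (if i \<in> I then graft i (mps_subst (F i) X) else 0)" for X i
  define A where "A k = (step ^^ k) (\<lambda>_. 0)" for k
  have A_Suc: "A (Suc k) = step (A k)" for k by (simp add: A_def)
  have step: "agree (Suc n) (step X i) (step Y i)" if "\<And>j. agree n (X j) (Y j)" for n X Y i
    using agree_graft_subst[of n X Y, OF that] by (simp add: step_def agree_def[of _ 0])
  have stable1: "agree k (A k i) (A (Suc k) i)" for k i
  proof (induction k arbitrary: i)
    case (Suc k)
    show ?case using step[of k "A k" "A (Suc k)" i, OF Suc] by (simp only: A_Suc)
  qed (simp add: agree_def)
  have stable: "agree k (A k i) (A (k + l) i)" for k l i
  proof (induction l)
    case (Suc l)
    thus ?case using stable1[of "k + l" i] by (auto simp: agree_def)
  qed (simp add: agree_def)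
  define X where "X i = Abs_mps (\<lambda>f. mcoeff (A (Suc (forest_vertices f)) i) f)" for i
  have X: "mcoeff (X i) f = mcoeff (A (Suc (forest_vertices f)) i) f" for i f
    by (simp add: X_def Abs_mps_inverse)
  have X_A: "agree n (X i) (A n i)" for n i
    unfolding agree_def X
  proof (intro allI impI)
    fix f :: "'i forest" assume "forest_vertices f < n"
    then obtain l where n: "n = Suc (forest_vertices f) + l" by (metis less_iff_Suc_add add_Suc)
    show "mcoeff (A (Suc (forest_vertices f)) i) f = mcoeff (A n i) f"
      using stable[of "Suc (forest_vertices f)" i l] unfolding n by (simp add: agree_def)
  qed
  have X_step: "X i = step X i" for i
  proof (rule mps_eqI)
    fix f :: "'i forest"
    let ?n = "forest_vertices f"
    have "agree (Suc ?n) (step X i) (A (Suc ?n) i)"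
      unfolding A_Suc by (rule step) (rule X_A)
    thus "mcoeff (X i) f = mcoeff (step X i) f" by (simp add: agree_def X)
  qed
  have over: "A k i \<in> cck_over I" for k i
  proof (induction k arbitrary: i)
    case 0
    show ?case by (simp add: A_def cck_over_def mps_over_def zero_mps.rep_eq)
  next
    case (Suc k)
    show ?case
    proof (cases "i \<in> I")
      case True
      thus ?thesis using cck_over_graft_subst[of "A k", OF Suc True] by (simp add: A_Suc step_def)
    qed (simp add: A_Suc step_def cck_over_def mps_over_def zero_mps.rep_eq)
  qed
  have "X i \<in> cck_over I" for i
    using over by (auto simp: cck_over_def mps_over_def X)
  moreover have "X i = graft i (mps_subst (F i) X)" if "i \<in> I" for i
    using that X_step[of i] unfolding step_def by (simp only: if_True)
  moreover have "X i = 0" if "i \<notin> I" for i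
    using that X_step[of i] unfolding step_def by (simp only: if_False)
  ultimately show "\<exists>X. is_solution I F X"
    unfolding is_solution_def by blast
next
  fix X Y assume XY: "is_solution I F X" "is_solution I F Y"
  have "agree n (X i) (Y i)" for n i
  proof (induction n arbitrary: i)
    case (Suc n)
    show ?case
    proof (cases "i \<in> I")
      case True
      hence X: "X i = graft i (mps_subst (F i) X)" and Y: "Y i = graft i (mps_subst (F i) Y)"
        using XY unfolding is_solution_def by blast+
      show ?thesis by (subst X, subst Y) (rule agree_graft_subst, rule Suc)
    qed (use XY in \<open>simp add: is_solution_def agree_def\<close>)
  qed (simp add: agree_def)
  thus "X = Y" by (intro ext mps_eqI) (metis agree_def lessI)
qed

lemma is_solution_solution: "is_solution I F (solution I F)"
  unfolding solution_def by (rule theI'[OF solution_exists_unique])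

definition sdse_algebra ::
    "'i set \<Rightarrow> ('i \<Rightarrow> ('i, 'k :: field_char_0) mps) \<Rightarrow> ('i, 'k) ck set" where
  "sdse_algebra I F = subalgebra hull {homogeneous_part n (solution I F i) | n i. i \<in> I}"

definition hopf_sdse :: "'i set \<Rightarrow> ('i \<Rightarrow> ('i, 'k :: field_char_0) mps) \<Rightarrow> bool" where
  "hopf_sdse I F \<longleftrightarrow> sdse I F \<and> hopf_subalgebra I (sdse_algebra I F)"

definition sdse_graph :: "'i set \<Rightarrow> ('i \<Rightarrow> ('i, 'k :: field_char_0) mps) \<Rightarrow> ('i \<times> 'i) set" where
  "sdse_graph I F = {(i, j). i \<in> I \<and> j \<in> I \<and> mps_deriv j (F i) \<noteq> 0}"

definition sdse_connected :: "'i set \<Rightarrow> ('i \<Rightarrow> ('i, 'k :: field_char_0) mps) \<Rightarrow> bool" where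
  "sdse_connected I F \<longleftrightarrow>
     (\<forall>i\<in>I. \<forall>j\<in>I. (i, j) \<in> (sdse_graph I F \<union> (sdse_graph I F)\<inverse>)\<^sup>*)"

definition tree_coeff ::
    "'i set \<Rightarrow> ('i \<Rightarrow> ('i, 'k :: field_char_0) mps) \<Rightarrow> 'i rtree \<Rightarrow> 'k" where
  "tree_coeff I F t = mcoeff (solution I F (root t)) {#t#}"

definition level_coeff ::
    "'i set \<Rightarrow> ('i \<Rightarrow> ('i, 'k :: field_char_0) mps) \<Rightarrow> 'i \<Rightarrow> 'i \<Rightarrow> nat \<Rightarrow> 'k" where
  "level_coeff I F i j n = (THE c. \<forall>t'\<in>trees I i n.
     (\<Sum>t\<in>trees I i (n + 1). of_nat (leaf_count j t t') * tree_coeff I F t) = c * tree_coeff I F t')"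

definition finite_level :: "'i set \<Rightarrow> ('i \<Rightarrow> ('i, 'k :: field_char_0) mps) \<Rightarrow> 'i \<Rightarrow> bool" where
  "finite_level I F i \<longleftrightarrow>
     (\<exists>M. \<forall>j\<in>I. \<exists>b a. \<forall>n>M. level_coeff I F i j n = b * (of_nat n - 1) + a)"


section \<open>Operations on systems\<close>

definition change_of_variables ::
    "'i set \<Rightarrow> ('i \<Rightarrow> ('i, 'k :: field_char_0) mps) \<Rightarrow> ('i \<Rightarrow> ('i, 'k) mps) \<Rightarrow> bool" where
  "change_of_variables I F F' \<longleftrightarrow> (\<exists>l. (\<forall>j\<in>I. l j \<noteq> 0) \<and>
     (\<forall>i\<in>I. F' i = mps_subst (F i) (\<lambda>j. mps_const (l j) * mps_var j)))"

definition dilatation ::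
    "'i set \<Rightarrow> ('i \<Rightarrow> ('i, 'k :: field_char_0) mps) \<Rightarrow> 'j set \<Rightarrow> ('j \<Rightarrow> ('j, 'k) mps) \<Rightarrow> bool" where
  "dilatation I F J F' \<longleftrightarrow> finite J \<and>
     (\<exists>P. (\<forall>i\<in>I. P i \<noteq> {}) \<and> disjoint_family_on P I \<and> (\<Union>i\<in>I. P i) = J \<and>
        (\<forall>i\<in>I. \<forall>x\<in>P i. F' x = mps_subst (F i) (\<lambda>j. \<Sum>y\<in>P j. mps_var y)))"

definition extension ::
    "'i set \<Rightarrow> ('i \<Rightarrow> ('i, 'k :: field_char_0) mps) \<Rightarrow> 'i set \<Rightarrow> ('i \<Rightarrow> ('i, 'k) mps) \<Rightarrow> bool" where
  "extension I F I' F' \<longleftrightarrow> hopf_sdse I F \<and>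
     (\<exists>z a. z \<notin> I \<and> I' = insert z I \<and> (\<forall>i\<in>I. F' i = F i) \<and>
        F' z = 1 + (\<Sum>i\<in>I. mps_const (a i) * mps_var i) \<and> mps_nonconstant (F' z) \<and>
        (\<forall>i\<in>I. \<forall>j\<in>I. a i \<noteq> 0 \<and> a j \<noteq> 0 \<longrightarrow> F i = F j))"


section \<open>Fundamental systems\<close>

text \<open>
  \<open>fser \<beta> l\<close> is \<open>f\<^bsub>\<beta>/l\<^esub>(l h)\<close>, which is \<open>1\<close> for \<open>l = 0\<close>, and \<open>f\<^sub>\<beta>(h)\<close> is \<open>fser \<beta> 1\<close>.
  \<open>lser a \<beta>\<close> is \<open>- (a/\<beta>) ln (1 - \<beta> h)\<close>, which is \<open>a h\<close> for \<open>\<beta> = 0\<close>; \<open>fps_ln 1\<close> is \<open>ln (1 + h)\<close>.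
\<close>

definition fser :: "'k :: field_char_0 \<Rightarrow> 'k \<Rightarrow> 'k fps" where
  "fser \<beta> l = Abs_fps (\<lambda>k. (\<Prod>r<k. l + of_nat r * \<beta>) / fact k)"

definition lser :: "'k :: field_char_0 \<Rightarrow> 'k \<Rightarrow> 'k fps" where
  "lser a \<beta> = (if \<beta> = 0 then fps_const a * fps_X
     else fps_const (- (a / \<beta>)) * fps_compose (fps_ln 1) (fps_const (- \<beta>) * fps_X))"

text \<open>
  The scalars \<open>a\<^sub>j\<^sup>(\<^sup>i\<^sup>)\<close> are written \<open>a i j\<close>; the \<open>b t\<close> in the last clause is the common value of
  \<open>a j t\<close> for those \<open>j \<in> I\<^sub>1\<close> on which the vertex \<open>i\<close> depends.
\<close>

definition basic_system :: "'i set \<Rightarrow> ('i \<Rightarrow> ('i, 'k :: field_char_0) mps) \<Rightarrow> bool" where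
  "basic_system I F \<longleftrightarrow> (\<exists>I0 J0 K0 I1 J1 \<beta> \<nu> a.
     finite I \<and> I = I0 \<union> J0 \<union> K0 \<union> I1 \<union> J1 \<and>
     I0 \<inter> J0 = {} \<and> (I0 \<union> J0) \<inter> K0 = {} \<and> (I0 \<union> J0 \<union> K0) \<inter> I1 = {} \<and>
     (I0 \<union> J0 \<union> K0 \<union> I1) \<inter> J1 = {} \<and>
     I0 \<union> J0 \<noteq> {} \<and>
     (\<forall>i\<in>I. mps_nonconstant (F i)) \<and>
     (\<forall>i\<in>I0. F i = mps_in (fser (\<beta> i) 1) i *
        (\<Prod>j\<in>I0 - {i}. mps_in (fser (\<beta> j) (1 + \<beta> j)) j) * (\<Prod>j\<in>J0. mps_in (fser 1 1) j)) \<and>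
     (\<forall>i\<in>J0. F i =
        (\<Prod>j\<in>I0. mps_in (fser (\<beta> j) (1 + \<beta> j)) j) * (\<Prod>j\<in>J0 - {i}. mps_in (fser 1 1) j)) \<and>
     (\<forall>i\<in>K0. F i =
        (\<Prod>j\<in>I0. mps_in (fser (\<beta> j) (1 + \<beta> j)) j) * (\<Prod>j\<in>J0. mps_in (fser 1 1) j)) \<and>
     (\<forall>i\<in>I1.
        (\<nu> i \<noteq> 1 \<or> (\<exists>j\<in>I0. a i j \<noteq> 1 + \<beta> j) \<or> (\<exists>j\<in>J0. a i j \<noteq> 1) \<or> (\<exists>j\<in>K0. a i j \<noteq> 0)) \<and>
        (\<nu> i \<noteq> 0 \<longrightarrow> F i =
           mps_const (1 / \<nu> i) *
             ((\<Prod>j\<in>I0. mps_in (fser (\<beta> j) (\<nu> i * a i j)) j) *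
              (\<Prod>j\<in>J0. mps_in (fser 1 (\<nu> i * a i j)) j) *
              (\<Prod>j\<in>K0. mps_in (fser 0 (\<nu> i * a i j)) j)) + 1 - mps_const (1 / \<nu> i)) \<and>
        (\<nu> i = 0 \<longrightarrow> F i =
           1 + (\<Sum>j\<in>I0. mps_in (lser (a i j) (\<beta> j)) j) + (\<Sum>j\<in>J0. mps_in (lser (a i j) 1) j) +
             (\<Sum>j\<in>K0. mps_const (a i j) * mps_var j))) \<and>
     (\<forall>i\<in>J1. let D = {j \<in> I1. a i j \<noteq> 0} in
        \<nu> i \<noteq> 0 \<and> D \<noteq> {} \<and> (\<forall>j\<in>D. \<nu> j = 1) \<and> (\<forall>j\<in>D. \<forall>k\<in>D. F j = F k) \<and>
        (\<exists>b. (\<forall>j\<in>D. \<forall>t\<in>I0 \<union> J0 \<union> K0. b t = a j t) \<and>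
           F i = mps_const (1 / \<nu> i) *
             ((\<Prod>j\<in>I0. mps_in (fser (\<beta> j) (b j - 1 - \<beta> j)) j) *
              (\<Prod>j\<in>J0. mps_in (fser 1 (b j - 1)) j) *
              (\<Prod>j\<in>K0. mps_in (fser 0 (b j)) j)) +
             (\<Sum>j\<in>D. mps_const (a i j) * mps_var j) + 1 - mps_const (1 / \<nu> i))))"

text \<open>
  Dilatation does not decrease the number of vertices, so up to renaming the basic system may be
  taken over the same type of vertices.
\<close>

definition fundamental :: "'i set \<Rightarrow> ('i \<Rightarrow> ('i, 'k :: field_char_0) mps) \<Rightarrow> bool" where
  "fundamental J F' \<longleftrightarrow> (\<exists>(I :: 'i set) F G.
     basic_system I F \<and> dilatation I F J G \<and> change_of_variables J G F')"

inductive fundamental_extended :: "'i set \<Rightarrow> ('i \<Rightarrow> ('i, 'k :: field_char_0) mps) \<Rightarrow> bool" where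
  fundamental: "fundamental I F \<Longrightarrow> fundamental_extended I F"
| extension: "fundamental_extended I F \<Longrightarrow> extension I F I' F' \<Longrightarrow> fundamental_extended I' F'"

end

theory Submission
  imports Defs
begin

text \<open>
  The terms of \<open>\<Delta>(X\<^sub>i(n + 1))\<close> with a single leaf \<open>j\<close> on the left show that in a Hopf system
  the numbers \<open>\<lambda>\<^sub>n\<^sup>(\<^sup>i\<^sup>,\<^sup>j\<^sup>)\<close> exist. Testing them on the trees whose branches have roots
  \<open>r\<^sub>1, \<dots>, r\<^sub>k\<close> and arbitrary sizes \<open>n\<^sub>1, \<dots>, n\<^sub>k\<close> gives, for the divided power coefficients
  \<open>\<phi>\<^sub>i\<close> of \<open>F\<^sub>i\<close>, the relation \<open>\<phi>\<^sub>i(j r\<^sub>1\<dots>r\<^sub>k) = (\<lambda>\<^sub>n\<^sup>(\<^sup>i\<^sup>,\<^sup>j\<^sup>) - \<Sum>\<^sub>s \<lambda>\<^bsub>n\<^sub>s\<^esub>\<^bsup>(r\<^sub>s,j)\<^esup>) \<phi>\<^sub>i(r\<^sub>1\<dots>r\<^sub>k)\<close>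
  with \<open>n = 1 + n\<^sub>1 + \<dots> + n\<^sub>k\<close>, which carries all the information needed about the system.

  Along an edge the slopes \<open>b\<^sub>j\<close> of \<open>\<lambda>\<^sub>n\<^sup>(\<^sup>i\<^sup>,\<^sup>j\<^sup>)\<close> agree and the level drops by one (or stays \<open>0\<close>).
  Hence a vertex of maximal level has no parents if that level is positive, and if it is at least
  \<open>2\<close>, the relation for \<open>k = 2\<close> forces its series to be linear with children having equal
  series. Such a vertex is an extension; so is any vertex of level \<open>1\<close> with a linear series
  once there are no levels above \<open>1\<close>. These vertices are removed one at a time, which preserves
  the Hopf property.

  In the remaining systems \<open>\<phi>\<^sub>i\<close> is determined by the recursion
  \<open>\<phi>\<^sub>i(j p) = (\<sigma>\<^sub>i\<^sub>j + \<Sum>\<^bsub>l \<in> p\<^esub> c\<^sub>j\<^sub>l) \<phi>\<^sub>i(p)\<close>, \<open>c\<^sub>j\<^sub>l = b\<^sub>j - a\<^sub>j\<^sup>(\<^sup>l\<^sup>)\<close>. Comparing both orders of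
  adding two vertices shows that \<open>c\<^sub>j\<^sub>k \<noteq> 0\<close> makes the data of \<open>j\<close> and \<open>k\<close> proportional. After a
  change of variables they coincide, \<open>c\<close> becomes diagonal on classes, and the recursion is
  solved by the series of a fundamental system.
\<close>

section \<open>Divided power coefficients\<close>

text \<open>Removing a vertex can disconnect the graph. The induction therefore carries one family
  of slopes \<open>b\<close> that is valid at every vertex; connectedness serves once, to produce
  it. The numbers \<open>lam\<close> are carried along as parameters as well, so that nothing has to
  be recomputed for a smaller system. An extension is built over a Hopf system, hence each removal
  needs the smaller algebra to be Hopf. It consists of the elements of the larger algebra supported
  on forests over the remaining decorations. The coproduct clearly preserves such supports; for the
  antipode this comes from the triangular form of its defining equation. The two orders of adding
  \<open>j\<close> and \<open>k\<close> give \<open>c k j * x j = c j k * x k\<close> for the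
  columns \<open>x\<close> of the data, but for \<open>a\<close> only at vertices of level 0. At
  level one the constancy of \<open>a\<close> on classes comes from a nonzero quadratic coefficient,
  which is why linear vertices of level one are removed beforehand. One kind of level 0 vertex
  resists the diagonal form of \<open>c\<close>: zero diagonal data, but a row of \<open>a\<close>
  different from \<open>b\<close>. Such vertices go to \<open>I1\<close>; as variables they occur
  only linearly, which produces the linear sums in the series of \<open>J1\<close>.\<close>

definition mfact :: "'v multiset \<Rightarrow> nat" where
  "mfact m = (\<Prod>v\<in>set_mset m. fact (count m v))"

lemma mfact_empty [simp]: "mfact {#} = 1"
  by (simp add: mfact_def)

lemma mfact_superset:
  assumes "finite A" "set_mset m \<subseteq> A"
  shows "mfact m = (\<Prod>v\<in>A. fact (count m v))"
  unfolding mfact_def using assms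
  by (intro prod.mono_neutral_left) (auto simp: not_in_iff)

lemma mfact_add_mset [simp]: "mfact (add_mset v m) = Suc (count m v) * mfact m"
proof -
  let ?A = "insert v (set_mset m)"
  have "mfact (add_mset v m) = (\<Prod>w\<in>?A. fact (count (add_mset v m) w))"
    by (simp add: mfact_def)
  also have "\<dots> = fact (Suc (count m v)) * (\<Prod>w\<in>?A - {v}. fact (count (add_mset v m) w))"
    by (subst prod.remove[where x = v]) auto
  also have "(\<Prod>w\<in>?A - {v}. fact (count (add_mset v m) w)) = (\<Prod>w\<in>?A - {v}. fact (count m w) :: nat)"
    by (intro prod.cong) auto
  also have "fact (Suc (count m v)) * \<dots> = Suc (count m v) * (\<Prod>w\<in>?A. fact (count m w))"
    by (subst (2) prod.remove[where x = v]) (auto simp: algebra_simps)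
  also have "(\<Prod>w\<in>?A. fact (count m w)) = mfact m"
    by (rule mfact_superset[symmetric]) auto
  finally show ?thesis .
qed

lemma mfact_pos [simp]: "mfact m > 0"
  by (induction m) auto

lemma mfact_nonzero [simp]: "of_nat (mfact m) \<noteq> (0 :: 'k :: field_char_0)"
  using mfact_pos[of m] by (simp del: mfact_pos)

lemma mfact_remove: "v \<in># m \<Longrightarrow> mfact m = count m v * mfact (m - {#v#})"
  by (metis count_add_mset insert_DiffM mfact_add_mset)

text \<open>
  Coefficients with respect to divided powers: substituting linear forms in distinct variables
  only multiplies them by scalars (\<open>dpc_subst_linear\<close>).
\<close>

definition dpc :: "('v, 'k :: field_char_0) mps \<Rightarrow> 'v multiset \<Rightarrow> 'k" where
  "dpc F m = mcoeff F m * of_nat (mfact m)"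

lemma mcoeff_eq_dpc: "mcoeff F m = dpc F m / of_nat (mfact m)"
  by (simp add: dpc_def)

lemma dpc_eqI: "(\<And>m. dpc F m = dpc G m) \<Longrightarrow> F = G"
  by (intro mps_eqI) (simp add: mcoeff_eq_dpc)

lemma dpc_eq_0_iff: "dpc F m = 0 \<longleftrightarrow> mcoeff F m = 0"
  unfolding dpc_def using mfact_nonzero mult_eq_0_iff by blast

lemma mcoeff_linear_mult:
  fixes X G :: "('w, 'k :: comm_ring_1) mps"
  assumes "\<And>m. size m \<noteq> 1 \<Longrightarrow> mcoeff X m = 0"
  shows "mcoeff (X * G) m = (\<Sum>w\<in>set_mset m. mcoeff X {#w#} * mcoeff G (m - {#w#}))"
proof -
  have "mcoeff (X * G) m = (\<Sum>a\<in>(\<lambda>w. {#w#}) ` set_mset m. mcoeff X a * mcoeff G (m - a))"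
    unfolding times_mps.rep_eq
  proof (rule sum.mono_neutral_right)
    show "\<forall>a\<in>{a. a \<subseteq># m} - (\<lambda>w. {#w#}) ` set_mset m. mcoeff X a * mcoeff G (m - a) = 0"
    proof
      fix a assume a: "a \<in> {a. a \<subseteq># m} - (\<lambda>w. {#w#}) ` set_mset m"
      have "size a \<noteq> 1"
      proof
        assume "size a = 1"
        then obtain w where "a = {#w#}" by (metis size_1_singleton_mset)
        thus False using a by auto
      qed
      thus "mcoeff X a * mcoeff G (m - a) = 0" using assms by simp
    qed
  qed auto
  also have "\<dots> = (\<Sum>w\<in>set_mset m. mcoeff X {#w#} * mcoeff G (m - {#w#}))"
    by (subst sum.reindex) (auto simp: inj_on_def)
  finally show ?thesis .
qed

text \<open>Each variable \<open>w\<close> occurs in only one of the forms, \<open>X (r w)\<close>,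
  so a monomial \<open>m\<close> arises only from \<open>n = image_mset r m\<close>. The factorials
  account for the n!/m! ways of distributing the variables of \<open>m\<close> over the
  factors.\<close>

lemma mcoeff_prod_linear:
  fixes X :: "'v \<Rightarrow> ('w, 'k :: field_char_0) mps"
  assumes lin: "\<And>v m. v \<in> V \<Longrightarrow> size m \<noteq> 1 \<Longrightarrow> mcoeff (X v) m = 0"
    and X: "\<And>v w. v \<in> V \<Longrightarrow> mcoeff (X v) {#w#} = (if r w = v then x w else 0)"
    and "set_mset n \<subseteq> V"
  shows "mcoeff (\<Prod>v\<in>#n. X v) m * of_nat (mfact m) =
         (if image_mset r m = n then of_nat (mfact n) * (\<Prod>w\<in>#m. x w) else 0)"
  using assms(3)
proof (induction n arbitrary: m)
  case empty
  show ?case by (simp add: one_mps.rep_eq)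
next
  case (add v n)
  let ?c = "if image_mset r m = add_mset v n then of_nat (mfact n) * (\<Prod>w\<in>#m. x w) else 0"
  have v: "v \<in> V" and n: "set_mset n \<subseteq> V" using add.prems by auto
  have "mcoeff (\<Prod>v\<in>#add_mset v n. X v) m * of_nat (mfact m)
      = (\<Sum>w\<in>set_mset m. (if r w = v then x w else 0) *
          (mcoeff (\<Prod>v\<in>#n. X v) (m - {#w#}) * of_nat (mfact m)))"
    using v by (simp add: mcoeff_linear_mult lin X sum_distrib_right mult.assoc)
  also have "\<dots> = (\<Sum>w\<in>set_mset m. if r w = v then of_nat (count m w) * ?c else 0)"
  proof (rule sum.cong)
    fix w assume w: "w \<in># m"
    then obtain m' where m: "m = add_mset w m'" by (metis multi_member_split)
    have "mcoeff (\<Prod>v\<in>#n. X v) m' * of_nat (mfact m) =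
          of_nat (count m w) * (mcoeff (\<Prod>v\<in>#n. X v) m' * of_nat (mfact m'))"
      by (simp add: m algebra_simps)
    also have "\<dots> = of_nat (count m w) *
        (if image_mset r m' = n then of_nat (mfact n) * (\<Prod>w\<in>#m'. x w) else 0)"
      using add.IH[OF n] by simp
    finally show "(if r w = v then x w else 0) *
          (mcoeff (\<Prod>v\<in>#n. X v) (m - {#w#}) * of_nat (mfact m)) =
        (if r w = v then of_nat (count m w) * ?c else 0)"
      by (auto simp: m)
  qed simp
  also have "\<dots> = (\<Sum>w\<in>{w \<in> set_mset m. r w = v}. of_nat (count m w) * ?c)"
    by (subst sum.inter_filter[symmetric]) auto
  \<comment> \<open>The multiplicities in \<open>m\<close> over the fibre of \<open>v\<close> add up
    to that of \<open>v\<close> in \<open>add_mset v n\<close>, the factor by which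
    \<open>mfact n\<close> grows.\<close>
  also have "\<dots> = of_nat (count (image_mset r m) v) * ?c"
    unfolding count_image_mset by (simp add: sum_distrib_right vimage_def Int_def conj_commute)
  also have "\<dots> = (if image_mset r m = add_mset v n
      then of_nat (mfact (add_mset v n)) * (\<Prod>w\<in>#m. x w) else 0)"
    by (auto simp: algebra_simps)
  finally show ?case .
qed

text \<open>One statement for three substitutions: the solution into the series
  (\<open>r = root\<close>), rescaling of variables (\<open>r = id\<close>), and the sums over
  classes in a dilatation.\<close>

lemma dpc_subst_linear:
  fixes X :: "'v \<Rightarrow> ('w, 'k :: field_char_0) mps"
  assumes lin: "\<And>v m. v \<in> V \<Longrightarrow> size m \<noteq> 1 \<Longrightarrow> mcoeff (X v) m = 0"
    and X: "\<And>v w. v \<in> V \<Longrightarrow> mcoeff (X v) {#w#} = (if r w = v then x w else 0)"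
    and F: "mps_over V F"
  shows "dpc (mps_subst F X) m = dpc F (image_mset r m) * (\<Prod>w\<in>#m. x w)"
proof -
  let ?g = "\<lambda>n. mcoeff F n * mcoeff (\<Prod>v\<in>#n. X v) m"
  have g: "?g n * of_nat (mfact m) = (if image_mset r m = n then dpc F n * (\<Prod>w\<in>#m. x w) else 0)" for n
  proof (cases "mcoeff F n = 0")
    case False
    hence "set_mset n \<subseteq> V" using F by (auto simp: mps_over_def)
    from mcoeff_prod_linear[OF lin X this, where m = m]
    show ?thesis by (simp add: dpc_def mult.assoc)
  qed (simp add: dpc_def)
  have "?g n = 0" if "n \<noteq> image_mset r m" for n
    using g[of n] that mfact_nonzero[of m, where ?'k = 'k] by (metis mult_eq_0_iff)
  hence "Sum_any ?g = ?g (image_mset r m)"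
    by (subst Sum_any.expand_superset[of "{image_mset r m}"]) auto
  thus ?thesis using g[of "image_mset r m"] by (simp add: dpc_def mps_subst.rep_eq)
qed

lemma mps_subst_cong:
  assumes "mps_over V F" "\<And>v. v \<in> V \<Longrightarrow> X v = Y v"
  shows "mps_subst F X = mps_subst F Y"
proof (rule mps_eqI)
  fix m
  have "mcoeff F n * mcoeff (\<Prod>v\<in>#n. X v) m = mcoeff F n * mcoeff (\<Prod>v\<in>#n. Y v) m" for n
  proof (cases "mcoeff F n = 0")
    case False
    hence "set_mset n \<subseteq> V" using assms(1) by (auto simp: mps_over_def)
    hence "image_mset X n = image_mset Y n" using assms(2) by (intro image_mset_cong) auto
    thus ?thesis by simp
  qed simp
  thus "mcoeff (mps_subst F X) m = mcoeff (mps_subst F Y) m" by (simp add: mps_subst.rep_eq)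
qed

lemma mcoeff_const_mult [simp]: "mcoeff (mps_const x * F) m = x * mcoeff F m"
proof -
  have "mcoeff (mps_const x * F) m = (\<Sum>a\<in>{{#}}. mcoeff (mps_const x) a * mcoeff F (m - a))"
    unfolding times_mps.rep_eq by (rule sum.mono_neutral_right) (auto simp: mps_const.rep_eq)
  thus ?thesis by (simp add: mps_const.rep_eq)
qed

lemma dpc_subst_scale_vars:
  assumes "mps_over V F" "\<And>v. v \<in> V \<Longrightarrow> X v = mps_const (l v) * mps_var v"
  shows "dpc (mps_subst F X) m = dpc F m * (\<Prod>v\<in>#m. l v)"
proof -
  have "dpc (mps_subst F X) m = dpc F (image_mset id m) * (\<Prod>v\<in>#m. l v)"
    using assms(1) by (intro dpc_subst_linear[where V = V]) (auto simp: assms(2) mps_var.rep_eq)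
  thus ?thesis by simp
qed

lemma mcoeff_sum [simp]: "mcoeff (\<Sum>x\<in>A. f x) m = (\<Sum>x\<in>A. mcoeff (f x) m)"
  by (induction A rule: infinite_finite_induct) (auto simp: zero_mps.rep_eq plus_mps.rep_eq)

lemma dpc_subst_merge_vars:
  assumes F: "mps_over V F" and X: "\<And>v. v \<in> V \<Longrightarrow> X v = (\<Sum>w\<in>P v. mps_var (w :: 'w))"
    and P: "\<And>v. v \<in> V \<Longrightarrow> P v = {w \<in> J. r w = v}" and "finite J"
  shows "dpc (mps_subst F X) m = (if set_mset m \<subseteq> J then dpc F (image_mset r m) else 0)"
proof -
  have fin: "finite (P v)" if "v \<in> V" for v using P[OF that] \<open>finite J\<close> by simp
  have "dpc (mps_subst F X) m = dpc F (image_mset r m) * (\<Prod>w\<in>#m. if w \<in> J then 1 else 0)"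
  proof (rule dpc_subst_linear[OF _ _ F])
    fix v w assume v: "v \<in> V"
    have "mcoeff (X v) {#w#} = (\<Sum>u\<in>P v. if u = w then 1 else 0)"
      using v by (auto simp: X mps_var.rep_eq intro!: sum.cong)
    also have "\<dots> = (if r w = v then if w \<in> J then 1 else 0 else 0)"
      using fin[OF v] by (simp add: sum.delta P[OF v])
    finally show "mcoeff (X v) {#w#} = (if r w = v then if w \<in> J then 1 else 0 else 0)" .
  next
    fix v and m :: "'w multiset" assume "v \<in> V" "size m \<noteq> 1"
    thus "mcoeff (X v) m = 0" by (auto simp: X mps_var.rep_eq intro!: sum.neutral)
  qed
  moreover have "(\<Prod>w\<in>#m. if w \<in> J then 1 else 0) = (if set_mset m \<subseteq> J then 1 else 0 :: 'b)"
    by (induction m) auto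
  ultimately show ?thesis by simp
qed

lemma mcoeff_prod_mps_in:
  assumes "finite A"
  shows "mcoeff (\<Prod>j\<in>A. mps_in (g j) j) m =
    (if set_mset m \<subseteq> A then \<Prod>j\<in>A. fps_nth (g j) (count m j) else 0)"
  using assms
proof (induction A arbitrary: m)
  case empty
  show ?case by (simp add: one_mps.rep_eq)
next
  case (insert v A)
  \<comment> \<open>The factor in \<open>v\<close> must take all copies of \<open>v\<close> from
    \<open>m\<close>, because the other factors do not involve \<open>v\<close>.\<close>
  let ?a = "replicate_mset (count m v) v"
  have sub: "?a \<subseteq># m" by (simp add: count_le_replicate_mset_subset_eq[symmetric])
  have cnt: "count (m - ?a) w = (if w = v then 0 else count m w)" for w by simp
  have "mcoeff (\<Prod>j\<in>insert v A. mps_in (g j) j) m =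
      (\<Sum>a\<in>{?a}. mcoeff (mps_in (g v) v) a * mcoeff (\<Prod>j\<in>A. mps_in (g j) j) (m - a))"
    unfolding prod.insert[OF insert.hyps] times_mps.rep_eq
  proof (rule sum.mono_neutral_right)
    show "\<forall>a\<in>{a. a \<subseteq># m} - {?a}. mcoeff (mps_in (g v) v) a * mcoeff (\<Prod>j\<in>A. mps_in (g j) j) (m - a) = 0"
    proof
      fix a assume a: "a \<in> {a. a \<subseteq># m} - {?a}"
      show "mcoeff (mps_in (g v) v) a * mcoeff (\<Prod>j\<in>A. mps_in (g j) j) (m - a) = 0"
      proof (cases "set_mset a \<subseteq> {v}")
        case True
        then obtain n where n: "a = replicate_mset n v"
          by (metis set_mset_subset_singletonD size_replicate_mset)
        hence "n < count m v" using a by (auto simp: count_le_replicate_mset_subset_eq[symmetric] le_less)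
        hence "v \<in># m - a" by (simp add: n flip: count_greater_zero_iff)
        hence "\<not> set_mset (m - a) \<subseteq> A" using insert.hyps by auto
        thus ?thesis by (simp add: insert.IH)
      qed (simp add: mps_in.rep_eq)
    qed
  qed (use sub in auto)
  also have "\<dots> = fps_nth (g v) (count m v) *
      (if set_mset (m - ?a) \<subseteq> A then \<Prod>j\<in>A. fps_nth (g j) (count (m - ?a) j) else 0)"
    by (simp add: mps_in.rep_eq insert.IH)
  also have "set_mset (m - ?a) = set_mset m - {v}"
    by (auto simp: in_diff_count split: if_splits)
  also have "(\<Prod>j\<in>A. fps_nth (g j) (count (m - ?a) j)) = (\<Prod>j\<in>A. fps_nth (g j) (count m j))"
    using insert.hyps by (intro prod.cong) auto
  also have "set_mset m - {v} \<subseteq> A \<longleftrightarrow> set_mset m \<subseteq> insert v A" by auto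
  finally show ?case using insert.hyps by auto
qed

lemma dpc_prod_mps_in:
  assumes "finite A"
  shows "dpc (\<Prod>j\<in>A. mps_in (g j) j) m =
    (if set_mset m \<subseteq> A then \<Prod>j\<in>A. fps_nth (g j) (count m j) * fact (count m j) else 0)"
  using assms mfact_superset[OF assms, of m]
  by (auto simp: dpc_def mcoeff_prod_mps_in of_nat_prod prod.distrib)

lemma fser_nth_fact: "fps_nth (fser \<beta> l) k * fact k = (\<Prod>s<k. l + of_nat s * \<beta>)"
  by (simp add: fser_def)

text \<open>Successive divided power coefficients have the ratios of \<open>fser\<close> with
  \<open>l = 0\<close>, but start from \<open>a\<close> in degree one. Hence the logarithm replaces
  the power when the parameter \<open>\<nu>\<close> vanishes.\<close>

lemma lser_nth_fact: "fps_nth (lser a \<beta>) (Suc k) * fact (Suc k) = a * \<beta> ^ k * fact k"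
proof (cases "\<beta> = 0")
  case False
  have "fps_nth (fps_compose (fps_ln 1) (fps_const (- \<beta>) * fps_X)) (Suc k) = (- \<beta>) ^ Suc k * fps_nth (fps_ln 1) (Suc k)"
    by (simp add: fps_compose_linear)
  also have "\<dots> = - (\<beta> ^ Suc k) / of_nat (Suc k)"
    by (simp add: fps_ln_def power_minus')
  finally show ?thesis using False
    by (simp add: lser_def field_simps del: of_nat_Suc)
qed (cases k; simp add: lser_def)

lemma lser_nth_0 [simp]: "fps_nth (lser a \<beta>) 0 = 0"
  by (simp add: lser_def fps_ln_def)

section \<open>Cutting a leaf\<close>

text \<open>Replaces paths in a planar representative by a recursion on the abstract tree. The
  result is a multiset because distinct leaves may leave the same tree behind.\<close>

function leaf_prunings :: "'i \<Rightarrow> 'i rtree \<Rightarrow> 'i rtree multiset" where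
  "leaf_prunings j (Node i f) = (\<Sum>s\<in>#f.
     (if s = Node j {#} then {#Node i (f - {#s#})#} else {#}) +
     image_mset (\<lambda>s'. Node i (add_mset s' (f - {#s#}))) (leaf_prunings j s))"
  by pat_completeness auto
termination
proof (relation "measure (\<lambda>(j, t). vertices t)")
  fix j i :: 'a and f and s :: "'a rtree" assume "s \<in># f"
  hence "vertices s \<le> forest_vertices f" by (rule vertices_member)
  thus "((j, s), (j, Node i f)) \<in> measure (\<lambda>(j, t). vertices t)"
    by (simp add: forest_vertices_def)
qed simp

lemma in_sum_mset_image: "x \<in># (\<Sum>s\<in>#f. h s) \<longleftrightarrow> (\<exists>s\<in>#f. x \<in># h s)"
  by (induction f) auto

lemma leaf_prunings_cases:
  assumes "t' \<in># leaf_prunings j (Node i f)"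
  obtains g where "f = add_mset (Node j {#}) g" "t' = Node i g"
  | s s' g where "f = add_mset s g" "s' \<in># leaf_prunings j s" "t' = Node i (add_mset s' g)"
proof -
  obtain s where s: "s \<in># f" and t': "t' \<in>#
     (if s = Node j {#} then {#Node i (f - {#s#})#} else {#}) +
     image_mset (\<lambda>s'. Node i (add_mset s' (f - {#s#}))) (leaf_prunings j s)"
    using assms unfolding leaf_prunings.simps in_sum_mset_image by (elim bexE)
  obtain g where f: "f = add_mset s g" using s by (metis multi_member_split)
  consider "s = Node j {#}" "t' = Node i g"
    | s' where "s' \<in># leaf_prunings j s" "t' = Node i (add_mset s' g)"
    using t' unfolding f add_mset_remove_trivial union_iff by (auto simp only: in_image_mset multi_member_this set_mset_single set_mset_empty split: if_splits)
  thus thesis using that f by cases simp_all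
qed

declare leaf_prunings.simps [simp del]

lemma root_leaf_prunings: "s \<in># leaf_prunings j t \<Longrightarrow> root s = root t"
  by (cases t) (auto elim: leaf_prunings_cases)

lemma is_vertex_PNode: "is_vertex (PNode i ts) q \<longleftrightarrow>
    q = [] \<or> (\<exists>k r. q = k # r \<and> k < length ts \<and> is_vertex (ts ! k) r)"
  by (cases q) auto

lemma finite_is_vertex: "finite {q. is_vertex p q}"
proof (induction p)
  case (PNode i ts)
  have "{q. is_vertex (PNode i ts) q} = insert [] (\<Union>k<length ts. (#) k ` {q. is_vertex (ts ! k) q})"
    by (auto simp: is_vertex_PNode)
  thus ?case using PNode by simp
qed

lemma finite_leaves: "finite (leaves p)"
  by (rule finite_subset[OF _ finite_is_vertex[of p]]) (auto simp: leaves_def)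

lemma finite_admissible_cuts: "finite (admissible_cuts p)"
proof (rule finite_subset)
  show "admissible_cuts p \<subseteq> Pow {q. is_vertex p q}" by (auto simp: admissible_cuts_def edges_def)
qed (simp add: finite_is_vertex)

lemma prune_empty [simp]: "prune {} p = p"
proof (induction p)
  case (PNode i ts)
  have "map (\<lambda>k. prune {} (ts ! k)) [0..<length ts] = map (\<lambda>k. ts ! k) [0..<length ts]"
    using PNode by (intro map_cong) auto
  thus ?case by (simp add: map_nth)
qed

text \<open>\<open>component\<close> cuts a subtree by the continuations of its path inside the cut;
  these include \<open>[]\<close> when the path itself belongs to the cut.\<close>

lemma prune_insert_Nil [simp]: "prune (insert [] c) p = prune c p"
  by (cases p) simp

lemma prune_child:
  assumes "k < length ts"
  shows "shape (prune {[k]} (PNode i ts)) = Node i (mset (map shape ts) - {#shape (ts ! k)#})"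
proof -
  have "mset (map shape (map (\<lambda>k. ts ! k) (filter (\<lambda>k'. k' \<noteq> k) [0..<length ts])))
      = image_mset (\<lambda>k. shape (ts ! k)) (filter_mset (\<lambda>k'. k' \<noteq> k) (mset [0..<length ts]))"
    by (simp add: image_mset.compositionality o_def)
  also have "filter_mset (\<lambda>k'. k' \<noteq> k) (mset [0..<length ts]) = mset [0..<length ts] - {#k#}"
    using assms by (intro multiset_eqI) (auto simp: count_mset_set')
  also have "image_mset (\<lambda>k. shape (ts ! k)) \<dots> =
      image_mset (\<lambda>k. shape (ts ! k)) (mset [0..<length ts]) - {#shape (ts ! k)#}"
    using assms by (subst image_mset_Diff) auto
  also have "image_mset (\<lambda>k. shape (ts ! k)) (mset [0..<length ts]) = mset (map shape ts)"
    unfolding mset_map[symmetric] by (rule arg_cong[where f = mset], rule nth_equalityI) auto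
  finally have *: "mset (map shape (map (\<lambda>k. ts ! k) (filter (\<lambda>k'. k' \<noteq> k) [0..<length ts])))
      = mset (map shape ts) - {#shape (ts ! k)#}" .
  have "prune {p. k' # p \<in> {[k]}} (ts ! k') = ts ! k'" if "k' \<noteq> k" for k'
    using that by simp
  hence "map (\<lambda>k'. prune {p. k' # p \<in> {[k]}} (ts ! k')) (filter (\<lambda>k'. [k'] \<notin> {[k]}) [0..<length ts])
       = map (\<lambda>k. ts ! k) (filter (\<lambda>k'. k' \<noteq> k) [0..<length ts])"
    by (intro map_cong) auto
  thus ?thesis using * by (simp only: prune.simps shape.simps)
qed

lemma prune_below:
  assumes "k < length ts" "l \<noteq> []"
  shows "shape (prune {k # l} (PNode i ts)) =
    Node i (add_mset (shape (prune {l} (ts ! k))) (image_mset shape (mset ts) - {#shape (ts ! k)#}))"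
proof -
  have "map (\<lambda>k'. prune {p. k' # p \<in> {k # l}} (ts ! k')) (filter (\<lambda>k'. [k'] \<notin> {k # l}) [0..<length ts])
       = map (\<lambda>k'. ts[k := prune {l} (ts ! k)] ! k') [0..<length ts]"
    using assms by (intro map_cong) (auto simp: nth_list_update)
  also have "\<dots> = ts[k := prune {l} (ts ! k)]"
    by (metis length_list_update map_nth)
  finally have "shape (prune {k # l} (PNode i ts)) = Node i (mset (map shape (ts[k := prune {l} (ts ! k)])))"
    by simp
  thus ?thesis using assms by (simp add: map_update mset_update)
qed

definition leaf_cuts :: "'i \<Rightarrow> 'i ptree \<Rightarrow> nat list set" where
  "leaf_cuts j p = {l \<in> leaves p. l \<noteq> [] \<and> proot (subtree p l) = j}"

lemma finite_leaf_cuts: "finite (leaf_cuts j p)"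
  using finite_leaves[of p] by (auto simp: leaf_cuts_def)

lemma Nil_notin_leaf_cuts: "[] \<notin> leaf_cuts j p"
  by (simp add: leaf_cuts_def)

lemma shape_eq_leaf: "shape p = Node j {#} \<longleftrightarrow> p = PNode j []"
  by (cases p) auto

lemma leaf_cuts_PNode:
  "leaf_cuts j (PNode i ts) = (\<Union>k<length ts.
     (if shape (ts ! k) = Node j {#} then {[k]} else {}) \<union> (#) k ` leaf_cuts j (ts ! k))"
  (is "?L = (\<Union>k<_. ?R k)")
proof (rule set_eqI)
  fix q
  show "q \<in> ?L \<longleftrightarrow> q \<in> (\<Union>k<length ts. ?R k)"
  proof (cases q)
    case (Cons k l)
    have "q \<in> ?L \<longleftrightarrow> k < length ts \<and>
        (if l = [] then shape (ts ! k) = Node j {#} else l \<in> leaf_cuts j (ts ! k))"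
      by (cases "ts ! k") (auto simp: Cons leaf_cuts_def leaves_def)
    moreover have "q \<in> (\<Union>k<length ts. ?R k) \<longleftrightarrow> k < length ts \<and> k # l \<in> ?R k"
      by (auto simp: Cons split: if_splits)
    moreover have "k # l \<in> ?R k \<longleftrightarrow>
        (if l = [] then shape (ts ! k) = Node j {#} else l \<in> leaf_cuts j (ts ! k))"
      by (auto simp: leaf_cuts_def)
    ultimately show ?thesis by simp
  qed (auto simp: leaf_cuts_def)
qed

lemma image_mset_mset_set_UN:
  assumes "finite A" "\<And>k. k \<in> A \<Longrightarrow> finite (B k)" "disjoint_family_on B A"
  shows "image_mset g (mset_set (\<Union>k\<in>A. B k)) = (\<Sum>k\<in>A. image_mset g (mset_set (B k)))"
  using assms
proof (induction A)
  case (insert a A)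
  have "B a \<inter> (\<Union>k\<in>A. B k) = {}" using insert by (auto simp: disjoint_family_on_def)
  moreover have "disjoint_family_on B A" using insert.prems by (auto simp: disjoint_family_on_def)
  ultimately show ?case using insert by (simp add: mset_set_Union)
qed simp

text \<open>The left side depends only on the shape, so counting leaves does not depend on the
  planar representative chosen in \<open>leaf_count\<close>.\<close>

lemma leaf_prunings_shape:
  "leaf_prunings j (shape p) = image_mset (\<lambda>l. shape (prune {l} p)) (mset_set (leaf_cuts j p))"
proof (induction p)
  case (PNode i ts)
  let ?f = "image_mset shape (mset ts)"
  let ?h = "\<lambda>s. (if s = Node j {#} then {#Node i (?f - {#s#})#} else {#}) +
     image_mset (\<lambda>s'. Node i (add_mset s' (?f - {#s#}))) (leaf_prunings j s)"
  let ?B = "\<lambda>k. (if shape (ts ! k) = Node j {#} then {[k]} else {}) \<union> (#) k ` leaf_cuts j (ts ! k)"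
  let ?g = "\<lambda>l. shape (prune {l} (PNode i ts))"
  have "image_mset ?g (mset_set (leaf_cuts j (PNode i ts))) =
        (\<Sum>k<length ts. image_mset ?g (mset_set (?B k)))"
    unfolding leaf_cuts_PNode
    by (rule image_mset_mset_set_UN) (auto simp: disjoint_family_on_def finite_leaf_cuts)
  also have "\<dots> = (\<Sum>k<length ts. ?h (shape (ts ! k)))"
  proof (rule sum.cong)
    fix k assume "k \<in> {..<length ts}"
    hence k: "k < length ts" by simp
    have "mset_set (?B k) = mset_set (if shape (ts ! k) = Node j {#} then {[k]} else {}) +
        mset_set ((#) k ` leaf_cuts j (ts ! k))"
      by (rule mset_set_Union) (auto simp: finite_leaf_cuts Nil_notin_leaf_cuts)
    moreover have "mset_set ((#) k ` leaf_cuts j (ts ! k)) = image_mset ((#) k) (mset_set (leaf_cuts j (ts ! k)))"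
      by (subst image_mset_mset_set) (auto simp: inj_on_def)
    moreover have "image_mset (\<lambda>l. ?g (k # l)) (mset_set (leaf_cuts j (ts ! k))) =
      image_mset (\<lambda>l. Node i (add_mset (shape (prune {l} (ts ! k))) (?f - {#shape (ts ! k)#})))
        (mset_set (leaf_cuts j (ts ! k)))"
      by (intro image_mset_cong prune_below k) (auto simp: leaf_cuts_def finite_leaf_cuts[unfolded leaf_cuts_def])
    ultimately show "image_mset ?g (mset_set (?B k)) = ?h (shape (ts ! k))"
      using PNode[OF nth_mem[OF k]] k
      by (simp add: image_mset.compositionality o_def prune_child del: prune.simps)
  qed simp
  also have "\<dots> = sum_mset (image_mset ?h ?f)"
    by (simp add: sum_mset_sum_list sum_list_sum_nth atLeast0LessThan flip: mset_map)
  also have "\<dots> = leaf_prunings j (shape (PNode i ts))"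
    by (simp add: leaf_prunings.simps)
  finally show ?case by (rule sym)
qed

lemma shape_planar_rep [simp]: "shape (planar_rep t) = t"
  unfolding planar_rep_def by (rule someI_ex[OF shape_surj])

lemma count_image_mset_set:
  "finite A \<Longrightarrow> count (image_mset g (mset_set A)) y = card {x \<in> A. g x = y}"
  by (simp add: count_image_mset vimage_def Int_def conj_commute)

lemma leaf_count_eq: "leaf_count j t t' = count (leaf_prunings j t) t'"
proof -
  let ?p = "planar_rep t"
  have "count (leaf_prunings j (shape ?p)) t' = card {l \<in> leaf_cuts j ?p. shape (prune {l} ?p) = t'}"
    unfolding leaf_prunings_shape by (rule count_image_mset_set) (rule finite_leaf_cuts)
  also have "{l \<in> leaf_cuts j ?p. shape (prune {l} ?p) = t'} =
      {l \<in> leaves ?p. l \<noteq> [] \<and> proot (subtree ?p l) = j \<and> shape (prune {l} ?p) = t'}"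
    unfolding leaf_cuts_def by blast
  also have "card \<dots> = leaf_count j t t'"
    by (simp only: leaf_count_def Let_def)
  finally show ?thesis by (simp only: shape_planar_rep)
qed

section \<open>Coefficients in the Connes-Kreimer algebra\<close>

lemma lookup_scale [simp]: "Poly_Mapping.lookup (scale c x) k = c * Poly_Mapping.lookup x k"
  unfolding scale_def mult_map_scale_conv_mult[symmetric]
  by (simp add: Poly_Mapping.map.rep_eq when_def)

lemma lookup_tensor [simp]:
  "Poly_Mapping.lookup (tensor x y) (f, g) = Poly_Mapping.lookup x f * Poly_Mapping.lookup y g"
proof -
  have "Poly_Mapping.lookup (tensor x y) (f, g) = (\<Sum>f'\<in>Poly_Mapping.keys x. \<Sum>g'\<in>Poly_Mapping.keys y.
     if f' = f then if g' = g then Poly_Mapping.lookup x f' * Poly_Mapping.lookup y g' else 0 else 0)"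
    unfolding tensor_def lookup_sum lookup_single
    by (intro sum.cong refl) (auto simp: when_def)
  also have "\<dots> = (\<Sum>f'\<in>Poly_Mapping.keys x. if f' = f then
      \<Sum>g'\<in>Poly_Mapping.keys y. if g' = g then Poly_Mapping.lookup x f' * Poly_Mapping.lookup y g' else 0 else 0)"
    by (intro sum.cong refl) auto
  also have "\<dots> = Poly_Mapping.lookup x f * Poly_Mapping.lookup y g"
    by (simp add: sum.delta in_keys_iff)
  finally show ?thesis .
qed

lemma lookup_mult_forest:
  fixes x y :: "('i, 'k :: field) ck"
  shows "Poly_Mapping.lookup (x * y) f =
    (\<Sum>a\<in>{a. a \<subseteq># f}. Poly_Mapping.lookup x a * Poly_Mapping.lookup y (f - a))"
proof -
  have inner: "(\<Sum>q. Poly_Mapping.lookup y q when f = l + q) =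
      (Poly_Mapping.lookup y (f - l) when l \<subseteq># f)" for l
  proof (cases "l \<subseteq># f")
    case True
    hence "(\<lambda>q. Poly_Mapping.lookup y q when f = l + q) = (\<lambda>q. Poly_Mapping.lookup y q when q = f - l)"
      by (intro ext when_cong) (auto simp: subset_mset.add_diff_inverse)
    hence "(\<Sum>q. Poly_Mapping.lookup y q when f = l + q) = (\<Sum>q. Poly_Mapping.lookup y q when q = f - l)"
      by (rule arg_cong)
    also have "\<dots> = Poly_Mapping.lookup y (f - l)" by (rule Sum_any_when_equal)
    finally show ?thesis using True by (simp only: when_def if_True)
  next
    case False
    hence "(\<lambda>q. Poly_Mapping.lookup y q when f = l + q) = (\<lambda>q. 0)"
      by (intro ext) (auto simp: when_def)
    hence "(\<Sum>q. Poly_Mapping.lookup y q when f = l + q) = (\<Sum>q::'i forest. 0)"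
      by (rule arg_cong)
    thus ?thesis using False by simp
  qed
  show ?thesis unfolding lookup_mult inner
    by (subst Sum_any.expand_superset[of "{a. a \<subseteq># f}"]) (auto simp: when_def intro!: sum.cong)
qed

lemma module_scale: "module scale"
  using vector_space_scale by (simp add: module_iff_vector_space)

lemma subspaceI:
  assumes "0 \<in> A" "\<And>x y. x \<in> A \<Longrightarrow> y \<in> A \<Longrightarrow> x + y \<in> A" "\<And>c x. x \<in> A \<Longrightarrow> scale c x \<in> A"
  shows "module.subspace scale A"
  using assms by (simp add: module.subspace_def[OF module_scale])

lemma sdse_algebra_minimal:
  assumes "subalgebra A" "\<And>i n. i \<in> I \<Longrightarrow> homogeneous_part n (solution I F i) \<in> A"
  shows "sdse_algebra I F \<subseteq> A"
  unfolding sdse_algebra_def using assms by (intro hull_minimal) auto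

lemma homogeneous_part_in_sdse_algebra:
  "i \<in> I \<Longrightarrow> homogeneous_part n (solution I F i) \<in> sdse_algebra I F"
  unfolding sdse_algebra_def by (rule hull_inc) auto

lemma lookup_coprod:
  "Poly_Mapping.lookup (coprod x) k =
    (\<Sum>f\<in>Poly_Mapping.keys x. Poly_Mapping.lookup x f * Poly_Mapping.lookup (\<Prod>t\<in>#f. coprod_tree t) k)"
  by (simp add: coprod_def lookup_sum)

lemma component_leaf: "component {e} p e = shape (subtree p e)"
proof -
  have "{q. e @ q \<in> {e}} = insert [] {}" by auto
  thus ?thesis unfolding component_def using prune_insert_Nil[of "{}"] by simp
qed

text \<open>The two terms of the coproduct outside the sum over cuts have an empty forest on one
  side and do not contribute; the cuts that contribute consist of the single edge above a leaf
  decorated by \<open>j\<close>.\<close>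

lemma coprod_tree_leaf_coeff:
  "Poly_Mapping.lookup (coprod_tree t :: ('i, 'k :: field) ck2) ({#Node j {#}#}, {#t'#}) = of_nat (leaf_count j t t')"
proof -
  let ?p = "planar_rep t"
  let ?S = "{c \<in> admissible_cuts ?p. cut_forest c ?p = {#Node j {#}#} \<and> cut_root c ?p = t'}"
  let ?L = "{l \<in> leaves ?p. l \<noteq> [] \<and> proot (subtree ?p l) = j \<and> shape (prune {l} ?p) = t'}"
  have "Poly_Mapping.lookup (coprod_tree t :: ('i, 'k) ck2) ({#Node j {#}#}, {#t'#}) =
    (\<Sum>c\<in>admissible_cuts ?p. if cut_forest c ?p = {#Node j {#}#} \<and> cut_root c ?p = t' then 1 else 0)"
    unfolding coprod_tree_def Let_def lookup_add lookup_sum lookup_tensor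
    by (auto simp: of_forest_def lookup_single when_def lookup_one intro!: sum.cong)
  also have "\<dots> = of_nat (card ?S)"
    by (simp add: finite_admissible_cuts sum.If_cases Int_def)
  also have "?S = (\<lambda>l. {l}) ` ?L"
  proof (intro set_eqI iffI)
    fix c assume "c \<in> (\<lambda>l. {l}) ` ?L"
    then obtain l where c: "c = {l}" and l: "l \<in> leaves ?p" "l \<noteq> []" "proot (subtree ?p l) = j"
      "shape (prune {l} ?p) = t'" by auto
    have "card {e \<in> {l}. prefix e l'} \<le> 1" for l'
      by (metis (no_types, lifting) card.empty card_1_singleton_iff card_mono empty_Collect_eq finite.emptyI finite.insertI mem_Collect_eq subsetI One_nat_def is_singletonI is_singleton_altdef)
    hence "c \<in> admissible_cuts ?p" using l by (auto simp: c admissible_cuts_def edges_def leaves_def)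
    moreover have "subtree ?p l = PNode j []"
      using l by (cases "subtree ?p l") (auto simp: leaves_def)
    hence "cut_forest c ?p = {#Node j {#}#}" by (simp add: c cut_forest_def component_leaf)
    moreover have "cut_root c ?p = t'" using l by (simp add: c cut_root_def component_def)
    ultimately show "c \<in> ?S" by simp
  next
    fix c assume c: "c \<in> ?S"
    \<comment> \<open>Each edge of a cut yields one tree of the pruned forest.\<close>
    hence "size (cut_forest c ?p) = 1" by simp
    hence "card c = 1" by (simp add: cut_forest_def)
    then obtain l where l: "c = {l}" by (metis card_1_singletonE)
    have v: "is_vertex ?p l" "l \<noteq> []" using c by (auto simp: l admissible_cuts_def edges_def)
    have "shape (subtree ?p l) = Node j {#}"
      using c by (simp add: l cut_forest_def component_leaf)
    hence "subtree ?p l = PNode j []" by (simp add: shape_eq_leaf)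
    moreover have "shape (prune {l} ?p) = t'" using c by (simp add: l cut_root_def component_def)
    ultimately show "c \<in> (\<lambda>l. {l}) ` ?L" using v by (auto simp: l leaves_def)
  qed
  also have "card \<dots> = card ?L" by (rule card_image) (simp add: inj_on_def)
  finally show ?thesis by (simp add: leaf_count_def Let_def)
qed

section \<open>The coefficients of the solution\<close>

lemma solution_outside: "v \<notin> I \<Longrightarrow> solution I F v = 0"
  using is_solution_solution[of I F] by (simp add: is_solution_def)

lemma solution_eq: "v \<in> I \<Longrightarrow> solution I F v = graft v (mps_subst (F v) (solution I F))"
  using is_solution_solution[of I F] unfolding is_solution_def by blast

lemma solution_over: "solution I F v \<in> cck_over I"
  using is_solution_solution[of I F] solution_outside[of v I F]
  by (cases "v \<in> I") (auto simp: is_solution_def cck_over_def mps_over_def zero_mps.rep_eq)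

lemma mcoeff_solution_tree:
  "mcoeff (solution I F v) {#t#} = (if root t = v then tree_coeff I F t else 0)"
proof (cases "v \<in> I")
  case True
  obtain k g where t: "t = Node k g" by (cases t)
  show ?thesis
  proof (cases "k = v")
    case False
    hence "mcoeff (solution I F v) {#t#} = 0"
      using True by (subst solution_eq) (auto intro: mcoeff_graft_other simp: t)
    thus ?thesis using False t by simp
  qed (simp add: tree_coeff_def t)
qed (auto simp: solution_outside tree_coeff_def zero_mps.rep_eq)

lemma mcoeff_solution_nontree: "size f \<noteq> 1 \<Longrightarrow> mcoeff (solution I F v) f = 0"
proof (cases "v \<in> I")
  case True
  assume "size f \<noteq> 1"
  hence "f \<noteq> {#Node v g#}" for g by auto
  thus ?thesis using True by (subst solution_eq) (auto intro: mcoeff_graft_other)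
qed (simp add: solution_outside zero_mps.rep_eq)

text \<open>As a series in the trees, the solution at \<open>v\<close> is a linear form in the trees
  with root \<open>v\<close>; thus \<open>dpc_subst_linear\<close> applies with
  \<open>r = root\<close>.\<close>

lemma tree_coeff_Node:
  assumes "i \<in> I"
  shows "tree_coeff I F (Node i f) * of_nat (mfact f) =
    dpc (F i) (image_mset root f) * (\<Prod>t\<in>#f. tree_coeff I F t)"
proof -
  have "tree_coeff I F (Node i f) = mcoeff (mps_subst (F i) (solution I F)) f"
    using assms by (simp add: tree_coeff_def, subst solution_eq) (simp_all add: mcoeff_graft_Node)
  hence "tree_coeff I F (Node i f) * of_nat (mfact f) = dpc (mps_subst (F i) (solution I F)) f"
    by (simp add: dpc_def)
  also have "\<dots> = dpc (F i) (image_mset root f) * (\<Prod>t\<in>#f. tree_coeff I F t)"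
    by (rule dpc_subst_linear[where V = UNIV])
       (auto simp: mcoeff_solution_tree mcoeff_solution_nontree mps_over_def)
  finally show ?thesis .
qed

lemma tree_coeff_Node':
  "i \<in> I \<Longrightarrow> tree_coeff I F (Node i f) =
    dpc (F i) (image_mset root f) * (\<Prod>t\<in>#f. tree_coeff I F t) / of_nat (mfact f)"
  using tree_coeff_Node[of i I F f] by (simp add: field_simps)

lemma tree_coeff_outside: "\<not> set_rtree t \<subseteq> I \<Longrightarrow> tree_coeff I F t = 0"
proof -
  assume "\<not> set_rtree t \<subseteq> I"
  moreover have "mcoeff (solution I F (root t)) {#t#} \<noteq> 0 \<longrightarrow> set_mset {#t#} \<subseteq> {t. set_rtree t \<subseteq> I}"
    using solution_over[of I F "root t"] unfolding cck_over_def mps_over_def by blast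
  ultimately show ?thesis by (auto simp: tree_coeff_def)
qed

lemma lookup_homogeneous_solution:
  assumes "finite I"
  shows "Poly_Mapping.lookup (homogeneous_part n (solution I F i)) f =
    (if \<exists>t\<in>trees I i n. f = {#t#} then tree_coeff I F (THE t. f = {#t#}) else 0)"
proof (cases "\<exists>t. f = {#t#}")
  case True
  then obtain t where [simp]: "f = {#t#}" by blast
  show ?thesis
    by (auto simp: lookup_homogeneous_part[OF assms solution_over] mcoeff_solution_tree trees_def
        tree_coeff_outside forest_vertices_def when_def)
next
  case False
  hence "size f \<noteq> 1" by (metis One_nat_def size_1_singleton_mset)
  thus ?thesis using False
    by (auto simp: lookup_homogeneous_part[OF assms solution_over] mcoeff_solution_nontree)
qed

text \<open>The constraint that the Hopf property exploits: restricted to single trees with a given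
  root and size, every element of the algebra of the system is a multiple of the solution.\<close>

definition proportional :: "'i set \<Rightarrow> ('i \<Rightarrow> ('i, 'k :: field_char_0) mps) \<Rightarrow> ('i rtree \<Rightarrow> 'k) \<Rightarrow> bool" where
  "proportional I F h \<longleftrightarrow> (\<forall>i\<in>I. \<forall>n. \<exists>c. \<forall>t\<in>trees I i n. h t = c * tree_coeff I F t)"

lemma proportional_zero: "proportional I F (\<lambda>_. 0)"
  by (auto simp: proportional_def intro!: exI[of _ 0])

lemma proportional_lincomb:
  assumes "proportional I F g" "proportional I F h"
  shows "proportional I F (\<lambda>t. a * g t + b * h t)"
  unfolding proportional_def
proof (intro ballI allI)
  fix i n assume "i \<in> I"
  then obtain c d where "\<forall>t\<in>trees I i n. g t = c * tree_coeff I F t"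
    "\<forall>t\<in>trees I i n. h t = d * tree_coeff I F t"
    using assms unfolding proportional_def by metis
  thus "\<exists>c. \<forall>t\<in>trees I i n. a * g t + b * h t = c * tree_coeff I F t"
    by (intro exI[of _ "a * c + b * d"]) (simp add: algebra_simps)
qed

lemma submultisets_single: "{a. a \<subseteq># {#t#}} = {{#}, {#t#}}"
proof (intro set_eqI iffI)
  fix a assume "a \<in> {a. a \<subseteq># {#t#}}"
  thus "a \<in> {{#}, {#t#}}" by (cases a) (auto simp: insert_subset_eq_iff)
qed auto

lemma sdse_algebra_proportional:
  assumes "finite I" "x \<in> sdse_algebra I F"
  shows "proportional I F (\<lambda>t. Poly_Mapping.lookup x {#t#})"
proof -
  let ?A = "{x. proportional I F (\<lambda>t. Poly_Mapping.lookup x {#t#})}"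
  have "sdse_algebra I F \<subseteq> ?A"
  proof (rule sdse_algebra_minimal)
    have "module.subspace scale ?A"
    proof (rule subspaceI)
      fix x y assume "x \<in> ?A" "y \<in> ?A"
      thus "x + y \<in> ?A" using proportional_lincomb[of I F _ _ 1 1] by (simp add: lookup_add)
    next
      fix c x assume "x \<in> ?A"
      thus "scale c x \<in> ?A" using proportional_lincomb[of I F _ "\<lambda>_. 0" c 1] proportional_zero[of I F] by simp
    qed (simp add: proportional_zero)
    moreover have "x * y \<in> ?A" if "x \<in> ?A" "y \<in> ?A" for x y
    proof -
      \<comment> \<open>A single tree splits only trivially, so products add nothing new beyond
        linear combinations.\<close>
      have "Poly_Mapping.lookup (x * y) {#t#} = Poly_Mapping.lookup y {#} * Poly_Mapping.lookup x {#t#}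
          + Poly_Mapping.lookup x {#} * Poly_Mapping.lookup y {#t#}" for t
        unfolding lookup_mult_forest submultisets_single by (simp add: algebra_simps)
      thus ?thesis using that proportional_lincomb by simp
    qed
    moreover have "1 \<in> ?A" by (simp add: lookup_one proportional_zero)
    ultimately show "subalgebra ?A" by (simp add: subalgebra_def)
  next
    fix i n assume "i \<in> I"
    show "homogeneous_part n (solution I F i) \<in> ?A"
      unfolding mem_Collect_eq proportional_def
    proof (intro ballI allI)
      fix j m
      show "\<exists>c. \<forall>t\<in>trees I j m. Poly_Mapping.lookup (homogeneous_part n (solution I F i)) {#t#} = c * tree_coeff I F t"
        by (intro exI[of _ "if i = j \<and> n = m then 1 else 0"])
           (auto simp: lookup_homogeneous_solution[OF assms(1)] trees_def)
    qed
  qed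
  thus ?thesis using assms(2) by auto
qed

text \<open>The sum is the coefficient of the leaf \<open>j\<close> tensor \<open>t'\<close> in the
  coproduct of the component of degree \<open>n + 1\<close>. The right tensor factors lie in the
  algebra, so this coefficient is proportional to the solution as a function of
  \<open>t'\<close>.\<close>

lemma hopf_leaf_sum:
  assumes "hopf_sdse I F" "i \<in> I" "n \<ge> 1"
  shows "\<exists>c. \<forall>t'\<in>trees I i n. (\<Sum>t\<in>trees I i (Suc n). of_nat (leaf_count j t t') * tree_coeff I F t)
           = c * tree_coeff I F t'"
proof -
  have fin: "finite I" using assms by (simp add: hopf_sdse_def sdse_def)
  let ?A = "sdse_algebra I F"
  let ?x = "homogeneous_part (Suc n) (solution I F i)"
  let ?Q = "{u. proportional I F (\<lambda>t. Poly_Mapping.lookup u ({#Node j {#}#}, {#t#}))}"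
  have "coprod ?x \<in> module.span scale {tensor y z | y z. y \<in> ?A \<and> z \<in> ?A}"
    using assms homogeneous_part_in_sdse_algebra[of i I "Suc n" F] unfolding hopf_sdse_def hopf_subalgebra_def by blast
  also have "\<dots> \<subseteq> ?Q"
  proof (rule module.span_minimal[OF module_scale])
    show "{tensor y z | y z. y \<in> ?A \<and> z \<in> ?A} \<subseteq> ?Q"
    proof safe
      fix y z assume "z \<in> ?A"
      from proportional_lincomb[OF sdse_algebra_proportional[OF fin this] proportional_zero]
      show "proportional I F (\<lambda>t. Poly_Mapping.lookup (tensor y z) ({#Node j {#}#}, {#t#}))"
        by simp
    qed
    show "module.subspace scale ?Q"
    proof (rule subspaceI)
      fix x y assume "x \<in> ?Q" "y \<in> ?Q"
      thus "x + y \<in> ?Q" using proportional_lincomb[of I F _ _ 1 1] by (simp add: lookup_add)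
    next
      fix c x assume "x \<in> ?Q"
      thus "scale c x \<in> ?Q" using proportional_lincomb[of I F _ "\<lambda>_. 0" c 1] proportional_zero[of I F] by simp
    qed (simp add: proportional_zero)
  qed
  finally have pr: "proportional I F (\<lambda>t. Poly_Mapping.lookup (coprod ?x) ({#Node j {#}#}, {#t#}))"
    by simp
  have "Poly_Mapping.lookup (coprod ?x) ({#Node j {#}#}, {#t'#}) =
      (\<Sum>t\<in>trees I i (Suc n). of_nat (leaf_count j t t') * tree_coeff I F t)" for t'
  proof -
    let ?h = "\<lambda>f. Poly_Mapping.lookup ?x f *
      Poly_Mapping.lookup (\<Prod>t\<in>#f. coprod_tree t) ({#Node j {#}#}, {#t'#})"
    have "Poly_Mapping.lookup (coprod ?x) ({#Node j {#}#}, {#t'#}) = sum ?h (Poly_Mapping.keys ?x)"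
      by (rule lookup_coprod)
    also have "\<dots> = sum ?h ((\<lambda>t. {#t#}) ` trees I i (Suc n))"
      by (rule sum.mono_neutral_left)
         (auto simp: in_keys_iff lookup_homogeneous_solution[OF fin] finite_trees[OF fin] split: if_splits)
    also have "\<dots> = (\<Sum>t\<in>trees I i (Suc n). ?h {#t#})"
      by (subst sum.reindex) (auto simp: inj_on_def)
    finally show ?thesis
      by (simp add: lookup_homogeneous_solution[OF fin] coprod_tree_leaf_coeff mult.commute)
  qed
  thus ?thesis using pr assms(2) by (simp add: proportional_def)
qed

section \<open>Recursion for the weighted sum over trees with one more leaf\<close>

lemma sum_mset_eq_sum_count:
  fixes h :: "'v \<Rightarrow> 'k :: comm_semiring_1"
  shows "(\<Sum>s\<in>#g. h s) = (\<Sum>s\<in>set_mset g. of_nat (count g s) * h s)"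
proof (induction g)
  case (add x g)
  have "(\<Sum>s\<in>set_mset (add_mset x g). of_nat (count (add_mset x g) s) * h s) =
        (\<Sum>s\<in>insert x (set_mset g). (if s = x then h s else 0) + of_nat (count g s) * h s)"
    by (intro sum.cong) (auto simp: algebra_simps)
  also have "\<dots> = h x + (\<Sum>s\<in>insert x (set_mset g). of_nat (count g s) * h s)"
    by (simp add: sum.distrib)
  also have "(\<Sum>s\<in>insert x (set_mset g). of_nat (count g s) * h s) = (\<Sum>s\<in>set_mset g. of_nat (count g s) * h s)"
    by (intro sum.mono_neutral_right) (auto simp: not_in_iff)
  finally show ?case using add.IH by simp
qed simp

lemma count_sum_mset: "count (\<Sum>s\<in>#g. h s) x = (\<Sum>s\<in>#g. count (h s) x)"
  by (induction g) auto

lemma finite_trees_size: "finite I \<Longrightarrow> finite {t. set_rtree t \<subseteq> I \<and> vertices t = n}"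
  by (rule finite_subset[OF _ finite_rtrees[of I n]]) auto

lemma forest_vertices_add [simp]: "forest_vertices (add_mset t f) = vertices t + forest_vertices f"
  by (simp add: forest_vertices_def)

lemma vertices_Node: "vertices (Node i f) = Suc (forest_vertices f)"
  by (simp add: forest_vertices_def)

lemma count_image_add_mset:
  "of_nat (count (image_mset (\<lambda>s'. Node i (add_mset s' h)) M) (Node i f)) =
   (\<Sum>s'\<in>set_mset f. if h = f - {#s'#} then of_nat (count M s') else (0 :: 'k :: comm_semiring_1))"
proof -
  have "count (image_mset (\<lambda>s'. Node i (add_mset s' h)) M) (Node i f) =
      (\<Sum>s'\<in>{s' \<in> set_mset M. add_mset s' h = f}. count M s')"
    unfolding count_image_mset by (intro sum.cong) auto
  also have "\<dots> = (\<Sum>s'\<in>{s' \<in> set_mset f. h = f - {#s'#}}. count M s')"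
  proof (rule sum.mono_neutral_left)
    show "{s' \<in> set_mset M. add_mset s' h = f} \<subseteq> {s' \<in> set_mset f. h = f - {#s'#}}" by auto
    show "\<forall>s'\<in>{s' \<in> set_mset f. h = f - {#s'#}} - {s' \<in> set_mset M. add_mset s' h = f}. count M s' = 0"
      by (auto simp: not_in_iff)
  qed simp
  finally show ?thesis by (simp add: sum.inter_filter[symmetric])
qed

text \<open>No root is prescribed: pruning keeps the root, so trees with another root contribute
  nothing. This lets the recursion treat branches with arbitrary roots uniformly.\<close>

definition leaf_sum :: "'i set \<Rightarrow> ('i \<Rightarrow> ('i, 'k :: field_char_0) mps) \<Rightarrow> 'i \<Rightarrow> 'i rtree \<Rightarrow> 'k" where
  "leaf_sum I F j t' = (\<Sum>t\<in>{t. set_rtree t \<subseteq> I \<and> vertices t = Suc (vertices t')}.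
     of_nat (count (leaf_prunings j t) t') * tree_coeff I F t)"

lemma leaf_sum_eq:
  assumes "finite I" "t' \<in> trees I i n"
  shows "leaf_sum I F j t' = (\<Sum>t\<in>trees I i (n + 1). of_nat (leaf_count j t t') * tree_coeff I F t)"
  unfolding leaf_sum_def leaf_count_eq
proof (rule sum.mono_neutral_right)
  show "\<forall>t\<in>{t. set_rtree t \<subseteq> I \<and> vertices t = Suc (vertices t')} - trees I i (n + 1).
       of_nat (count (leaf_prunings j t) t') * tree_coeff I F t = 0"
  proof
    fix t assume t: "t \<in> {t. set_rtree t \<subseteq> I \<and> vertices t = Suc (vertices t')} - trees I i (n + 1)"
    have "t' \<notin># leaf_prunings j t"
      using t assms(2) root_leaf_prunings[of t' j t] by (auto simp: trees_def)
    thus "of_nat (count (leaf_prunings j t) t') * tree_coeff I F t = 0"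
      by (simp add: not_in_iff)
  qed
qed (use assms in \<open>auto simp: trees_def finite_trees_size\<close>)

text \<open>
  A tree with a marked non-root leaf above \<open>Node i f\<close> arises either by grafting the leaf on the root,
  or by grafting it on one of the trees \<open>s'\<close> of \<open>f\<close>.
\<close>

lemma leaf_sum_Node:
  fixes F :: "'i \<Rightarrow> ('i, 'k :: field_char_0) mps"
  assumes I: "finite I" "i \<in> I" "j \<in> I" and f: "\<forall>t\<in>#f. set_rtree t \<subseteq> I" and one: "mcoeff (F j) {#} = 1"
  shows "leaf_sum I F j (Node i f) * of_nat (mfact f) =
    dpc (F i) (add_mset j (image_mset root f)) * (\<Prod>t\<in>#f. tree_coeff I F t) +
    dpc (F i) (image_mset root f) *
      (\<Sum>s'\<in>#f. (\<Prod>t\<in>#f - {#s'#}. tree_coeff I F t) * leaf_sum I F j s')"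
proof -
  let ?a = "tree_coeff I F" and ?\<phi> = "dpc (F i)" and ?n = "Suc (forest_vertices f)"
  define G where "G = {g. (\<forall>t\<in>#g. set_rtree t \<subseteq> I) \<and> forest_vertices g = ?n}"
  \<comment> \<open>A pair \<open>(h, s)\<close> stands for the forest \<open>add_mset s h\<close>
    with the branch \<open>s\<close> marked. Below, \<open>c1\<close> covers the case that
    \<open>s\<close> is itself the cut leaf, \<open>c2\<close> the case that the leaf lies inside
    \<open>s\<close> and a tree of \<open>f\<close> remains; \<open>w\<close> is the weight of the
    marked forest.\<close>
  define H where "H = {(h, s). (\<forall>t\<in>#h. set_rtree t \<subseteq> I) \<and> set_rtree s \<subseteq> I \<and> forest_vertices h + vertices s = ?n}"
  define P where "P h = (\<Prod>t\<in>#h. ?a t)" for h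
  define c1 where "c1 h s = (if h = f \<and> s = Node j {#} then 1 else 0 :: 'k)" for h s
  define c2 where "c2 h s = (\<Sum>s'\<in>set_mset f. if h = f - {#s'#} then of_nat (count (leaf_prunings j s) s') else (0 :: 'k))" for h s
  define w where "w h s = ?\<phi> (image_mset root (add_mset s h)) * (?a s * P h) / of_nat (mfact h)" for h s
  have fin_G: "finite G" unfolding G_def by (rule finite_forests[OF I(1)])
  have count: "of_nat (count (leaf_prunings j (Node i g)) (Node i f)) =
      (\<Sum>s\<in>set_mset g. of_nat (count g s) * (c1 (g - {#s#}) s + c2 (g - {#s#}) s))" for g
  proof -
    have "of_nat (count (leaf_prunings j (Node i g)) (Node i f)) =
      (\<Sum>s\<in>#g. of_nat (count (if s = Node j {#} then {#Node i (g - {#s#})#} else {#}) (Node i f)) +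
        of_nat (count (image_mset (\<lambda>s'. Node i (add_mset s' (g - {#s#}))) (leaf_prunings j s)) (Node i f)) :: 'k)"
      unfolding leaf_prunings.simps count_sum_mset by (simp add: of_nat_sum_mset image_mset.compositionality o_def)
    also have "\<dots> = (\<Sum>s\<in>#g. c1 (g - {#s#}) s + c2 (g - {#s#}) s)"
      unfolding c2_def count_image_add_mset
      by (intro arg_cong[of _ _ sum_mset] image_mset_cong) (auto simp: c1_def)
    finally show ?thesis by (simp only: sum_mset_eq_sum_count)
  qed
  have "leaf_sum I F j (Node i f) = (\<Sum>t\<in>Node i ` G. of_nat (count (leaf_prunings j t) (Node i f)) * ?a t)"
    unfolding leaf_sum_def
  proof (rule sum.mono_neutral_right)
    show "\<forall>t\<in>{t. set_rtree t \<subseteq> I \<and> vertices t = Suc (vertices (Node i f))} - Node i ` G.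
       of_nat (count (leaf_prunings j t) (Node i f)) * ?a t = 0"
    proof
      fix t assume t: "t \<in> {t. set_rtree t \<subseteq> I \<and> vertices t = Suc (vertices (Node i f))} - Node i ` G"
      obtain k g where k: "t = Node k g" by (cases t)
      have "g \<in> G" using t by (auto simp: k G_def vertices_Node simp del: vertices.simps)
      hence "k \<noteq> i" using t k by auto
      hence "Node i f \<notin># leaf_prunings j t" using root_leaf_prunings[of "Node i f" j t] k by auto
      thus "of_nat (count (leaf_prunings j t) (Node i f)) * ?a t = 0" by (simp add: not_in_iff)
    qed
  qed (use I in \<open>auto simp: G_def vertices_Node finite_trees_size simp del: vertices.simps, blast\<close>)
  also have "\<dots> = (\<Sum>g\<in>G. of_nat (count (leaf_prunings j (Node i g)) (Node i f)) * ?a (Node i g))"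
    by (subst sum.reindex) (auto simp: inj_on_def)
  also have "\<dots> = (\<Sum>g\<in>G. \<Sum>s\<in>set_mset g. (c1 (g - {#s#}) s + c2 (g - {#s#}) s) * w (g - {#s#}) s)"
  proof (rule sum.cong)
    fix g assume "g \<in> G"
    \<comment> \<open>Marking one of the \<open>count g s\<close> copies of \<open>s\<close> turns
      the denominator \<open>mfact g\<close> into \<open>mfact (g - {#s#})\<close>.\<close>
    have "of_nat (count g s) * x * ?a (Node i g) = x * w (g - {#s#}) s" if "s \<in># g" for s x
    proof -
      obtain h where g: "g = add_mset s h" using \<open>s \<in># g\<close> by (metis multi_member_split)
      have "of_nat (Suc (count h s)) * (x * (?\<phi> (image_mset root (add_mset s h)) * (?a s * P h))) * of_nat (mfact h) =
          x * (?\<phi> (image_mset root (add_mset s h)) * (?a s * P h)) * of_nat (mfact (add_mset s h))"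
        by (simp add: algebra_simps)
      thus ?thesis using mfact_nonzero[of h, where ?'k = 'k] mfact_nonzero[of "add_mset s h", where ?'k = 'k]
        unfolding tree_coeff_Node'[OF I(2)] w_def g P_def
        by (simp add: field_simps del: mfact_add_mset of_nat_Suc)
    qed
    thus "of_nat (count (leaf_prunings j (Node i g)) (Node i f)) * ?a (Node i g) =
      (\<Sum>s\<in>set_mset g. (c1 (g - {#s#}) s + c2 (g - {#s#}) s) * w (g - {#s#}) s)"
      unfolding count sum_distrib_right by (intro sum.cong) auto
  qed simp
  also have "\<dots> = (\<Sum>(g, s)\<in>Sigma G set_mset. (c1 (g - {#s#}) s + c2 (g - {#s#}) s) * w (g - {#s#}) s)"
    by (rule sum.Sigma) (use fin_G in auto)
  also have "\<dots> = (\<Sum>(h, s)\<in>H. (c1 h s + c2 h s) * w h s)"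
  proof (rule sum.reindex_bij_witness[where j = "\<lambda>(g, s). (g - {#s#}, s)" and i = "\<lambda>(h, s). (add_mset s h, s)"])
    fix x assume "x \<in> Sigma G set_mset"
    then obtain h s where x: "x = (add_mset s h, s)" "add_mset s h \<in> G"
      by (metis SigmaE insert_DiffM)
    thus "(case x of (g, s) \<Rightarrow> (g - {#s#}, s)) \<in> H"
      by (auto simp: G_def H_def)
  qed (auto simp: G_def H_def, blast+)
  also have "\<dots> = (\<Sum>(h, s)\<in>H. c1 h s * w h s) + (\<Sum>(h, s)\<in>H. c2 h s * w h s)"
    by (simp add: case_prod_beta distrib_right sum.distrib)
  finally have main: "leaf_sum I F j (Node i f) = (\<Sum>(h, s)\<in>H. c1 h s * w h s) + (\<Sum>(h, s)\<in>H. c2 h s * w h s)" .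
  have fin_H: "finite H"
  proof (rule finite_subset)
    show "H \<subseteq> (\<Union>m\<le>?n. {h. (\<forall>t\<in>#h. set_rtree t \<subseteq> I) \<and> forest_vertices h = m}) \<times> {s. set_rtree s \<subseteq> I \<and> vertices s \<le> ?n}"
      by (auto simp: H_def)
  qed (use finite_forests[OF I(1)] finite_rtrees[OF I(1)] in auto)
  have leaf: "?a (Node j {#}) = 1"
    using one by (simp add: tree_coeff_Node'[OF I(3)] dpc_def)
  have "(\<Sum>(h, s)\<in>H. c1 h s * w h s) = (\<Sum>(h, s)\<in>{(f, Node j {#})}. c1 h s * w h s)"
    by (rule sum.mono_neutral_right) (use fin_H I f in \<open>auto simp: H_def c1_def split: if_splits\<close>)
  also have "\<dots> = ?\<phi> (add_mset j (image_mset root f)) * P f / of_nat (mfact f)"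
    by (simp add: c1_def w_def leaf)
  finally have part1: "(\<Sum>(h, s)\<in>H. c1 h s * w h s) * of_nat (mfact f) = ?\<phi> (add_mset j (image_mset root f)) * P f"
    by simp
  have "(\<Sum>(h, s)\<in>H. c2 h s * w h s) =
     (\<Sum>(h, s)\<in>H. \<Sum>s'\<in>set_mset f. if h = f - {#s'#} then of_nat (count (leaf_prunings j s) s') * w h s else 0)"
    by (intro sum.cong refl) (auto simp: c2_def sum_distrib_right if_distrib[of "\<lambda>x. x * _"] intro!: sum.cong)
  also have "\<dots> = (\<Sum>s'\<in>set_mset f. \<Sum>(h, s)\<in>H. if h = f - {#s'#} then of_nat (count (leaf_prunings j s) s') * w h s else 0)"
    unfolding case_prod_beta by (rule sum.swap)
  also have "\<dots> = (\<Sum>s'\<in>set_mset f. ?\<phi> (image_mset root f) * P (f - {#s'#}) / of_nat (mfact (f - {#s'#})) * leaf_sum I F j s')"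
  proof (rule sum.cong)
    fix s' assume s': "s' \<in># f"
    define h0 where "h0 = f - {#s'#}"
    have f': "f = add_mset s' h0" using s' by (simp add: h0_def)
    let ?T = "{s. set_rtree s \<subseteq> I \<and> vertices s = Suc (vertices s')}"
    have "(\<Sum>(h, s)\<in>H. if h = h0 then of_nat (count (leaf_prunings j s) s') * w h s else 0) =
        (\<Sum>(h, s)\<in>Pair h0 ` ?T. if h = h0 then of_nat (count (leaf_prunings j s) s') * w h s else 0)"
      by (rule sum.mono_neutral_right) (use fin_H f in \<open>auto simp: H_def f'\<close>)
    also have "\<dots> = (\<Sum>s\<in>?T. of_nat (count (leaf_prunings j s) s') * w h0 s)"
      by (subst sum.reindex) (auto simp: inj_on_def)
    also have "\<dots> = (\<Sum>s\<in>?T. ?\<phi> (image_mset root f) * P h0 / of_nat (mfact h0) *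
        (of_nat (count (leaf_prunings j s) s') * ?a s))"
    proof (rule sum.cong)
      fix s
      show "of_nat (count (leaf_prunings j s) s') * w h0 s =
        ?\<phi> (image_mset root f) * P h0 / of_nat (mfact h0) * (of_nat (count (leaf_prunings j s) s') * ?a s)"
      proof (cases "s' \<in># leaf_prunings j s")
        case True
        \<comment> \<open>Equal roots mean that replacing \<open>s'\<close> by \<open>s\<close>
          leaves the monomial in the coefficient of \<open>F i\<close> unchanged.\<close>
        hence "root s = root s'" using root_leaf_prunings[of s' j s] by simp
        thus ?thesis by (simp add: w_def f')
      qed (simp add: not_in_iff)
    qed simp
    also have "\<dots> = ?\<phi> (image_mset root f) * P h0 / of_nat (mfact h0) * leaf_sum I F j s'"
      by (simp add: leaf_sum_def sum_distrib_left)
    finally show "(\<Sum>(h, s)\<in>H. if h = f - {#s'#} then of_nat (count (leaf_prunings j s) s') * w h s else 0) =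
        ?\<phi> (image_mset root f) * P (f - {#s'#}) / of_nat (mfact (f - {#s'#})) * leaf_sum I F j s'"
      unfolding h0_def .
  qed simp
  finally have "(\<Sum>(h, s)\<in>H. c2 h s * w h s) * of_nat (mfact f) =
    (\<Sum>s'\<in>set_mset f. ?\<phi> (image_mset root f) * P (f - {#s'#}) / of_nat (mfact (f - {#s'#})) * leaf_sum I F j s' * of_nat (mfact f))"
    by (simp add: sum_distrib_right)
  also have "\<dots> = (\<Sum>s'\<in>set_mset f. of_nat (count f s') * (?\<phi> (image_mset root f) * (P (f - {#s'#}) * leaf_sum I F j s')))"
    by (intro sum.cong refl) (simp add: mfact_remove mfact_pos[THEN gr_implies_not0])
  also have "\<dots> = ?\<phi> (image_mset root f) * (\<Sum>s'\<in>#f. P (f - {#s'#}) * leaf_sum I F j s')"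
    by (simp only: sum_mset_eq_sum_count[symmetric] sum_mset_distrib_left)
  finally show ?thesis
    using part1 unfolding main P_def by (simp add: distrib_right)
qed

lemma dpc_singleton_nonzero:
  assumes "dpc F m \<noteq> 0" "m \<noteq> {#}"
    and step: "\<And>j p. dpc F (add_mset j p) \<noteq> 0 \<Longrightarrow> dpc F p \<noteq> 0"
  shows "\<exists>j\<in>#m. dpc F {#j#} \<noteq> 0"
  using assms(1,2)
proof (induction m)
  case (add j m)
  show ?case
  proof (cases "m = {#}")
    case False
    hence "\<exists>j\<in>#m. dpc F {#j#} \<noteq> 0" using add.IH step[OF add.prems(1)] by blast
    thus ?thesis by auto
  qed (use add.prems in auto)
qed simp

text \<open>Each pair \<open>(r, m)\<close> of \<open>q\<close> is realised by a tree with root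
  \<open>r\<close>, size \<open>m\<close> and nonzero coefficient. In \<open>leaf_sum_Node\<close>
  the product of these coefficients is then a common factor and cancels.\<close>

lemma hopf_level_coeff:
  fixes F :: "'i \<Rightarrow> ('i, 'k :: field_char_0) mps" and q :: "('i \<times> nat) multiset"
  assumes hopf: "hopf_sdse I F" and one: "\<forall>i\<in>I. mcoeff (F i) {#} = 1"
    and ij: "i \<in> I" "j \<in> I" and q: "\<forall>(r, m)\<in>#q. r \<in> I \<and> m \<ge> 1"
  shows "dpc (F i) (add_mset j (image_mset fst q)) =
        (level_coeff I F i j (Suc (\<Sum>(r, m)\<in>#q. m)) - (\<Sum>(r, m)\<in>#q. level_coeff I F r j m)) *
        dpc (F i) (image_mset fst q)"
proof -
  have sdse: "sdse I F" using hopf by (simp add: hopf_sdse_def)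
  hence fin: "finite I" by (simp add: sdse_def)
  have ex: "\<exists>c. \<forall>t'\<in>trees I i n. leaf_sum I F j t' = c * tree_coeff I F t'" if "i \<in> I" "n \<ge> 1" for i j n
  proof -
    from hopf_leaf_sum[OF hopf that, of j]
    obtain c where "\<forall>t'\<in>trees I i n. (\<Sum>t\<in>trees I i (Suc n). of_nat (leaf_count j t t') * tree_coeff I F t)
        = c * tree_coeff I F t'" by blast
    thus ?thesis using leaf_sum_eq[OF fin, of _ i n F j] by (intro exI[of _ c]) simp
  qed
  define c where "c i j n = (SOME c. \<forall>t'\<in>trees I i n. leaf_sum I F j t' = c * tree_coeff I F t')" for i j n
  have c: "leaf_sum I F j t' = c i j n * tree_coeff I F t'" if "i \<in> I" "n \<ge> 1" "t' \<in> trees I i n" for i j n t'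
    using someI_ex[OF ex[OF that(1,2), of j]] that(3) unfolding c_def by blast
  have star: "dpc (F i) (add_mset j (image_mset root f)) =
      (c i j (Suc (forest_vertices f)) - (\<Sum>t\<in>#f. c (root t) j (vertices t))) * dpc (F i) (image_mset root f)"
    if ij: "i \<in> I" "j \<in> I" and f: "\<forall>t\<in>#f. set_rtree t \<subseteq> I" "\<forall>t\<in>#f. tree_coeff I F t \<noteq> 0" for i j f
  proof -
    let ?P = "\<Prod>t\<in>#f. tree_coeff I F t" and ?\<phi> = "dpc (F i) (image_mset root f)"
    have P: "?P \<noteq> 0" using f(2) by (induction f) auto
    have "(\<Sum>s'\<in>#f. (\<Prod>t\<in>#f - {#s'#}. tree_coeff I F t) * leaf_sum I F j s') = (\<Sum>s'\<in>#f. c (root s') j (vertices s') * ?P)"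
    proof (intro arg_cong[of _ _ sum_mset] image_mset_cong)
      fix s assume s: "s \<in># f"
      then obtain h where h: "f = add_mset s h" by (metis multi_member_split)
      have sI: "set_rtree s \<subseteq> I" using f(1) s by blast
      have "root s \<in> I" using sI by (cases s) auto
      moreover have "s \<in> trees I (root s) (vertices s)" using sI by (simp add: trees_def)
      ultimately have "leaf_sum I F j s = c (root s) j (vertices s) * tree_coeff I F s"
        by (intro c) (simp_all add: Suc_le_eq)
      thus "(\<Prod>t\<in>#f - {#s#}. tree_coeff I F t) * leaf_sum I F j s = c (root s) j (vertices s) * ?P"
        by (simp add: h)
    qed
    also have "\<dots> = (\<Sum>t\<in>#f. c (root t) j (vertices t)) * ?P"
      by (simp only: sum_mset_distrib_right)
    finally have eq: "(\<Sum>s'\<in>#f. (\<Prod>t\<in>#f - {#s'#}. tree_coeff I F t) * leaf_sum I F j s') = \<dots>" .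
    have "leaf_sum I F j (Node i f) * of_nat (mfact f) =
        (dpc (F i) (add_mset j (image_mset root f)) + ?\<phi> * (\<Sum>t\<in>#f. c (root t) j (vertices t))) * ?P"
      unfolding leaf_sum_Node[where F = F, OF fin ij f(1) one[rule_format, OF ij(2)]] eq
      by (simp only: distrib_right mult.assoc)
    moreover have "leaf_sum I F j (Node i f) = c i j (Suc (forest_vertices f)) * tree_coeff I F (Node i f)"
      using ij f(1) by (intro c) (auto simp: trees_def forest_vertices_def)
    ultimately have "c i j (Suc (forest_vertices f)) * (?\<phi> * ?P) =
        (dpc (F i) (add_mset j (image_mset root f)) + ?\<phi> * (\<Sum>t\<in>#f. c (root t) j (vertices t))) * ?P"
      using tree_coeff_Node[OF ij(1), of F f] by (simp add: mult.assoc)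
    hence "c i j (Suc (forest_vertices f)) * ?\<phi> =
        dpc (F i) (add_mset j (image_mset root f)) + ?\<phi> * (\<Sum>t\<in>#f. c (root t) j (vertices t))"
      using mult_right_cancel[OF P] by (simp only: mult.assoc[symmetric])
    thus ?thesis by (simp add: algebra_simps)
  qed
  have over: "dpc (F i) m \<noteq> 0 \<Longrightarrow> set_mset m \<subseteq> I" if "i \<in> I" for i m
    using sdse that unfolding sdse_def mps_over_def by (metis dpc_eq_0_iff)
  have leaf: "tree_coeff I F (Node j {#}) = 1" if "j \<in> I" for j
    using that one by (simp add: tree_coeff_Node' dpc_def)
  \<comment> \<open>Taking single leaves as branches shows that supports are closed under removing a
    variable; hence every nonconstant series has a nonzero linear term.\<close>
  have step: "dpc (F i) p \<noteq> 0" if "i \<in> I" "dpc (F i) (add_mset j p) \<noteq> 0" for i j p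
  proof -
    have p: "insert j (set_mset p) \<subseteq> I" using over[OF that] by simp
    have "dpc (F i) (add_mset j (image_mset root (image_mset (\<lambda>l. Node l {#}) p))) =
        (c i j (Suc (forest_vertices (image_mset (\<lambda>l. Node l {#}) p))) -
         (\<Sum>t\<in>#image_mset (\<lambda>l. Node l {#}) p. c (root t) j (vertices t))) *
        dpc (F i) (image_mset root (image_mset (\<lambda>l. Node l {#}) p))"
      using p that(1) by (intro star) (auto simp: leaf)
    thus ?thesis using that(2) by (auto simp: image_mset.compositionality o_def)
  qed
  have child: "\<exists>k\<in>I. dpc (F i) {#k#} \<noteq> 0" if "i \<in> I" for i
  proof -
    have "mps_nonconstant (F i)" using sdse that by (simp add: sdse_def)
    then obtain m where m: "m \<noteq> {#}" "dpc (F i) m \<noteq> 0"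
      unfolding mps_nonconstant_def dpc_eq_0_iff by (elim exE conjE)
    have "\<exists>j\<in>#m. dpc (F i) {#j#} \<noteq> 0"
      by (rule dpc_singleton_nonzero[OF m(2,1)]) (erule step[OF that])
    then obtain k where k: "k \<in># m" "dpc (F i) {#k#} \<noteq> 0" by blast
    thus ?thesis using over[OF that m(2)] by blast
  qed
  \<comment> \<open>Unbranched trees give a nonzero coefficient in every degree. They provide the
    branches for \<open>q\<close> and make the scalar defining \<open>level_coeff\<close>
    unique.\<close>
  have ladder: "\<exists>t\<in>trees I i (Suc n). tree_coeff I F t \<noteq> 0" if "i \<in> I" for i n
    using that
  proof (induction n arbitrary: i)
    case 0
    thus ?case by (intro bexI[of _ "Node i {#}"]) (auto simp: leaf trees_def)
  next
    case (Suc n)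
    obtain k where k: "k \<in> I" "dpc (F i) {#k#} \<noteq> 0" using child[OF Suc.prems] by blast
    obtain t where t: "t \<in> trees I k (Suc n)" "tree_coeff I F t \<noteq> 0" using Suc.IH[OF k(1)] by blast
    show ?case
      using k t Suc.prems by (intro bexI[of _ "Node i {#t#}"]) (auto simp: tree_coeff_Node' trees_def)
  qed
  have lev: "level_coeff I F i j n = c i j n" if iI: "i \<in> I" and n1: "n \<ge> 1" for i j n
    unfolding level_coeff_def
  proof (rule the_equality)
    show "\<forall>t'\<in>trees I i n. (\<Sum>t\<in>trees I i (n + 1). of_nat (leaf_count j t t') * tree_coeff I F t) = c i j n * tree_coeff I F t'"
      using c[OF iI n1] leaf_sum_eq[OF fin] by metis
    fix d assume d: "\<forall>t'\<in>trees I i n. (\<Sum>t\<in>trees I i (n + 1). of_nat (leaf_count j t t') * tree_coeff I F t) = d * tree_coeff I F t'"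
    obtain t where t: "t \<in> trees I i n" "tree_coeff I F t \<noteq> 0" using ladder[OF iI, of "n - 1"] n1 by auto
    have "d * tree_coeff I F t = c i j n * tree_coeff I F t"
      using c[OF iI n1 t(1)] d t(1) leaf_sum_eq[OF fin t(1)] by metis
    thus "d = c i j n" using t(2) by simp
  qed
  define T where "T = (\<lambda>(r, m). SOME t. t \<in> trees I r m \<and> tree_coeff I F t \<noteq> 0)"
  have T: "T x \<in> trees I (fst x) (snd x) \<and> tree_coeff I F (T x) \<noteq> 0" if "x \<in># q" for x
  proof -
    obtain r m where x: "x = (r, m)" by (cases x)
    hence "r \<in> I" "m \<ge> 1" using q that by auto
    hence "\<exists>t. t \<in> trees I r m \<and> tree_coeff I F t \<noteq> 0" using ladder[of r "m - 1"] by auto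
    from someI_ex[OF this] show ?thesis by (simp add: x T_def)
  qed
  have 1: "image_mset root (image_mset T q) = image_mset fst q"
    unfolding image_mset.compositionality o_def using T by (intro image_mset_cong) (auto simp: trees_def)
  have 2: "forest_vertices (image_mset T q) = (\<Sum>(r, m)\<in>#q. m)"
    unfolding forest_vertices_def image_mset.compositionality o_def
    using T by (intro arg_cong[of _ _ sum_mset] image_mset_cong) (auto simp: trees_def)
  have 3: "(\<Sum>t\<in>#image_mset T q. c (root t) j (vertices t)) = (\<Sum>(r, m)\<in>#q. level_coeff I F r j m)"
    unfolding image_mset.compositionality o_def
    using T q by (intro arg_cong[of _ _ sum_mset] image_mset_cong) (force simp: trees_def lev)
  show "dpc (F i) (add_mset j (image_mset fst q)) =
        (level_coeff I F i j (Suc (\<Sum>(r, m)\<in>#q. m)) - (\<Sum>(r, m)\<in>#q. level_coeff I F r j m)) *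
        dpc (F i) (image_mset fst q)"
    using star[OF ij, of "image_mset T q"] T lev[OF ij(1)]
    unfolding 1 2 3 by (force simp: trees_def)
qed

section \<open>Removing a vertex without parents\<close>

lemma mps_over_mono: "mps_over V F \<Longrightarrow> V \<subseteq> W \<Longrightarrow> mps_over W F"
  by (auto simp: mps_over_def)

text \<open>No series involves the variable of \<open>z\<close>, so the value at \<open>z\<close>
  never feeds back: the solution over \<open>I\<close>, completed by one substitution at
  \<open>z\<close>, solves the larger system, and solutions are unique.\<close>

lemma solution_restrict:
  assumes over: "\<And>i. i \<in> insert z I \<Longrightarrow> mps_over I (F i)" and z: "z \<notin> I" and i: "i \<in> I"
  shows "solution (insert z I) F i = solution I F i"
proof -
  define X where "X = solution I F"
  define Y where "Y = X(z := graft z (mps_subst (F z) X))"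
  have sub: "cck_over I \<subseteq> cck_over (insert z I)"
    by (auto simp: cck_over_def intro: mps_over_mono)
  have XY: "mps_subst (F k) Y = mps_subst (F k) X" if "k \<in> insert z I" for k
    using over[OF that] z by (intro mps_subst_cong[of I]) (auto simp: Y_def)
  have "is_solution (insert z I) F Y"
    unfolding is_solution_def
  proof (intro conjI ballI allI impI)
    fix k assume k: "k \<in> insert z I"
    show "Y k \<in> cck_over (insert z I)"
    proof (cases "k = z")
      case True
      thus ?thesis using cck_over_graft_subst[of X "insert z I" z "F z"] solution_over[of I F] sub
        by (auto simp: Y_def X_def)
    next
      case False
      thus ?thesis using solution_over[of I F] sub by (auto simp: Y_def X_def)
    qed
    show "Y k = graft k (mps_subst (F k) Y)"
      using XY[OF k] k solution_eq[of k I F] by (auto simp: Y_def X_def)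
  next
    fix k assume "k \<notin> insert z I"
    thus "Y k = 0" by (simp add: Y_def X_def solution_outside)
  qed
  hence "Y = solution (insert z I) F"
    using solution_exists_unique[of "insert z I" F] is_solution_solution by blast
  moreover have "i \<noteq> z" using z i by blast
  ultimately show ?thesis by (metis Y_def X_def fun_upd_other)
qed

section \<open>Supports in forests over a set of decorations\<close>

definition forest_over :: "'i set \<Rightarrow> 'i forest \<Rightarrow> bool" where
  "forest_over I f \<longleftrightarrow> (\<forall>t\<in>#f. set_rtree t \<subseteq> I)"

lemma forest_over_simps [simp]:
  "forest_over I {#}"
  "forest_over I (add_mset t f) \<longleftrightarrow> set_rtree t \<subseteq> I \<and> forest_over I f"
  "forest_over I (f + g) \<longleftrightarrow> forest_over I f \<and> forest_over I g"
  by (auto simp: forest_over_def)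

lemma forest_over_mono: "a \<subseteq># f \<Longrightarrow> forest_over I f \<Longrightarrow> forest_over I a"
  by (auto simp: forest_over_def dest: mset_subset_eqD)

lemma ck_over_iff: "x \<in> ck_over I \<longleftrightarrow> (\<forall>f. Poly_Mapping.lookup x f \<noteq> 0 \<longrightarrow> forest_over I f)"
  unfolding ck_over_def forest_over_def Ball_def in_keys_iff by (rule mem_Collect_eq)

lemma subspace_ck_over: "module.subspace scale (ck_over I)"
  by (rule subspaceI) (auto simp: ck_over_iff lookup_add, metis add_0)

lemma ck_over_mult: "x \<in> ck_over I \<Longrightarrow> y \<in> ck_over I \<Longrightarrow> x * y \<in> ck_over I"
  unfolding ck_over_iff
proof (intro allI impI)
  fix f
  assume xy: "\<forall>f. Poly_Mapping.lookup x f \<noteq> 0 \<longrightarrow> forest_over I f"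
    "\<forall>f. Poly_Mapping.lookup y f \<noteq> 0 \<longrightarrow> forest_over I f" "Poly_Mapping.lookup (x * y) f \<noteq> 0"
  from xy(3) have "f \<in> Poly_Mapping.keys (x * y)" by (simp add: in_keys_iff)
  hence "f \<in> {a + b | a b. a \<in> Poly_Mapping.keys x \<and> b \<in> Poly_Mapping.keys y}"
    using keys_mult[of x y] by (rule rev_subsetD)
  then obtain a b where "f = a + b" "a \<in> Poly_Mapping.keys x" "b \<in> Poly_Mapping.keys y" by blast
  thus "forest_over I f" using xy by (simp add: in_keys_iff)
qed

lemma subalgebra_ck_over: "subalgebra (ck_over I)"
  by (simp add: subalgebra_def subspace_ck_over ck_over_mult) (auto simp: ck_over_iff lookup_one when_def)

lemma subalgebra_sdse_algebra: "subalgebra (sdse_algebra I F)"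
  unfolding sdse_algebra_def
  by (rule hull_in) (auto simp: subalgebra_def module.subspace_def[OF module_scale])

lemma subalgebraD:
  assumes "subalgebra A"
  shows "0 \<in> A" "1 \<in> A" "x \<in> A \<Longrightarrow> y \<in> A \<Longrightarrow> x + y \<in> A" "x \<in> A \<Longrightarrow> scale c x \<in> A"
    "x \<in> A \<Longrightarrow> y \<in> A \<Longrightarrow> x * y \<in> A"
  using assms by (auto simp: subalgebra_def module.subspace_def[OF module_scale])

lemma sdse_algebra_over:
  assumes "finite I"
  shows "sdse_algebra I F \<subseteq> ck_over I"
  by (rule sdse_algebra_minimal[OF subalgebra_ck_over])
     (auto simp: ck_over_iff lookup_homogeneous_solution[OF assms] trees_def split: if_splits)

definition ck2_over :: "'i set \<Rightarrow> ('i, 'k :: field) ck2 set" where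
  "ck2_over I = {u. \<forall>f g. Poly_Mapping.lookup u (f, g) \<noteq> 0 \<longrightarrow> forest_over I f \<and> forest_over I g}"

lemma subspace_ck2_over: "module.subspace scale (ck2_over I :: ('i, 'k :: field) ck2 set)"
proof (rule subspaceI)
  fix x y :: "('i, 'k) ck2" assume xy: "x \<in> ck2_over I" "y \<in> ck2_over I"
  have "forest_over I f \<and> forest_over I g" if "Poly_Mapping.lookup (x + y) (f, g) \<noteq> 0" for f g
  proof -
    have "Poly_Mapping.lookup x (f, g) \<noteq> 0 \<or> Poly_Mapping.lookup y (f, g) \<noteq> 0"
      using that by (auto simp: lookup_add)
    thus ?thesis using xy unfolding ck2_over_def by blast
  qed
  thus "x + y \<in> ck2_over I" by (simp add: ck2_over_def)
qed (auto simp: ck2_over_def)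

lemma ck2_over_mult: "u \<in> ck2_over I \<Longrightarrow> v \<in> ck2_over I \<Longrightarrow> u * v \<in> ck2_over I"
  unfolding ck2_over_def
proof (intro CollectI allI impI)
  fix f g
  assume uv: "u \<in> {u. \<forall>f g. Poly_Mapping.lookup u (f, g) \<noteq> 0 \<longrightarrow> forest_over I f \<and> forest_over I g}"
    "v \<in> {u. \<forall>f g. Poly_Mapping.lookup u (f, g) \<noteq> 0 \<longrightarrow> forest_over I f \<and> forest_over I g}"
    "Poly_Mapping.lookup (u * v) (f, g) \<noteq> 0"
  from uv(3) have "(f, g) \<in> Poly_Mapping.keys (u * v)" by (simp add: in_keys_iff)
  hence "(f, g) \<in> {a + b | a b. a \<in> Poly_Mapping.keys u \<and> b \<in> Poly_Mapping.keys v}"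
    using keys_mult[of u v] by (rule rev_subsetD)
  then obtain a b c d where "f = a + c" "g = b + d" "(a, b) \<in> Poly_Mapping.keys u" "(c, d) \<in> Poly_Mapping.keys v"
    by auto
  thus "forest_over I f \<and> forest_over I g" using uv by (auto simp: in_keys_iff)
qed

lemma tensor_over: "x \<in> ck_over I \<Longrightarrow> y \<in> ck_over I \<Longrightarrow> tensor x y \<in> ck2_over I"
  by (auto simp: ck2_over_def ck_over_iff)

lemma of_forest_over: "forest_over I f \<Longrightarrow> of_forest f \<in> ck_over I"
  by (auto simp: ck_over_iff of_forest_def lookup_single when_def)

lemma set_shape: "set_rtree (shape p) = set_ptree p"
  by (induction p) auto

lemma set_prune: "set_ptree (prune c p) \<subseteq> set_ptree p"
proof (induction p arbitrary: c)
  case (PNode i ts)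
  show ?case
  proof
    fix x assume "x \<in> set_ptree (prune c (PNode i ts))"
    then consider "x = i" | k where "k < length ts" "x \<in> set_ptree (prune {p. k # p \<in> c} (ts ! k))"
      by auto
    thus "x \<in> set_ptree (PNode i ts)"
    proof cases
      case 2
      hence "x \<in> set_ptree (ts ! k)" using PNode[of "ts ! k"] by auto
      thus ?thesis using 2(1) by auto
    qed simp
  qed
qed

lemma set_subtree: "is_vertex p q \<Longrightarrow> set_ptree (subtree p q) \<subseteq> set_ptree p"
proof (induction q arbitrary: p)
  case (Cons k q)
  obtain i ts where p: "p = PNode i ts" by (cases p)
  have "set_ptree (subtree (ts ! k) q) \<subseteq> set_ptree (ts ! k)" using Cons by (simp add: p)
  thus ?case using Cons.prems by (auto simp: p)
qed simp

lemma component_over: "is_vertex p e \<Longrightarrow> set_rtree (component c p e) \<subseteq> set_ptree p"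
  unfolding component_def set_shape using set_prune set_subtree by (meson subset_trans)

lemma coprod_tree_over:
  assumes "set_rtree t \<subseteq> I"
  shows "coprod_tree t \<in> ck2_over I"
proof -
  have t: "set_ptree (planar_rep t) \<subseteq> I"
    using assms by (simp flip: set_shape)
  have "(\<Sum>c\<in>admissible_cuts (planar_rep t). tensor (of_forest (cut_forest c (planar_rep t)))
      (of_forest {#cut_root c (planar_rep t)#})) \<in> ck2_over I"
  proof (rule module.subspace_sum[OF module_scale subspace_ck2_over])
    fix c assume "c \<in> admissible_cuts (planar_rep t)"
    hence "is_vertex (planar_rep t) e" if "e \<in> c" for e
      using that by (auto simp: admissible_cuts_def edges_def)
    hence "forest_over I (cut_forest c (planar_rep t))"
      using t component_over by (cases "finite c") (fastforce simp: forest_over_def cut_forest_def)+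
    moreover have "set_rtree (cut_root c (planar_rep t)) \<subseteq> I"
      using t component_over[of "planar_rep t" "[]" c] by (simp add: cut_root_def)
    ultimately show "tensor (of_forest (cut_forest c (planar_rep t)))
      (of_forest {#cut_root c (planar_rep t)#}) \<in> ck2_over I"
      by (intro tensor_over of_forest_over) auto
  qed
  moreover have "tensor (of_forest {#t#}) 1 \<in> ck2_over I" "tensor 1 (of_forest {#t#}) \<in> ck2_over I"
    using assms by (auto intro!: tensor_over of_forest_over subalgebraD[OF subalgebra_ck_over])
  ultimately show ?thesis unfolding coprod_tree_def Let_def
    by (intro module.subspace_add[OF module_scale subspace_ck2_over])
qed

lemma prod_coprod_tree_over: "forest_over I f \<Longrightarrow> (\<Prod>t\<in>#f. coprod_tree t) \<in> ck2_over I"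
proof (induction f)
  case empty
  show ?case by (auto simp: ck2_over_def lookup_one when_def zero_prod_def)
next
  case (add t f)
  thus ?case by (auto intro!: ck2_over_mult coprod_tree_over)
qed

lemma coprod_over:
  assumes "x \<in> ck_over I"
  shows "coprod x \<in> ck2_over I"
  unfolding coprod_def
proof (rule module.subspace_sum[OF module_scale subspace_ck2_over])
  fix f assume "f \<in> Poly_Mapping.keys x"
  hence "forest_over I f" using assms by (simp add: ck_over_iff in_keys_iff)
  thus "scale (Poly_Mapping.lookup x f) (\<Prod>t\<in>#f. coprod_tree t) \<in> ck2_over I"
    by (intro module.subspace_scale[OF module_scale subspace_ck2_over] prod_coprod_tree_over)
qed

text \<open>The components of a cut partition the vertices. Inserting \<open>[]\<close> accounts for
  the component of the root; the induction restricts the cut to each branch.\<close>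

lemma vertices_components:
  assumes "c \<subseteq> {q. is_vertex p q}"
  shows "(\<Sum>e\<in>insert [] c. vertices (component c p e)) = vertices (shape p)"
  using assms
proof (induction p arbitrary: c)
  case (PNode i ts)
  define d where "d k = {q. k # q \<in> c}" for k
  let ?n = "length ts"
  have dv: "d k \<subseteq> {q. is_vertex (ts ! k) q}" for k using PNode.prems by (auto simp: d_def)
  hence fd: "finite (d k)" for k using finite_is_vertex finite_subset by blast
  have c: "c - {[]} = (\<Union>k<?n. (#) k ` d k)"
  proof (rule set_eqI)
    fix e
    show "e \<in> c - {[]} \<longleftrightarrow> e \<in> (\<Union>k<?n. (#) k ` d k)"
    proof (cases e)
      case (Cons k q)
      have "k < ?n" if "k # q \<in> c"
        using that PNode.prems by auto
      thus ?thesis by (auto simp: Cons d_def)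
    qed auto
  qed
  have comp: "component c (PNode i ts) (k # q) = component (d k) (ts ! k) q" for k q
    by (simp add: component_def d_def)
  have "vertices (component c (PNode i ts) []) =
      Suc (\<Sum>k\<leftarrow>filter (\<lambda>k. [k] \<notin> c) [0..<?n]. vertices (shape (prune (d k) (ts ! k))))"
    by (simp add: component_def d_def sum_mset_sum_list image_mset.compositionality o_def flip: mset_map)
  \<comment> \<open>A branch cut off at the root contributes nothing here; the top of any other
    branch belongs to the component of the root.\<close>
  also have "(\<Sum>k\<leftarrow>filter (\<lambda>k. [k] \<notin> c) [0..<?n]. vertices (shape (prune (d k) (ts ! k)))) =
      (\<Sum>k<?n. if [] \<in> d k then 0 else vertices (component (d k) (ts ! k) []))"
    by (subst sum_list_distinct_conv_sum_set) (auto simp: component_def d_def sum.inter_filter[symmetric] if_not_P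
        intro!: sum.mono_neutral_cong_left split: if_splits)
  finally have root: "vertices (component c (PNode i ts) []) =
      Suc (\<Sum>k<?n. if [] \<in> d k then 0 else vertices (component (d k) (ts ! k) []))" .
  have "finite c" using PNode.prems finite_is_vertex finite_subset by blast
  hence "(\<Sum>e\<in>insert [] c. vertices (component c (PNode i ts) e)) =
      vertices (component c (PNode i ts) []) + (\<Sum>e\<in>c - {[]}. vertices (component c (PNode i ts) e))"
    by (simp add: sum.insert_remove)
  also have "(\<Sum>e\<in>c - {[]}. vertices (component c (PNode i ts) e)) =
      (\<Sum>k<?n. \<Sum>e\<in>(#) k ` d k. vertices (component c (PNode i ts) e))"
    unfolding c by (rule sum.UNION_disjoint) (auto simp: fd)
  also have "\<dots> = (\<Sum>k<?n. \<Sum>q\<in>d k. vertices (component (d k) (ts ! k) q))"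
    by (rule sum.cong[OF refl], subst sum.reindex) (auto simp: comp)
  finally have "(\<Sum>e\<in>insert [] c. vertices (component c (PNode i ts) e)) =
      Suc (\<Sum>k<?n. (if [] \<in> d k then 0 else vertices (component (d k) (ts ! k) [])) +
        (\<Sum>q\<in>d k. vertices (component (d k) (ts ! k) q)))"
    by (simp add: root sum.distrib)
  also have "\<dots> = Suc (\<Sum>k<?n. vertices (shape (ts ! k)))"
  proof (intro arg_cong[of _ _ Suc] sum.cong refl)
    fix k assume "k \<in> {..<?n}"
    hence "(\<Sum>q\<in>insert [] (d k). vertices (component (d k) (ts ! k) q)) = vertices (shape (ts ! k))"
      by (intro PNode.IH dv) simp
    thus "(if [] \<in> d k then 0 else vertices (component (d k) (ts ! k) [])) +
        (\<Sum>q\<in>d k. vertices (component (d k) (ts ! k) q)) = vertices (shape (ts ! k))"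
      using fd[of k] by (auto simp: sum.insert_if insert_absorb split: if_splits)
  qed
  also have "\<dots> = vertices (shape (PNode i ts))"
    by (simp add: sum_mset_sum_list sum_list_sum_nth atLeast0LessThan flip: mset_map)
  finally show ?case .
qed

lemma cut_forest_vertices:
  assumes "c \<in> admissible_cuts p"
  shows "forest_vertices (cut_forest c p) < vertices (shape p)"
proof -
  have c: "c \<subseteq> {q. is_vertex p q}" "[] \<notin> c" using assms by (auto simp: admissible_cuts_def edges_def)
  have "finite c" using c finite_is_vertex finite_subset by blast
  hence "forest_vertices (cut_forest c p) = (\<Sum>e\<in>c. vertices (component c p e))"
    by (simp add: forest_vertices_def cut_forest_def image_mset.compositionality o_def sum_unfold_sum_mset)
  moreover have "vertices (component c p []) + (\<Sum>e\<in>c. vertices (component c p e)) = vertices (shape p)"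
    using vertices_components[OF c(1)] c(2) \<open>finite c\<close> by simp
  ultimately show ?thesis using vertices_pos[of "component c p []"] by linarith
qed

text \<open>The triangularity that lets the antipode equation be solved for the value at
  \<open>f\<close>: in all other terms the antipode is applied to a smaller forest.\<close>

definition leading_left :: "'i forest \<Rightarrow> ('i, 'k :: field) ck2 \<Rightarrow> bool" where
  "leading_left f u \<longleftrightarrow> (\<exists>v. u = Poly_Mapping.single (f, {#}) 1 + v \<and>
     (\<forall>g h. Poly_Mapping.lookup v (g, h) \<noteq> 0 \<longrightarrow> forest_vertices g < forest_vertices f))"

lemma forest_vertices_plus [simp]: "forest_vertices (f + g) = forest_vertices f + forest_vertices g"
  by (simp add: forest_vertices_def)

lemma leading_left_mult:
  assumes "leading_left f u" "leading_left f' u'"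
  shows "leading_left (f + f') (u * u')"
proof -
  obtain v where u: "u = Poly_Mapping.single (f, {#}) 1 + v"
    and v: "\<And>g h. Poly_Mapping.lookup v (g, h) \<noteq> 0 \<Longrightarrow> forest_vertices g < forest_vertices f"
    using assms(1) unfolding leading_left_def by blast
  obtain v' where u': "u' = Poly_Mapping.single (f', {#}) 1 + v'"
    and v': "\<And>g h. Poly_Mapping.lookup v' (g, h) \<noteq> 0 \<Longrightarrow> forest_vertices g < forest_vertices f'"
    using assms(2) unfolding leading_left_def by blast
  let ?s = "Poly_Mapping.single (f, {#}) 1" and ?s' = "Poly_Mapping.single (f', {#}) 1"
  let ?w = "?s * v' + (v * ?s' + v * v')"
  have prod: "forest_vertices g < forest_vertices f + forest_vertices f'"
    if "Poly_Mapping.lookup (x * y) (g, h) \<noteq> 0"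
      and "\<And>a b a' b'. Poly_Mapping.lookup x (a, b) \<noteq> 0 \<Longrightarrow> Poly_Mapping.lookup y (a', b') \<noteq> 0 \<Longrightarrow>
        forest_vertices a + forest_vertices a' < forest_vertices f + forest_vertices f'"
    for x y :: "('a, 'b) ck2" and g h
  proof -
    have "(g, h) \<in> Poly_Mapping.keys (x * y)" using that(1) by (simp add: in_keys_iff)
    hence "(g, h) \<in> {a + b | a b. a \<in> Poly_Mapping.keys x \<and> b \<in> Poly_Mapping.keys y}"
      using keys_mult[of x y] by (rule rev_subsetD)
    then obtain a b a' b' where "g = a + a'" "h = b + b'" "(a, b) \<in> Poly_Mapping.keys x" "(a', b') \<in> Poly_Mapping.keys y"
      by auto
    thus ?thesis using that(2) by (simp add: in_keys_iff)
  qed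
  have "u * u' = Poly_Mapping.single (f + f', {#}) 1 + ?w"
    by (simp add: u u' algebra_simps mult_single)
  moreover have "forest_vertices g < forest_vertices (f + f')" if "Poly_Mapping.lookup ?w (g, h) \<noteq> 0" for g h
  proof -
    consider "Poly_Mapping.lookup (?s * v') (g, h) \<noteq> 0" | "Poly_Mapping.lookup (v * ?s') (g, h) \<noteq> 0"
      | "Poly_Mapping.lookup (v * v') (g, h) \<noteq> 0"
      using \<open>Poly_Mapping.lookup ?w (g, h) \<noteq> 0\<close> unfolding lookup_add by (metis add_0)
    thus ?thesis
    proof cases
      case 1
      show ?thesis unfolding forest_vertices_plus
        by (rule prod[OF 1]) (use v' in \<open>auto simp: lookup_single when_def split: if_splits\<close>)
    next
      case 2
      show ?thesis unfolding forest_vertices_plus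
        by (rule prod[OF 2]) (use v in \<open>auto simp: lookup_single when_def split: if_splits\<close>)
    next
      case 3
      show ?thesis unfolding forest_vertices_plus
        by (rule prod[OF 3]) (use v v' add_strict_mono in blast)
    qed
  qed
  ultimately show ?thesis unfolding leading_left_def by blast
qed

lemma add_nonzeroD: "a + b \<noteq> (0 :: 'a :: comm_monoid_add) \<Longrightarrow> a \<noteq> 0 \<or> b \<noteq> 0"
  by auto

text \<open>An admissible cut leaves at least the root on the right, so its left factor is strictly
  smaller than \<open>t\<close>.\<close>

lemma leading_left_coprod_tree: "leading_left {#t#} (coprod_tree t :: ('i, 'k :: field) ck2)"
proof -
  let ?p = "planar_rep t"
  let ?v = "tensor 1 (of_forest {#t#}) + (\<Sum>c\<in>admissible_cuts ?p.
     tensor (of_forest (cut_forest c ?p)) (of_forest {#cut_root c ?p#})) :: ('i, 'k) ck2"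
  have "tensor (of_forest {#t#}) 1 = (Poly_Mapping.single ({#t#}, {#}) 1 :: ('i, 'k) ck2)"
    by (rule poly_mapping_eqI, rename_tac k, case_tac k)
       (auto simp: of_forest_def lookup_single lookup_one when_def)
  hence "coprod_tree t = Poly_Mapping.single ({#t#}, {#}) 1 + ?v"
    by (simp add: coprod_tree_def Let_def add.assoc)
  moreover have "forest_vertices g < forest_vertices {#t#}" if v: "Poly_Mapping.lookup ?v (g, h) \<noteq> 0" for g h
  proof -
    consider "Poly_Mapping.lookup (tensor 1 (of_forest {#t#}) :: ('i, 'k) ck2) (g, h) \<noteq> 0"
      | "(\<Sum>c\<in>admissible_cuts ?p. Poly_Mapping.lookup (tensor (of_forest (cut_forest c ?p))
          (of_forest {#cut_root c ?p#}) :: ('i, 'k) ck2) (g, h)) \<noteq> 0"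
      using add_nonzeroD[OF v[unfolded lookup_add lookup_sum]] by blast
    thus ?thesis
    proof cases
      case 1
      thus ?thesis by (auto simp: lookup_one when_def forest_vertices_def split: if_splits)
    next
      case 2
      then obtain c where c: "c \<in> admissible_cuts ?p" "Poly_Mapping.lookup (tensor (of_forest (cut_forest c ?p))
          (of_forest {#cut_root c ?p#}) :: ('i, 'k) ck2) (g, h) \<noteq> 0"
        by (rule sum.not_neutral_contains_not_neutral)
      hence "g = cut_forest c ?p" by (auto simp: of_forest_def lookup_single when_def split: if_splits)
      thus ?thesis using cut_forest_vertices[OF c(1)] by (simp add: forest_vertices_def)
    qed
  qed
  ultimately show ?thesis unfolding leading_left_def by blast
qed

lemma leading_left_coprod: "leading_left f (\<Prod>t\<in>#f. coprod_tree t)"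
proof (induction f)
  case empty
  show ?case by (auto simp: leading_left_def zero_prod_def[symmetric] single_one intro!: exI[of _ 0])
next
  case (add t f)
  thus ?case using leading_left_mult[OF leading_left_coprod_tree[of t] add] by simp
qed

text \<open>Solving the antipode equation at \<open>f\<close> expresses
  \<open>S (of_forest f)\<close> by values of \<open>S\<close> at smaller forests, which the
  coproduct keeps over \<open>I\<close>. So every antipode respects the decoration set.\<close>

lemma antipode_forest_over:
  fixes S :: "('i, 'k :: field) ck \<Rightarrow> ('i, 'k) ck"
  assumes S: "is_antipode S"
  shows "forest_over I f \<Longrightarrow> S (of_forest f) \<in> ck_over I"
proof (induction "forest_vertices f" arbitrary: f rule: less_induct)
  case less
  let ?u = "\<Prod>t\<in>#f. coprod_tree t :: ('i, 'k) ck2"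
  obtain v where u: "?u = Poly_Mapping.single (f, {#}) 1 + v"
    and v: "\<And>g h. Poly_Mapping.lookup v (g, h) \<noteq> 0 \<Longrightarrow> forest_vertices g < forest_vertices f"
    using leading_left_coprod[of f] unfolding leading_left_def by blast
  have cop: "coprod (of_forest f) = ?u"
    by (rule poly_mapping_eqI) (simp add: lookup_coprod of_forest_def)
  have fv: "(f, {#}) \<notin> Poly_Mapping.keys v" using v[of f "{#}"] by (auto simp: in_keys_iff)
  have lu: "Poly_Mapping.lookup ?u k = (if k = (f, {#}) then 1 else Poly_Mapping.lookup v k)" for k
    using fv by (auto simp: u lookup_add lookup_single when_def in_keys_iff)
  hence ku: "Poly_Mapping.keys ?u = insert (f, {#}) (Poly_Mapping.keys v)"
    by (auto simp: in_keys_iff set_eq_iff split: if_splits)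
  let ?h = "\<lambda>(g, h). scale (Poly_Mapping.lookup ?u (g, h)) (S (of_forest g) * of_forest h)"
  have over: "forest_over I g" "forest_over I h" if "(g, h) \<in> Poly_Mapping.keys ?u" for g h
    using prod_coprod_tree_over[OF less.prems, where ?'b = 'k] that by (auto simp: ck2_over_def in_keys_iff)
  have "sum ?h (Poly_Mapping.keys v) \<in> ck_over I"
  proof (rule module.subspace_sum[OF module_scale subspace_ck_over])
    fix k assume k: "k \<in> Poly_Mapping.keys v"
    obtain g h where [simp]: "k = (g, h)" by (cases k)
    have "forest_vertices g < forest_vertices f" using k v by (auto simp: in_keys_iff)
    moreover have "forest_over I g" "forest_over I h" using over k by (auto simp: ku)
    ultimately have "S (of_forest g) * of_forest h \<in> ck_over I"
      using less.hyps by (intro ck_over_mult of_forest_over) auto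
    thus "?h k \<in> ck_over I"
      by (simp add: module.subspace_scale[OF module_scale subspace_ck_over])
  qed
  moreover have "mult_tensor S id ?u = S (of_forest f) + sum ?h (Poly_Mapping.keys v)"
  proof -
    have "mult_tensor S id ?u = sum ?h (insert (f, {#}) (Poly_Mapping.keys v))"
      unfolding mult_tensor_def ku by simp
    also have "\<dots> = ?h (f, {#}) + sum ?h (Poly_Mapping.keys v)" using fv by simp
    also have "?h (f, {#}) = S (of_forest f)"
      unfolding case_prod_conv lu by (simp add: of_forest_def scale_def)
    finally show ?thesis .
  qed
  moreover have "mult_tensor S id ?u = scale (counit (of_forest f)) 1"
    using S unfolding is_antipode_def cop[symmetric] by blast
  ultimately have eq: "S (of_forest f) = scale (counit (of_forest f)) 1 - sum ?h (Poly_Mapping.keys v)"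
    and sum: "sum ?h (Poly_Mapping.keys v) \<in> ck_over I" by (simp_all only: eq_diff_eq)
  have "scale (counit (of_forest f)) 1 \<in> ck_over I"
    by (intro subalgebraD(2,4)[OF subalgebra_ck_over])
  thus ?case unfolding eq by (rule module.subspace_diff[OF module_scale subspace_ck_over _ sum])
qed

lemma antipode_over:
  assumes S: "is_antipode S" and x: "x \<in> ck_over I"
  shows "S x \<in> ck_over I"
proof -
  have lin: "Vector_Spaces.linear scale scale S" using S by (simp add: is_antipode_def)
  hence hom: "module_hom scale scale S" by (simp add: Vector_Spaces.linear_iff_module_hom)
  have "x = (\<Sum>f\<in>Poly_Mapping.keys x. scale (Poly_Mapping.lookup x f) (of_forest f))"
    by (rule poly_mapping_eqI)
       (simp add: lookup_sum of_forest_def lookup_single when_def in_keys_iff if_distrib[of "(*) _"] cong: if_cong)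
  hence "S x = S (\<Sum>f\<in>Poly_Mapping.keys x. scale (Poly_Mapping.lookup x f) (of_forest f))" by (rule arg_cong)
  also have "\<dots> = (\<Sum>f\<in>Poly_Mapping.keys x. scale (Poly_Mapping.lookup x f) (S (of_forest f)))"
    by (simp add: module_hom.sum[OF hom] module_hom.scale[OF hom])
  also have "\<dots> \<in> ck_over I"
  proof (rule module.subspace_sum[OF module_scale subspace_ck_over])
    fix f assume "f \<in> Poly_Mapping.keys x"
    hence "forest_over I f" using x by (simp add: ck_over_iff in_keys_iff)
    thus "scale (Poly_Mapping.lookup x f) (S (of_forest f)) \<in> ck_over I"
      by (intro module.subspace_scale[OF module_scale subspace_ck_over] antipode_forest_over[OF S])
  qed
  finally show ?thesis .
qed

text \<open>Discarding the forests that are not over \<open>I\<close> is an algebra morphism, since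
  the factors of a forest over \<open>I\<close> are over \<open>I\<close>. It fixes the generators
  with root in \<open>I\<close> and kills those with root \<open>z\<close>.\<close>

lemma sdse_algebra_restrict:
  fixes F :: "'i \<Rightarrow> ('i, 'k :: field_char_0) mps"
  assumes fin: "finite I" and over: "\<And>i. i \<in> insert z I \<Longrightarrow> mps_over I (F i)" and z: "z \<notin> I"
    and x: "x \<in> sdse_algebra (insert z I) F"
  shows "\<exists>y\<in>sdse_algebra I F. \<forall>f. forest_over I f \<longrightarrow> Poly_Mapping.lookup x f = Poly_Mapping.lookup y f"
proof -
  let ?A = "sdse_algebra I F"
  let ?eq = "\<lambda>x y. \<forall>f. forest_over I f \<longrightarrow> Poly_Mapping.lookup x f = Poly_Mapping.lookup y f"
  let ?Q = "{x :: ('i, 'k) ck. \<exists>y\<in>?A. ?eq x y}"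
  note A = subalgebraD[OF subalgebra_sdse_algebra[of I F]]
  have "sdse_algebra (insert z I) F \<subseteq> ?Q"
  proof (rule sdse_algebra_minimal)
    have "module.subspace scale ?Q"
    proof (rule subspaceI)
      show "0 \<in> ?Q" by (intro CollectI bexI[of _ 0] A(1)) simp
    next
      fix x x' assume "x \<in> ?Q" "x' \<in> ?Q"
      then obtain y y' where "y \<in> ?A" "y' \<in> ?A" "?eq x y" "?eq x' y'" by blast
      thus "x + x' \<in> ?Q" using A(3) by (auto simp: lookup_add intro!: bexI[of _ "y + y'"])
    next
      fix c x assume "x \<in> ?Q"
      then obtain y where "y \<in> ?A" "?eq x y" by blast
      thus "scale c x \<in> ?Q" using A(4) by (auto intro!: bexI[of _ "scale c y"])
    qed
    moreover have "x * x' \<in> ?Q" if xx: "x \<in> ?Q" "x' \<in> ?Q" for x x'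
    proof -
      obtain y y' where y: "y \<in> ?A" "y' \<in> ?A" "?eq x y" "?eq x' y'" using xx by blast
      have "?eq (x * x') (y * y')"
      proof (intro allI impI)
        fix f assume f: "forest_over I f"
        show "Poly_Mapping.lookup (x * x') f = Poly_Mapping.lookup (y * y') f"
          unfolding lookup_mult_forest
        proof (rule sum.cong)
          fix a assume "a \<in> {a. a \<subseteq># f}"
          hence "forest_over I a" "forest_over I (f - a)"
            using f forest_over_mono diff_subset_eq_self by blast+
          thus "Poly_Mapping.lookup x a * Poly_Mapping.lookup x' (f - a) =
              Poly_Mapping.lookup y a * Poly_Mapping.lookup y' (f - a)" using y by simp
        qed simp
      qed
      thus ?thesis using A(5)[OF y(1,2)] by blast
    qed
    moreover have "1 \<in> ?Q" using A(2) by blast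
    ultimately show "subalgebra ?Q" by (simp add: subalgebra_def)
  next
    fix i n assume i: "i \<in> insert z I"
    have fin': "finite (insert z I)" using fin by simp
    show "homogeneous_part n (solution (insert z I) F i) \<in> ?Q"
    proof (cases "i = z")
      case True
      have "Poly_Mapping.lookup (homogeneous_part n (solution (insert z I) F z)) f = 0"
        if f: "forest_over I f" for f
      proof -
        have "f \<noteq> {#t#}" if "t \<in> trees (insert z I) z n" for t
        proof
          assume "f = {#t#}"
          hence "root t \<in> I" using f by (cases t) auto
          thus False using that z by (simp add: trees_def)
        qed
        thus ?thesis unfolding lookup_homogeneous_solution[OF fin'] by auto
      qed
      thus ?thesis unfolding True by (intro CollectI bexI[of _ 0] A(1)) simp
    next
      case False
      hence "i \<in> I" using i by simp
      thus ?thesis using homogeneous_part_in_sdse_algebra[of i I n F]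
          solution_restrict[of z I F i] over z by auto
    qed
  qed
  thus ?thesis using x by blast
qed

text \<open>The smaller algebra is the part of the larger one supported over \<open>I\<close>.
  Coproduct and antipode preserve supports over \<open>I\<close>, so both closure properties are
  inherited.\<close>

lemma hopf_sdse_restrict:
  fixes F :: "'i \<Rightarrow> ('i, 'k :: field_char_0) mps"
  assumes hopf: "hopf_sdse (insert z I) F" and I: "I \<noteq> {}"
    and over: "\<And>i. i \<in> insert z I \<Longrightarrow> mps_over I (F i)" and z: "z \<notin> I"
  shows "hopf_sdse I F"
proof -
  let ?A = "sdse_algebra I F" and ?B = "sdse_algebra (insert z I) F"
  have fin: "finite I" and sdse: "sdse I F"
    using hopf I over by (auto simp: hopf_sdse_def sdse_def)
  note A = subalgebraD[OF subalgebra_sdse_algebra[of I F]]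
  have restr: "\<exists>y\<in>?A. \<forall>f. forest_over I f \<longrightarrow> Poly_Mapping.lookup x f = Poly_Mapping.lookup y f"
    if x: "x \<in> ?B" for x
    by (rule sdse_algebra_restrict[OF fin _ z x]) (rule over)
  have AB: "?A \<subseteq> ?B"
  proof (rule sdse_algebra_minimal[OF subalgebra_sdse_algebra])
    fix i n assume "i \<in> I"
    thus "homogeneous_part n (solution I F i) \<in> ?B"
      using homogeneous_part_in_sdse_algebra[of i "insert z I" n F] solution_restrict[of z I F i] over z by auto
  qed
  have A_over: "?A \<subseteq> ck_over I" by (rule sdse_algebra_over[OF fin])
  have BA: "x \<in> ?A" if xB: "x \<in> ?B" and xI: "x \<in> ck_over I" for x
  proof -
    obtain y where y: "y \<in> ?A" "\<And>f. forest_over I f \<Longrightarrow> Poly_Mapping.lookup x f = Poly_Mapping.lookup y f"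
      using restr[OF xB] by blast
    have "y \<in> ck_over I" using y(1) A_over by blast
    hence "x = y" using y(2) xI by (intro poly_mapping_eqI) (metis ck_over_iff)
    thus ?thesis using y(1) by simp
  qed
  have hB: "hopf_subalgebra (insert z I) ?B" using hopf by (simp add: hopf_sdse_def)
  have "coprod x \<in> module.span scale {tensor y z | y z. y \<in> ?A \<and> z \<in> ?A}" if x: "x \<in> ?A" for x
  proof -
    let ?T = "module.span scale {tensor y z | y z. y \<in> ?A \<and> z \<in> ?A}"
    let ?eq = "\<lambda>u w. \<forall>f g. forest_over I f \<longrightarrow> forest_over I g \<longrightarrow>
        Poly_Mapping.lookup u (f, g) = Poly_Mapping.lookup w (f, g)"
    \<comment> \<open>Both tensor factors are projected to forests over \<open>I\<close>; the
      coproduct of \<open>x\<close> is already supported there and is unchanged.\<close>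
    let ?Q = "{u. \<exists>w\<in>?T. ?eq u w}"
    have "coprod x \<in> module.span scale {tensor y z | y z. y \<in> ?B \<and> z \<in> ?B}"
      using hB x AB unfolding hopf_subalgebra_def by blast
    also have "\<dots> \<subseteq> ?Q"
    proof (rule module.span_minimal[OF module_scale])
      show "{tensor y z | y z. y \<in> ?B \<and> z \<in> ?B} \<subseteq> ?Q"
      proof safe
        fix y z assume "y \<in> ?B" "z \<in> ?B"
        then obtain y' z' where yz: "y' \<in> ?A" "z' \<in> ?A"
          "\<And>f. forest_over I f \<Longrightarrow> Poly_Mapping.lookup y f = Poly_Mapping.lookup y' f"
          "\<And>f. forest_over I f \<Longrightarrow> Poly_Mapping.lookup z f = Poly_Mapping.lookup z' f"
          using restr[of y] restr[of z] by blast
        have "tensor y' z' \<in> ?T" by (rule module.span_base[OF module_scale]) (use yz in blast)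
        moreover have "?eq (tensor y z) (tensor y' z')" using yz by simp
        ultimately show "\<exists>w\<in>?T. ?eq (tensor y z) w" by blast
      qed
      show "module.subspace scale ?Q"
      proof (rule subspaceI)
        show "0 \<in> ?Q" by (intro CollectI bexI[of _ 0] module.span_zero[OF module_scale]) simp
      next
        fix u u' assume "u \<in> ?Q" "u' \<in> ?Q"
        then obtain w w' where "w \<in> ?T" "w' \<in> ?T" "?eq u w" "?eq u' w'" by blast
        thus "u + u' \<in> ?Q"
          by (intro CollectI bexI[of _ "w + w'"] module.span_add[OF module_scale]) (auto simp: lookup_add)
      next
        fix c u assume "u \<in> ?Q"
        then obtain w where "w \<in> ?T" "?eq u w" by blast
        thus "scale c u \<in> ?Q"
          by (intro CollectI bexI[of _ "scale c w"] module.span_scale[OF module_scale]) auto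
      qed
    qed
    finally obtain w where w: "w \<in> ?T" "?eq (coprod x) w" by blast
    have "?T \<subseteq> ck2_over I"
      by (rule module.span_minimal[OF module_scale _ subspace_ck2_over]) (use A_over in \<open>auto intro!: tensor_over\<close>)
    hence wo: "w \<in> ck2_over I" using w(1) by blast
    have co: "coprod x \<in> ck2_over I" using x A_over by (intro coprod_over) blast
    have "coprod x = w"
    proof (rule poly_mapping_eqI)
      fix k :: "'i forest \<times> 'i forest"
      obtain f g where k: "k = (f, g)" by (cases k)
      show "Poly_Mapping.lookup (coprod x) k = Poly_Mapping.lookup w k"
      proof (cases "forest_over I f \<and> forest_over I g")
        case False
        hence "Poly_Mapping.lookup (coprod x) k = 0" "Poly_Mapping.lookup w k = 0"
          using wo co unfolding ck2_over_def k by blast+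
        thus ?thesis by simp
      qed (use w(2) k in auto)
    qed
    thus ?thesis using w(1) by simp
  qed
  moreover obtain S where S: "is_antipode S" "S ` ?B \<subseteq> ?B"
    using hB unfolding hopf_subalgebra_def by blast
  have "S ` ?A \<subseteq> ?A"
    using S AB A_over antipode_over[OF S(1)] BA by blast
  ultimately have "hopf_subalgebra I ?A"
    using S(1) A_over subalgebra_sdse_algebra[of I F] unfolding hopf_subalgebra_def by blast
  thus ?thesis using sdse by (simp add: hopf_sdse_def)
qed

section \<open>Systems with vertices of level at most one\<close>

text \<open>
  Here \<open>\<phi> i m\<close> stands for the divided power coefficients of \<open>F\<^sub>i\<close> and \<open>\<sigma> i j\<close> for
  \<open>\<lambda>\<^sub>2\<^sup>(\<^sup>i\<^sup>,\<^sup>j\<^sup>) - b\<^sub>j\<close>; the set \<open>E\<close> consists of the vertices of level \<open>0\<close>.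
\<close>

locale level_le_one =
  fixes I :: "'i set" and \<phi> :: "'i \<Rightarrow> 'i multiset \<Rightarrow> 'k :: field_char_0"
    and \<sigma> :: "'i \<Rightarrow> 'i \<Rightarrow> 'k" and b :: "'i \<Rightarrow> 'k"
  fixes a c E
  defines "a \<equiv> \<lambda>i j. \<phi> i {#j#}"
  defines "c \<equiv> \<lambda>j l. b j - a l j"
  defines "E \<equiv> {i \<in> I. \<forall>j\<in>I. \<sigma> i j = a i j}"
  assumes finite_I: "finite I" and I_nonempty: "I \<noteq> {}"
    and one: "i \<in> I \<Longrightarrow> \<phi> i {#} = 1"
    and over: "i \<in> I \<Longrightarrow> \<phi> i m \<noteq> 0 \<Longrightarrow> set_mset m \<subseteq> I"
    and step: "i \<in> I \<Longrightarrow> j \<in> I \<Longrightarrow> p \<noteq> {#} \<Longrightarrow>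
      \<phi> i (add_mset j p) = (\<sigma> i j + (\<Sum>l\<in>#p. c j l)) * \<phi> i p"
    and child_E: "i \<in> I \<Longrightarrow> a i k \<noteq> 0 \<Longrightarrow> k \<in> E"
    and has_child: "i \<in> I \<Longrightarrow> \<exists>k. a i k \<noteq> 0"
    and nonlinear: "i \<in> I \<Longrightarrow> i \<notin> E \<Longrightarrow> \<exists>m. size m \<ge> 2 \<and> \<phi> i m \<noteq> 0"
begin

section \<open>Proportional columns of the data\<close>

lemma E_I: "E \<subseteq> I"
  by (auto simp: E_def)

lemma c_eq: "c j l = b j - a l j"
  by (simp add: c_def)

lemma \<sigma>_E: "i \<in> E \<Longrightarrow> j \<in> I \<Longrightarrow> \<sigma> i j = a i j"
  by (simp add: E_def)

lemma phi_two: "i \<in> I \<Longrightarrow> j \<in> I \<Longrightarrow> \<phi> i {#j, k#} = (\<sigma> i j + c j k) * a i k"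
  using step[of i j "{#k#}"] by (simp add: a_def)

lemma commute2:
  assumes "i \<in> I" "j \<in> I" "k \<in> I"
  shows "(\<sigma> i k + c k j) * a i j = (\<sigma> i j + c j k) * a i k"
  using phi_two[OF assms(1,2), of k] phi_two[OF assms(1,3), of j] by (simp add: add_mset_commute)

text \<open>Adding \<open>j\<close> and \<open>k\<close> in either order to \<open>l\<close>
  produces the common product \<open>(\<sigma> i k + c k l) * (\<sigma> i j + c j l)\<close>; what
  remains after cancelling it is the claim.\<close>

lemma commute3:
  assumes "i \<in> I" "j \<in> I" "k \<in> I" "a i l \<noteq> 0"
  shows "c k j * (\<sigma> i j + c j l) = c j k * (\<sigma> i k + c k l)"
proof -
  have "\<phi> i {#k, j, l#} = (\<sigma> i k + (c k j + c k l)) * ((\<sigma> i j + c j l) * a i l)"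
    using step[of i k "{#j, l#}"] assms by (simp add: phi_two)
  moreover have "\<phi> i {#j, k, l#} = (\<sigma> i j + (c j k + c j l)) * ((\<sigma> i k + c k l) * a i l)"
    using step[of i j "{#k, l#}"] assms by (simp add: phi_two)
  ultimately have "((\<sigma> i k + (c k j + c k l)) * (\<sigma> i j + c j l)) * a i l =
      ((\<sigma> i j + (c j k + c j l)) * (\<sigma> i k + c k l)) * a i l"
    by (auto simp: add_mset_commute mult.assoc)
  hence "(\<sigma> i k + (c k j + c k l)) * (\<sigma> i j + c j l) = (\<sigma> i j + (c j k + c j l)) * (\<sigma> i k + c k l)"
    using mult_right_cancel[OF assms(4)] by blast
  thus ?thesis by (simp add: algebra_simps)
qed

text \<open>At level 0 \<open>\<sigma>\<close> equals \<open>a\<close>, so the products of two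
  entries of \<open>a\<close> in \<open>commute2\<close> cancel.\<close>

lemma col_a: "i \<in> E \<Longrightarrow> j \<in> I \<Longrightarrow> k \<in> I \<Longrightarrow> c k j * a i j = c j k * a i k"
  using commute2[of i j k] E_I by (auto simp: \<sigma>_E algebra_simps)

lemma E_nonempty: "E \<noteq> {}"
  using I_nonempty has_child child_E by blast

lemma col_b:
  assumes "j \<in> I" "k \<in> I"
  shows "c k j * b j = c j k * b k"
proof -
  obtain i where i: "i \<in> E" using E_nonempty by blast
  obtain l where l: "a i l \<noteq> 0" "l \<in> E" using has_child[of i] child_E[of i] i E_I by blast
  have "c k j * (a i j + c j l) = c j k * (a i k + c k l)"
    using commute3[of i j k l] i l assms E_I by (auto simp: \<sigma>_E)
  \<comment> \<open>The part with \<open>a i j\<close> and \<open>a i k\<close> is removed by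
    \<open>col_a\<close>; writing \<open>c\<close> as \<open>b\<close> minus \<open>a\<close> and
    using \<open>col_a\<close> at \<open>l\<close> then isolates \<open>b\<close>.\<close>
  hence "c k j * c j l = c j k * c k l"
    using col_a[OF i assms] by (simp add: algebra_simps)
  thus ?thesis using col_a[OF l(2) assms] by (simp add: c_def algebra_simps)
qed

lemma col_c: "i \<in> E \<Longrightarrow> j \<in> I \<Longrightarrow> k \<in> I \<Longrightarrow> c k j * c j i = c j k * c k i"
  using col_a[of i j k] col_b[of j k] c_eq[of j i] c_eq[of k i] by (simp add: right_diff_distrib)

lemma col_\<sigma>:
  assumes "i \<in> I" "j \<in> I" "k \<in> I"
  shows "c k j * \<sigma> i j = c j k * \<sigma> i k"
proof -
  obtain l where l: "a i l \<noteq> 0" "l \<in> E" using has_child[of i] child_E[of i] assms by blast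
  show ?thesis
    using commute3[OF assms l(1)] col_c[OF l(2) assms(2,3)] by (simp add: algebra_simps)
qed

text \<open>For indices outside \<open>S\<close> the columns of \<open>a\<close> and
  \<open>c\<close> over \<open>E\<close> and the entry of \<open>b\<close> vanish, so nontrivial
  proportionality of columns concerns \<open>S\<close> only.\<close>

definition S where "S = {j \<in> I. \<exists>i\<in>E. a i j \<noteq> 0}"

lemma S_E: "S \<subseteq> E"
  using child_E E_I by (auto simp: S_def)

lemma not_S_a: "j \<in> I \<Longrightarrow> j \<notin> S \<Longrightarrow> i \<in> E \<Longrightarrow> a i j = 0"
  by (auto simp: S_def)

lemma not_S_b:
  assumes "j \<in> I" "j \<notin> S"
  shows "b j = 0"
proof -
  obtain i where i: "i \<in> E" using E_nonempty by blast
  obtain k where k: "a i k \<noteq> 0" "k \<in> E" using has_child[of i] child_E[of i] i E_I by blast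
  have "c j k = b j" using not_S_a[OF assms k(2)] by (simp add: c_def)
  \<comment> \<open>Here \<open>col_a\<close> says that \<open>b j * a i k\<close> is zero, as
    column \<open>j\<close> of \<open>a\<close> vanishes over \<open>E\<close>.\<close>
  thus ?thesis using col_a[OF i assms(1), of k] k E_I not_S_a[OF assms i] by auto
qed

lemma not_S_c: "j \<in> I \<Longrightarrow> j \<notin> S \<Longrightarrow> i \<in> E \<Longrightarrow> c j i = 0"
  by (simp add: c_def not_S_a not_S_b)

lemma S_c_sym:
  assumes "j \<in> S" "k \<in> S" "c j k \<noteq> 0"
  shows "c k j \<noteq> 0"
proof
  assume "c k j = 0"
  hence "a i k = 0" if "i \<in> E" for i
    using col_a[OF that, of j k] assms by (auto simp: S_def)
  thus False using assms by (auto simp: S_def)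
qed

text \<open>This is \<open>col_c\<close> at \<open>i = k\<close> after cancelling
  \<open>c j k\<close>.\<close>

lemma S_c_diag:
  assumes "j \<in> S" "k \<in> S" "c j k \<noteq> 0"
  shows "c k j = c k k"
  using col_c[of k j k] assms S_E E_I by auto

lemma support_children:
  assumes "i \<in> I" "\<phi> i m \<noteq> 0" "l \<in># m"
  shows "a i l \<noteq> 0"
proof -
  obtain p where m: "m = add_mset l p" using assms(3) by (metis multi_member_split)
  have "\<phi> i (add_mset l p) \<noteq> 0 \<Longrightarrow> a i l \<noteq> 0"
  proof (induction p)
    case (add q p)
    have "set_mset (add_mset l (add_mset q p)) \<subseteq> I" using over[OF assms(1) add.prems] .
    hence "\<phi> i (add_mset q (add_mset l p)) = (\<sigma> i q + (\<Sum>l\<in>#add_mset l p. c q l)) * \<phi> i (add_mset l p)"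
      using assms(1) by (intro step) auto
    hence "\<phi> i (add_mset l p) \<noteq> 0" using add.prems by (auto simp: add_mset_commute)
    thus ?case by (rule add.IH)
  qed (simp add: a_def)
  thus ?thesis using assms(2) m by simp
qed

lemma support_E: "i \<in> I \<Longrightarrow> \<phi> i m \<noteq> 0 \<Longrightarrow> l \<in># m \<Longrightarrow> l \<in> E"
  using support_children child_E by blast

text \<open>If all these factors vanished, \<open>step\<close> would kill every coefficient of
  degree two and then, inductively, of higher degree. This is how the absence of linear vertices of
  level one is used.\<close>

lemma not_E_nonlinear:
  assumes "i \<in> I" "i \<notin> E"
  shows "\<exists>q\<in>I. \<exists>l. a i l \<noteq> 0 \<and> \<sigma> i q + c q l \<noteq> 0"
proof (rule ccontr)
  assume no: "\<not> ?thesis"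
  have "\<phi> i m = 0" if "size m \<ge> 2" for m
    using that
  proof (induction m)
    case (add q p)
    show ?case
    proof (rule ccontr)
      assume nz: "\<phi> i (add_mset q p) \<noteq> 0"
      have q: "q \<in> I" using over[OF assms(1) nz] by auto
      have "p \<noteq> {#}" using add.prems by auto
      hence nz': "\<phi> i p \<noteq> 0" "\<sigma> i q + (\<Sum>l\<in>#p. c q l) \<noteq> 0"
        using step[OF assms(1) q, of p] nz by auto
      hence "size p < 2" using add.IH by linarith
      hence "size p = 1" using \<open>p \<noteq> {#}\<close> by (cases p) auto
      then obtain l where p: "p = {#l#}" by (metis size_1_singleton_mset)
      have "a i l \<noteq> 0" using nz' p by (simp add: a_def)
      moreover have "\<sigma> i q + c q l \<noteq> 0" using nz' p by simp
      ultimately show False using no q by blast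
    qed
  qed simp
  thus False using nonlinear[OF assms] by auto
qed

lemma not_E_a: "i \<in> I \<Longrightarrow> j \<notin> E \<Longrightarrow> a i j = 0"
  using child_E by blast

lemma not_E_\<sigma>:
  assumes "i \<in> I" "j \<in> I" "j \<notin> E"
  shows "\<sigma> i j = 0"
proof -
  obtain k where k: "a i k \<noteq> 0" "k \<in> E" using has_child[of i] child_E[of i] assms by blast
  have "c j k = 0" using assms S_E k by (intro not_S_c) auto
  thus ?thesis using commute2[of i j k] assms k E_I not_E_a[of i j] by auto
qed

end

text \<open>The alternatives mirror the parts of a fundamental system: diagonal entry
  \<open>1\<close> for \<open>I0\<close>, \<open>0\<close> with \<open>b j = 1\<close> for
  \<open>J0\<close>, and both \<open>0\<close> for \<open>K0\<close> or the level 0 part of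
  \<open>I1\<close>.\<close>

locale normalized_level_le_one = level_le_one I \<phi> \<sigma> b a c E
  for I :: "'i set" and \<phi> :: "'i \<Rightarrow> 'i multiset \<Rightarrow> 'k :: field_char_0" and \<sigma> b a c E +
  assumes norm: "j \<in> E \<Longrightarrow> a j j = 1 \<or> a j j = 0 \<and> (b j = 1 \<or> b j = 0)"
begin

text \<open>Both off-diagonal entries equal diagonal ones, and the diagonal entries of
  \<open>a\<close> vanish together. If they vanish, both entries of \<open>c\<close> are values of
  \<open>b\<close> and equal \<open>1\<close>; if not, both entries of \<open>a\<close> are
  \<open>1\<close> and \<open>col_a\<close> gives the equality.\<close>

lemma S_c_eq:
  assumes jk: "j \<in> S" "k \<in> S" "c j k \<noteq> 0"
  shows "c j k = c k j"
proof -
  have E: "j \<in> E" "k \<in> E" and I: "j \<in> I" "k \<in> I" using jk S_E E_I by auto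
  have kj: "c k j \<noteq> 0" using S_c_sym[OF jk] .
  have d: "c k j = c k k" "c j k = c j j"
    using S_c_diag[OF jk] S_c_diag[OF jk(2,1) kj] by auto
  hence "a k j = a j j" by (simp add: c_def)
  hence *: "c k j * a j j = c j k * a k k" using col_a[OF E(2) I] by simp
  show ?thesis
  proof (cases "a k k = 0")
    case True
    hence "a j j = 0" using * kj by simp
    moreover have "b k \<noteq> 0" using d(1) kj True by (simp add: c_def)
    moreover have "b j \<noteq> 0" using d(2) jk(3) \<open>a j j = 0\<close> by (simp add: c_def)
    ultimately show ?thesis using d norm[OF E(1)] norm[OF E(2)] True by (simp add: c_def)
  next
    case False
    hence "a k k = 1" using norm[OF E(2)] by blast
    hence "c k j * a j j = c j k" using * by simp
    hence "a j j \<noteq> 0" using jk(3) by auto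
    hence "a j j = 1" using norm[OF E(1)] by blast
    thus ?thesis using \<open>c k j * a j j = c j k\<close> by simp
  qed
qed

text \<open>The classes of \<open>rel\<close> become the parts of the dilatation, with \<open>r j\<close> the representative of \<open>j\<close>.\<close>

definition rel where "rel j k \<longleftrightarrow> j = k \<or> j \<in> S \<and> k \<in> S \<and> c j k \<noteq> 0"

lemma rel_cols:
  assumes "rel j k" "j \<in> I" "k \<in> I"
  shows "b j = b k" "i \<in> E \<Longrightarrow> a i j = a i k" "i \<in> E \<Longrightarrow> c j i = c k i" "i \<in> I \<Longrightarrow> \<sigma> i j = \<sigma> i k"
proof -
  have *: "j = k \<or> c k j = c j k \<and> c j k \<noteq> 0" using assms(1) S_c_eq[of j k] by (auto simp: rel_def)
  show "b j = b k" using * col_b[OF assms(2,3)] by auto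
  show "i \<in> E \<Longrightarrow> a i j = a i k" using * col_a[OF _ assms(2,3), of i] by auto
  thus "i \<in> E \<Longrightarrow> c j i = c k i" using \<open>b j = b k\<close> by (simp add: c_def)
  show "i \<in> I \<Longrightarrow> \<sigma> i j = \<sigma> i k" using * col_\<sigma>[OF _ assms(2,3), of i] by auto
qed

lemma rel_sym: "rel j k \<Longrightarrow> rel k j"
  using S_c_sym by (auto simp: rel_def)

lemma rel_trans:
  assumes "rel j k" "rel k l"
  shows "rel j l"
proof (cases "j = k \<or> k = l")
  case False
  hence S: "j \<in> S" "k \<in> S" "l \<in> S" "c k l \<noteq> 0" using assms by (auto simp: rel_def)
  have "c j l = c k l" using S S_E E_I by (intro rel_cols[OF assms(1)]) auto
  thus ?thesis using S by (simp add: rel_def)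
qed (use assms in auto)

definition r where "r j = (SOME k. rel j k)"

lemma rel_r: "rel j (r j)"
  unfolding r_def by (rule someI[of _ j]) (simp add: rel_def)

lemma r_eq_iff: "r j = r k \<longleftrightarrow> rel j k"
proof
  assume "r j = r k"
  thus "rel j k" using rel_r[of j] rel_r[of k] rel_sym rel_trans by metis
next
  assume "rel j k"
  hence "rel j = rel k" using rel_sym rel_trans by (intro ext) blast
  thus "r j = r k" by (simp add: r_def)
qed

lemma r_r [simp]: "r (r j) = r j"
  using rel_r rel_sym r_eq_iff by blast

lemma r_I: "j \<in> I \<Longrightarrow> r j \<in> I"
  using rel_r[of j] S_E E_I by (auto simp: rel_def)

lemma r_not_S: "j \<notin> S \<Longrightarrow> r j = j"
  using rel_r[of j] by (auto simp: rel_def)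

lemma r_S: "r j \<in> S \<longleftrightarrow> j \<in> S"
  using rel_r[of j] by (auto simp: rel_def)

lemma r_E: "r j \<in> E \<longleftrightarrow> j \<in> E"
  using rel_r[of j] S_E by (auto simp: rel_def)

lemma r_cols:
  assumes "j \<in> I"
  shows "b (r j) = b j" "i \<in> E \<Longrightarrow> a i (r j) = a i j" "i \<in> E \<Longrightarrow> c (r j) i = c j i" "i \<in> I \<Longrightarrow> \<sigma> i (r j) = \<sigma> i j"
  using rel_cols[OF rel_r assms r_I[OF assms]] by simp_all

text \<open>These become the parameters \<beta> of the fundamental system: arbitrary on
  \<open>I0\<close>, equal to \<open>1\<close> on \<open>J0\<close> and to \<open>0\<close> on
  \<open>K0\<close>.\<close>

abbreviation "\<gamma> j \<equiv> c j j"

lemma rel_diag: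
  assumes "rel j k" "j \<in> I" "k \<in> I"
  shows "\<gamma> j = \<gamma> k"
proof (cases "j = k")
  case False
  hence jk: "j \<in> S" "k \<in> S" "c j k \<noteq> 0" using assms by (auto simp: rel_def)
  have "c k j = \<gamma> k" "c j k = \<gamma> j"
    using S_c_diag[OF jk] S_c_diag[OF jk(2,1) S_c_sym[OF jk]] by auto
  thus ?thesis using S_c_eq[OF jk] by simp
qed simp

text \<open>\<open>T\<close> is the set of the vertices of level \<open>0\<close> which belong to \<open>I\<^sub>1\<close>.\<close>

definition T where "T = {l \<in> E. a l l = 0 \<and> b l = 0 \<and> (\<exists>k\<in>I. c k l \<noteq> 0)}"

lemma T_E: "T \<subseteq> E" by (auto simp: T_def)

lemma T_witness:
  assumes "l \<in> T"
  obtains k where "k \<in> S" "c k l \<noteq> 0"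
  using assms not_S_c by (auto simp: T_def)

text \<open>Inside \<open>S\<close> a nonzero \<open>c k l\<close> would have to agree with the
  diagonal entry at \<open>l\<close>, which is \<open>0\<close> for members of
  \<open>T\<close>.\<close>

lemma T_not_S:
  assumes "l \<in> T"
  shows "l \<notin> S"
proof
  assume l: "l \<in> S"
  obtain k where k: "k \<in> S" "c k l \<noteq> 0" using T_witness[OF assms] .
  have "\<gamma> l = 0" using assms by (simp add: T_def c_def)
  moreover have "c k l = \<gamma> l" using rel_cols(3)[of k l l] k l S_E E_I by (auto simp: rel_def)
  ultimately show False using k(2) by simp
qed

text \<open>The diagonal form of \<open>c\<close> on classes. Its only obstruction is a column
  \<open>l\<close> outside \<open>S\<close> with a nonzero entry; such an \<open>l\<close> has zero
  diagonal data and therefore belongs to \<open>T\<close>.\<close>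

lemma c_formula:
  assumes "j \<in> I" "l \<in> E - T"
  shows "c j l = (if r j = r l then \<gamma> (r j) else 0)"
proof -
  have l: "l \<in> I" using assms E_I by auto
  have g: "\<gamma> (r j) = \<gamma> j" using rel_diag[OF rel_r assms(1) r_I[OF assms(1)]] by simp
  show ?thesis
  proof (cases "rel j l")
    case True
    have "c j l = c l l" using rel_cols(3)[OF True assms(1) l, of l] assms(2) by simp
    thus ?thesis using True rel_diag[OF True assms(1) l] g by (simp add: r_eq_iff)
  next
    case False
    have "c j l = 0"
    proof (cases "j \<in> S \<and> l \<notin> S")
      case True
      have "a l l = 0" "b l = 0" using True assms not_S_a not_S_b l by auto
      thus ?thesis using assms by (auto simp: T_def)
    next
      case F2: False
      thus ?thesis using False assms not_S_c[of j l] by (auto simp: rel_def)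
    qed
    thus ?thesis using False by (simp add: r_eq_iff)
  qed
qed

lemma T_\<sigma>:
  assumes "l \<in> T" "i \<in> I"
  shows "\<sigma> i l = 0"
proof -
  obtain k where k: "k \<in> S" "c k l \<noteq> 0" using T_witness[OF assms(1)] .
  have "c l k = 0" using T_not_S[OF assms(1)] T_E assms(1) E_I S_E k(1) by (intro not_S_c) auto
  thus ?thesis using col_\<sigma>[OF assms(2), of l k] k T_E E_I S_E assms(1) by auto
qed

section \<open>Representatives and the level 0 parts of the basic system\<close>

definition R where "R = r ` I"
definition V where "V = R \<inter> E - T"
definition I0 where "I0 = {j \<in> V. a j j \<noteq> 0}"
definition J0 where "J0 = {j \<in> V. a j j = 0 \<and> b j \<noteq> 0}"
definition K0 where "K0 = {j \<in> V. a j j = 0 \<and> b j = 0}"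

lemma V_split: "V = I0 \<union> J0 \<union> K0" "I0 \<inter> J0 = {}" "(I0 \<union> J0) \<inter> K0 = {}"
  by (auto simp: I0_def J0_def K0_def)

lemma R_iff: "j \<in> R \<longleftrightarrow> j \<in> I \<and> r j = j"
  unfolding R_def using r_I by (metis imageE imageI r_r)

lemma V_I: "V \<subseteq> I" using E_I by (auto simp: V_def)

lemma V_r: "j \<in> V \<Longrightarrow> r j = j" by (simp add: V_def R_iff)

lemma finite_V: "finite V" using finite_I V_I finite_subset by blast

lemma V_data:
  "j \<in> I0 \<Longrightarrow> a j j = 1 \<and> b j = 1 + \<gamma> j"
  "j \<in> J0 \<Longrightarrow> a j j = 0 \<and> b j = 1 \<and> \<gamma> j = 1"
  "j \<in> K0 \<Longrightarrow> a j j = 0 \<and> b j = 0 \<and> \<gamma> j = 0"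
  using norm[of j] by (auto simp: I0_def J0_def K0_def V_def c_def)

lemma r_V: "j \<in> I \<Longrightarrow> r j \<in> V \<longleftrightarrow> j \<in> E - T"
  using r_I[of j] T_not_S r_E[of j] r_S[of j] r_not_S[of j] by (auto simp: V_def R_iff)

text \<open>Otherwise \<open>b\<close> vanishes throughout, and so do the entries of
  \<open>c\<close> in the columns over \<open>S\<close>. Then the rows of \<open>a\<close> over
  \<open>S\<close> are zero, although children of level 0 vertices lie in \<open>S\<close> and have
  children themselves.\<close>

lemma I0_J0_nonempty: "I0 \<union> J0 \<noteq> {}"
proof
  assume "I0 \<union> J0 = {}"
  hence V: "V = K0" using V_split by blast
  have b: "b j = 0" if "j \<in> I" for j
  proof (cases "j \<in> S")
    case True
    hence "r j \<in> V" using r_V[OF that] T_not_S S_E by blast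
    thus ?thesis using V V_data(3)[of "r j"] r_cols(1)[OF that] by simp
  qed (use that not_S_b in auto)
  have a0: "a i j = 0" if "i \<in> S" "j \<in> I" for i j
  proof (cases "j \<in> S")
    case True
    have rj: "r j \<in> V" using r_V[OF that(2)] T_not_S S_E True by blast
    have "i \<in> E - T" using that S_E T_not_S by blast
    hence "c j i = 0" using c_formula[OF that(2), of i] V V_data(3)[of "r j"] rj by auto
    thus ?thesis using b[OF that(2)] by (simp add: c_def)
  next
    case False
    thus ?thesis using not_S_a[OF that(2)] that S_E by blast
  qed
  obtain i where i: "i \<in> E" using E_nonempty by blast
  obtain k where k: "a i k \<noteq> 0" using has_child[of i] i E_I by blast
  have "k \<in> S" using k i child_E[of i k] E_I by (auto simp: S_def)
  moreover obtain j where "a k j \<noteq> 0" using has_child[of k] \<open>k \<in> S\<close> S_E E_I by blast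
  moreover have "j \<in> I" using calculation child_E[of k j] S_E E_I by blast
  ultimately show False using a0 by blast
qed

text \<open>A vertex of level one whose coefficients are not constant on a class would have a linear series.\<close>

lemma const_on_classes:
  assumes i: "i \<in> I" and jk: "rel j k" "j \<in> I" "k \<in> I"
  shows "a i j = a i k"
proof (rule ccontr)
  assume ne: "a i j \<noteq> a i k"
  have iE: "i \<notin> E" using ne rel_cols(2)[OF jk] by blast
  have "j \<noteq> k" using ne by auto
  hence S: "j \<in> S" "k \<in> S" "c j k \<noteq> 0" using jk(1) by (auto simp: rel_def)
  have jkE: "j \<in> E - T" "k \<in> E - T" using S S_E T_not_S by blast+
  have row: "c q j = c q k" if "q \<in> I" for q
    using c_formula[OF that jkE(1)] c_formula[OF that jkE(2)] jk(1) by (simp flip: r_eq_iff)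
  \<comment> \<open>For the related \<open>j\<close> and \<open>k\<close> the right sides of
    \<open>commute2\<close> agree, and so do the factors on the left; since \<open>a i j\<close> and
    \<open>a i k\<close> differ, that factor is zero.\<close>
  have q0: "\<sigma> i q + c q j = 0 \<and> (\<sigma> i j + c j q) * a i q = 0" if q: "q \<in> I" for q
  proof -
    have "c j q * a i q = c k q * a i q"
      using rel_cols(3)[OF jk, of q] not_E_a[OF i, of q] by (cases "q \<in> E") auto
    hence "(\<sigma> i j + c j q) * a i q = (\<sigma> i k + c k q) * a i q"
      using rel_cols(4)[OF jk i] by (simp add: distrib_right)
    moreover have "(\<sigma> i q + c q j) * a i j = (\<sigma> i j + c j q) * a i q"
      using commute2[OF i jk(2) q] .
    moreover have "(\<sigma> i q + c q j) * a i k = (\<sigma> i k + c k q) * a i q"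
      using commute2[OF i jk(3) q] row[OF q] by simp
    ultimately have "(\<sigma> i q + c q j) * (a i j - a i k) = 0" by (simp add: right_diff_distrib)
    hence "\<sigma> i q + c q j = 0" using ne by simp
    thus ?thesis using commute2[OF i jk(2) q] by simp
  qed
  have \<sigma>j: "\<sigma> i j = - c k j" using q0[OF jk(3)] rel_cols(4)[OF jk i] by (simp add: add_eq_0_iff)
  obtain q l where ql: "q \<in> I" "a i l \<noteq> 0" "\<sigma> i q + c q l \<noteq> 0"
    using not_E_nonlinear[OF i iE] by blast
  have lE: "l \<in> E" using child_E[OF i ql(2)] .
  hence lI: "l \<in> I" using E_I by blast
  have cjl: "c j l \<noteq> 0" using q0[OF lI] ql(2) \<sigma>j S_c_sym[OF S] by auto
  have \<sigma>q: "\<sigma> i q = - c q j" using q0[OF ql(1)] by (simp add: add_eq_0_iff)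
  \<comment> \<open>This contradicts the quadratic witness. If \<open>l\<close> is in
    \<open>S\<close> it is related to \<open>j\<close>, so the factor is the one that vanishes by
    \<open>q0\<close>; otherwise the other side of \<open>commute2\<close> vanishes.\<close>
  have "(\<sigma> i q + c q l) * a i l = 0"
  proof (cases "l \<in> S")
    case True
    hence rjl: "rel j l" using S(1) cjl by (simp add: rel_def)
    have "l \<in> E - T" using True lE T_not_S by blast
    hence "c q l = c q j"
      using c_formula[OF ql(1) jkE(1)] c_formula[OF ql(1), of l] rjl by (simp flip: r_eq_iff)
    thus ?thesis using \<sigma>q by simp
  next
    case False
    have "\<sigma> i l = 0"
      using q0[OF lI] not_S_c[OF lI False, of j] jkE by simp
    moreover have "c l q * a i q = 0"
      using not_S_c[OF lI False, of q] not_E_a[OF i, of q] by (cases "q \<in> E") auto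
    ultimately show ?thesis using commute2[OF i lI ql(1)] by (simp add: distrib_right)
  qed
  thus False using ql by simp
qed

lemma a_r: "i \<in> I \<Longrightarrow> j \<in> I \<Longrightarrow> a i (r j) = a i j"
  using const_on_classes[OF _ rel_r _ r_I] by metis

text \<open>Reduces the computation of a series to exhibiting a function \<open>Q\<close> on class
  multisets with the same recursion. Degree one is prescribed separately because the first variable
  enters through \<open>a\<close>, all later ones through \<open>\<sigma>\<close>.\<close>

lemma phi_recursion:
  assumes i: "i \<in> I"
    and Q: "\<And>j n. n \<noteq> {#} \<Longrightarrow>
        Q (add_mset j n) = (if j \<in> V then (\<sigma> i j + of_nat (count n j) * \<gamma> j) * Q n else 0)"
    and Q1: "\<And>j. Q {#j#} = (if j \<in> V then a i j else 0)"
    and "m \<noteq> {#}" "set_mset m \<subseteq> I - T"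
  shows "\<phi> i m = Q (image_mset r m)"
  using assms(4,5)
proof (induction m)
  case (add j p)
  have j: "j \<in> I - T" and p: "set_mset p \<subseteq> I - T" using add.prems by auto
  show ?case
  proof (cases "p = {#}")
    case True
    have "a i j = Q {#r j#}"
      unfolding Q1 using j r_V[of j] a_r[OF i, of j] not_E_a[OF i, of j] by auto
    thus ?thesis using True by (simp add: a_def)
  next
    case False
    have IH: "\<phi> i p = Q (image_mset r p)" by (rule add.IH[OF False p])
    have st: "\<phi> i (add_mset j p) = (\<sigma> i j + (\<Sum>l\<in>#p. c j l)) * \<phi> i p"
      using j False i by (intro step) auto
    have Qs: "Q (image_mset r (add_mset j p)) =
        (if r j \<in> V then (\<sigma> i (r j) + of_nat (count (image_mset r p) (r j)) * \<gamma> (r j)) * Q (image_mset r p) else 0)"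
      using Q[of "image_mset r p" "r j"] False by simp
    show ?thesis
    proof (cases "\<phi> i p = 0")
      case True
      thus ?thesis using st Qs IH by simp
    next
      case nz: False
      \<comment> \<open>Nonvanishing of the coefficient puts all its variables into
        \<open>E\<close>, where \<open>c_formula\<close> turns the sum of entries of
        \<open>c\<close> into a count of the class of \<open>j\<close>.\<close>
      have pE: "l \<in> E - T" if "l \<in># p" for l using support_E[OF i nz that] that p by blast
      have sum: "(\<Sum>l\<in>#p. c j l) = of_nat (count (image_mset r p) (r j)) * \<gamma> (r j)"
        using pE
      proof (induction p)
        case (add l p)
        have "c j l = (if r j = r l then \<gamma> (r j) else 0)"
          using add.prems j by (intro c_formula) auto
        thus ?case using add by (simp add: algebra_simps)
      qed simp
      show ?thesis
      proof (cases "r j \<in> V")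
        case True
        thus ?thesis using st Qs IH sum r_cols(4)[of j i] j i by simp
      next
        case False
        hence "j \<notin> E" using r_V[of j] j by blast
        hence "\<sigma> i j = 0" using not_E_\<sigma>[OF i, of j] j by blast
        moreover have "(\<Sum>l\<in>#p. c j l) = 0"
        proof (rule sum_mset.neutral)
          show "\<forall>x\<in>#image_mset (c j) p. x = 0"
            using pE j \<open>j \<notin> E\<close> S_E not_S_c[of j] by auto
        qed
        ultimately show ?thesis using st Qs False by simp
      qed
    qed
  qed
qed simp

end

lemma dpc_simps [simp]:
  "dpc (F + G) m = dpc F m + dpc G m"
  "dpc (F - G) m = dpc F m - dpc G m"
  "dpc (mps_const x * F) m = x * dpc F m"
  "dpc 1 m = (if m = {#} then 1 else 0)"
  "dpc (mps_const x) m = (if m = {#} then x else 0)"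
  "dpc (mps_var v) m = (if m = {#v#} then 1 else 0)"
  "dpc (\<Sum>x\<in>A. f x) m = (\<Sum>x\<in>A. dpc (f x) m)"
  by (auto simp: dpc_def plus_mps.rep_eq minus_mps.rep_eq one_mps.rep_eq mps_const.rep_eq mps_var.rep_eq
      distrib_right left_diff_distrib mult.assoc sum_distrib_right)

lemma dpc_mps_in: "dpc (mps_in g j) n = (if set_mset n \<subseteq> {j} then fps_nth g (size n) * fact (size n) else 0)"
proof (cases "set_mset n \<subseteq> {j}")
  case True
  then obtain k where "n = replicate_mset k j" by (metis set_mset_subset_singletonD)
  moreover have "mfact (replicate_mset k j) = fact k" by (induction k) auto
  ultimately show ?thesis by (simp add: dpc_def mps_in.rep_eq)
qed (simp add: dpc_def mps_in.rep_eq)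

lemma mps_in_fser_0 [simp]: "mps_in (fser \<beta> 0) j = 1"
proof -
  have "fps_nth (fser \<beta> 0) k = (if k = 0 then 1 else 0)" for k
    by (cases k) (auto simp: fser_def intro: prod_zero bexI[of _ 0])
  thus ?thesis by (intro mps_eqI) (auto simp: mps_in.rep_eq one_mps.rep_eq)
qed

lemma mps_in_lser_0:
  fixes x :: "'k :: field_char_0" and j :: 'v
  shows "mps_in (lser x 0) j = mps_const x * mps_var j"
proof (rule mps_eqI)
  fix m :: "'v multiset"
  have *: "fps_nth (lser x 0) n = (if n = 1 then x else 0)" for n
    by (cases n) (auto simp: lser_def)
  show "mcoeff (mps_in (lser x 0) j) m = mcoeff (mps_const x * mps_var j) m"
  proof (cases "size m = 1")
    case True
    then obtain k where "m = {#k#}" using size_1_singleton_mset by blast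
    thus ?thesis by (simp add: mps_in.rep_eq mps_var.rep_eq *)
  next
    case False
    hence "m \<noteq> {#j#}" by auto
    thus ?thesis using False by (simp add: mps_in.rep_eq mps_var.rep_eq *)
  qed
qed

context normalized_level_le_one
begin

section \<open>Products and logarithms as solutions of the recursion\<close>

definition prod_coeff :: "('i \<Rightarrow> 'k) \<Rightarrow> 'i multiset \<Rightarrow> 'k" where
  "prod_coeff y n = (if set_mset n \<subseteq> V then \<Prod>j\<in>V. \<Prod>s<count n j. y j + of_nat s * \<gamma> j else 0)"

lemma prod_coeff_empty [simp]: "prod_coeff y {#} = 1"
  by (simp add: prod_coeff_def)

lemma prod_coeff_add: "prod_coeff y (add_mset j n) = (if j \<in> V then (y j + of_nat (count n j) * \<gamma> j) * prod_coeff y n else 0)"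
proof (cases "j \<in> V")
  case True
  let ?f = "\<lambda>n k. \<Prod>s<count n k. y k + of_nat s * \<gamma> k"
  have "prod (?f (add_mset j n)) V = ?f (add_mset j n) j * prod (?f (add_mset j n)) (V - {j})"
    using True finite_V by (rule prod.remove[rotated])
  also have "prod (?f (add_mset j n)) (V - {j}) = prod (?f n) (V - {j})"
    by (intro prod.cong) auto
  also have "?f (add_mset j n) j = (y j + of_nat (count n j) * \<gamma> j) * ?f n j"
    by (simp add: mult.commute)
  finally have "prod (?f (add_mset j n)) V = (y j + of_nat (count n j) * \<gamma> j) * (?f n j * prod (?f n) (V - {j}))"
    by (simp add: mult.assoc)
  also have "?f n j * prod (?f n) (V - {j}) = prod (?f n) V"
    using True finite_V by (rule prod.remove[rotated, symmetric])
  finally show ?thesis using True by (simp add: prod_coeff_def)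
qed (simp add: prod_coeff_def)

lemma prod_coeff_single: "prod_coeff y {#j#} = (if j \<in> V then y j else 0)"
  using prod_coeff_add[of y j "{#}"] by simp

lemma prod_coeff_outside: "\<not> set_mset n \<subseteq> V \<Longrightarrow> prod_coeff y n = 0"
  by (simp add: prod_coeff_def)

lemma prod_coeff_cong: "(\<And>j. j \<in> V \<Longrightarrow> y j = z j) \<Longrightarrow> prod_coeff y n = prod_coeff z n"
  by (auto simp: prod_coeff_def intro!: prod.cong)

text \<open>Written with \<open>1\<close> and \<open>0\<close> on \<open>J0\<close> and
  \<open>K0\<close>, where these are the values of \<open>\<gamma>\<close>, so as to match the
  clauses of \<open>basic_system\<close> literally.\<close>

definition prod_series :: "('i \<Rightarrow> 'k) \<Rightarrow> ('i, 'k) mps" where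
  "prod_series y = (\<Prod>j\<in>I0. mps_in (fser (\<gamma> j) (y j)) j) * (\<Prod>j\<in>J0. mps_in (fser 1 (y j)) j) *
     (\<Prod>j\<in>K0. mps_in (fser 0 (y j)) j)"

lemma finite_parts: "finite I0" "finite J0" "finite K0"
  using finite_V V_split(1) by auto

lemma dpc_prod_series: "dpc (prod_series y) n = prod_coeff y n"
proof -
  have "(\<Prod>j\<in>V. mps_in (fser (\<gamma> j) (y j)) j) = (\<Prod>j\<in>I0. mps_in (fser (\<gamma> j) (y j)) j) *
      (\<Prod>j\<in>J0. mps_in (fser (\<gamma> j) (y j)) j) * (\<Prod>j\<in>K0. mps_in (fser (\<gamma> j) (y j)) j)"
    unfolding V_split(1) using V_split(2,3) finite_parts
    by (subst prod.union_disjoint; simp?)+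
  also have "\<dots> = prod_series y"
    unfolding prod_series_def using V_data by (intro arg_cong2[of _ _ _ _ "(*)"] prod.cong) auto
  finally show ?thesis
    using dpc_prod_mps_in[OF finite_V, of "\<lambda>j. fser (\<gamma> j) (y j)" n] by (simp add: prod_coeff_def fser_nth_fact)
qed

definition log_series :: "('i \<Rightarrow> 'k) \<Rightarrow> ('i, 'k) mps" where
  "log_series y = 1 + (\<Sum>j\<in>I0. mps_in (lser (y j) (\<gamma> j)) j) + (\<Sum>j\<in>J0. mps_in (lser (y j) 1) j) +
     (\<Sum>j\<in>K0. mps_const (y j) * mps_var j)"

definition log_coeff :: "('i \<Rightarrow> 'k) \<Rightarrow> 'i multiset \<Rightarrow> 'k" where
  "log_coeff y n = (\<Sum>j\<in>V. if set_mset n \<subseteq> {j} then fps_nth (lser (y j) (\<gamma> j)) (size n) * fact (size n) else 0)"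

lemma dpc_log_series: "dpc (log_series y) n = (if n = {#} then 1 else log_coeff y n)"
proof -
  have "(\<Sum>j\<in>V. mps_in (lser (y j) (\<gamma> j)) j) = (\<Sum>j\<in>I0. mps_in (lser (y j) (\<gamma> j)) j) +
      (\<Sum>j\<in>J0. mps_in (lser (y j) (\<gamma> j)) j) + (\<Sum>j\<in>K0. mps_in (lser (y j) (\<gamma> j)) j)"
    unfolding V_split(1) using V_split(2,3) finite_parts
    by (subst sum.union_disjoint; simp?)+
  also have "\<dots> = (\<Sum>j\<in>I0. mps_in (lser (y j) (\<gamma> j)) j) + (\<Sum>j\<in>J0. mps_in (lser (y j) 1) j) +
     (\<Sum>j\<in>K0. mps_const (y j) * mps_var j)"
    using V_data by (intro arg_cong2[of _ _ _ _ "(+)"] sum.cong) (auto simp: mps_in_lser_0)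
  finally have "log_series y = 1 + (\<Sum>j\<in>V. mps_in (lser (y j) (\<gamma> j)) j)"
    by (simp add: log_series_def add.assoc)
  thus ?thesis by (auto simp: log_coeff_def dpc_mps_in)
qed

lemma log_coeff_single: "log_coeff y {#k#} = (if k \<in> V then y k else 0)"
proof -
  have "fps_nth (lser x \<beta>) (Suc 0) = x" for x \<beta> :: 'k using lser_nth_fact[of x \<beta> 0] by simp
  thus ?thesis using finite_V by (simp add: log_coeff_def eq_commute[of k])
qed

text \<open>This is the recursion with all \<open>\<sigma> i k\<close> equal to \<open>0\<close>,
  that is, the case \<open>\<nu> i = 0\<close>. Mixed monomials vanish because the logarithms are
  added rather than multiplied.\<close>

lemma log_coeff_add:
  assumes "n \<noteq> {#}"
  shows "log_coeff y (add_mset k n) = (if k \<in> V then (of_nat (count n k) * \<gamma> k) * log_coeff y n else 0)"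
proof (cases "k \<in> V")
  case True
  define g where "g j m = fps_nth (lser (y j) (\<gamma> j)) m * fact m" for j m
  have L: "log_coeff y (add_mset k n) = (if set_mset n \<subseteq> {k} then g k (Suc (size n)) else 0)"
  proof -
    have "log_coeff y (add_mset k n) = (\<Sum>j\<in>V. if j = k then if set_mset n \<subseteq> {k} then g k (Suc (size n)) else 0 else 0)"
      unfolding log_coeff_def g_def by (intro sum.cong) auto
    thus ?thesis using True finite_V by simp
  qed
  show ?thesis
  proof (cases "set_mset n \<subseteq> {k}")
    case sub: True
    obtain m where m: "n = replicate_mset (Suc m) k"
      using sub assms by (metis set_mset_subset_singletonD replicate_mset_0 not0_implies_Suc)
    have "log_coeff y n = (\<Sum>j\<in>V. if j = k then g k (Suc m) else 0)"
      unfolding log_coeff_def g_def by (intro sum.cong) (auto simp: m)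
    hence "log_coeff y n = g k (Suc m)" using True finite_V by simp
    moreover have "g k (Suc m) = y k * \<gamma> k ^ m * fact m" "g k (Suc (Suc m)) = y k * \<gamma> k ^ Suc m * fact (Suc m)"
      unfolding g_def by (rule lser_nth_fact)+
    ultimately show ?thesis using True L sub by (simp add: m)
  next
    case nsub: False
    have "log_coeff y n = 0" if "k \<in># n"
    proof -
      have "\<not> set_mset n \<subseteq> {j}" for j using nsub that by auto
      thus ?thesis by (simp add: log_coeff_def)
    qed
    hence "of_nat (count n k) * \<gamma> k * log_coeff y n = 0" by (cases "k \<in># n") (auto simp: not_in_iff)
    thus ?thesis using L nsub True by simp
  qed
next
  case False
  thus ?thesis unfolding log_coeff_def by (auto intro!: sum.neutral)
qed

lemma log_coeff_outside: "n \<noteq> {#} \<Longrightarrow> \<not> set_mset n \<subseteq> V \<Longrightarrow> log_coeff y n = 0"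
  unfolding log_coeff_def by (rule sum.neutral) auto

text \<open>Members of \<open>T\<close> have level 0, yet their series are of the type required in
  \<open>I1\<close>, with \<nu> equal to \<open>1\<close>; they are the admissible linear children
  of \<open>J1\<close>.\<close>

definition I1 where "I1 = T \<union> {i \<in> I - E. \<forall>l\<in>T. a i l = 0}"
definition J1 where "J1 = {i \<in> I - E. \<exists>l\<in>T. a i l \<noteq> 0}"

text \<open>The ratio of the rows \<open>\<sigma> i\<close> and \<open>a i\<close> on
  \<open>V\<close>. On \<open>T\<close> it is fixed as \<open>1\<close>, since the two rows coincide
  at level 0.\<close>

definition \<nu> where "\<nu> i = (if i \<in> T then 1 else SOME v. \<forall>j\<in>V. \<sigma> i j = v * a i j)"

text \<open>Distinct representatives in \<open>V\<close> are unrelated, so the terms with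
  \<open>c\<close> in \<open>commute2\<close> disappear and the 2 by 2 minors of the two rows are
  zero.\<close>

lemma wedge:
  assumes "i \<in> I" "j \<in> V" "k \<in> V"
  shows "\<sigma> i k * a i j = \<sigma> i j * a i k"
proof (cases "j = k")
  case False
  have "c k j = 0" "c j k = 0"
    using c_formula[of k j] c_formula[of j k] assms V_r False V_I by (auto simp: V_def)
  thus ?thesis using commute2[OF assms(1), of j k] assms V_I by auto
qed simp

lemma \<nu>_ex:
  assumes "i \<in> I" "k \<in> V" "a i k \<noteq> 0" "i \<notin> T"
  shows "\<forall>j\<in>V. \<sigma> i j = \<nu> i * a i j"
proof -
  have "\<forall>j\<in>V. \<sigma> i j = \<sigma> i k / a i k * a i j"
    using wedge[OF assms(1) _ assms(2)] assms(3) by (simp add: field_simps)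
  define P where "P v \<longleftrightarrow> (\<forall>j\<in>V. \<sigma> i j = v * a i j)" for v
  have "P (\<sigma> i k / a i k)" unfolding P_def by fact
  hence "P (SOME v. P v)" by (rule someI)
  moreover have "\<nu> i = (SOME v. P v)"
    unfolding \<nu>_def P_def using assms(4) by (rule if_not_P)
  ultimately show ?thesis by (simp only: P_def)
qed

lemma not_E_not_T: "i \<in> I - E \<Longrightarrow> i \<notin> T"
  using T_E by blast

lemma r_T: "l \<in> T \<Longrightarrow> r l = l"
  using T_not_S r_not_S by blast

lemma r_eq_T: "j \<in> I \<Longrightarrow> r j \<in> T \<Longrightarrow> r j = j"
  using T_not_S r_S r_not_S by blast

lemma \<nu>_I1:
  assumes "i \<in> I - E" "\<forall>l\<in>T. a i l = 0"
  shows "\<forall>j\<in>V. \<sigma> i j = \<nu> i * a i j"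
proof -
  obtain k where k: "a i k \<noteq> 0" "k \<in> E" using has_child[of i] child_E[of i] assms(1) by blast
  have kI: "k \<in> I" using k E_I by blast
  have "k \<in> E - T" using k assms(2) by auto
  hence "r k \<in> V" using r_V[OF kI] by blast
  moreover have "a i (r k) \<noteq> 0" using a_r[of i k] kI k assms(1) by simp
  ultimately show ?thesis using \<nu>_ex[of i "r k"] assms(1) not_E_not_T by blast
qed

text \<open>For a child \<open>l\<close> in \<open>T\<close> both \<open>\<sigma> i l\<close> and
  the relevant entries of \<open>c l\<close> vanish, so one side of \<open>commute2\<close> is zero.
  The conclusion says that no variable can be added to \<open>l\<close>.\<close>

lemma \<sigma>_T_child:
  assumes "i \<in> I" "l \<in> T" "a i l \<noteq> 0" "j \<in> I"
  shows "\<sigma> i j = - c j l"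
proof -
  have lI: "l \<in> I" using assms T_E E_I by blast
  have "(\<sigma> i l + c l j) * a i j = 0"
    using T_\<sigma>[OF assms(2,1)] not_S_c[OF lI T_not_S[OF assms(2)], of j] not_E_a[OF assms(1), of j]
    by (cases "j \<in> E") auto
  hence "(\<sigma> i j + c j l) * a i l = 0" using commute2[OF assms(1) lI assms(4)] by simp
  thus ?thesis using assms(3) by (simp add: eq_neg_iff_add_eq_0)
qed

lemma \<nu>_J1:
  assumes i: "i \<in> J1"
  shows "\<forall>j\<in>V. \<sigma> i j = \<nu> i * a i j" "\<nu> i \<noteq> 0"
proof -
  have iI: "i \<in> I" "i \<notin> E" using i by (auto simp: J1_def)
  obtain l where l: "l \<in> T" "a i l \<noteq> 0" using i by (auto simp: J1_def)
  obtain k0 where k0: "k0 \<in> S" "c k0 l \<noteq> 0" using T_witness[OF l(1)] .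
  have k0I: "k0 \<in> I" using k0 S_E E_I by blast
  have rk0: "r k0 \<in> V" using r_V[OF k0I] k0 S_E T_not_S by blast
  have nz: "\<sigma> i (r k0) \<noteq> 0"
    using \<sigma>_T_child[OF iI(1) l k0I] k0(2) r_cols(4)[OF k0I iI(1)] by simp
  \<comment> \<open>If all children were in \<open>T\<close>, every quadratic factor would vanish by
    \<open>\<sigma>_T_child\<close>, against nonlinearity.\<close>
  have "\<exists>k\<in>V. a i k \<noteq> 0"
  proof (rule ccontr)
    assume no: "\<not> ?thesis"
    obtain q l' where ql: "q \<in> I" "a i l' \<noteq> 0" "\<sigma> i q + c q l' \<noteq> 0"
      using not_E_nonlinear[OF iI] by blast
    have l'E: "l' \<in> E" using child_E[OF iI(1) ql(2)] .
    hence l'I: "l' \<in> I" using E_I by blast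
    have "l' \<in> T"
      using no r_V[OF l'I] a_r[OF iI(1) l'I] ql(2) l'E by auto
    thus False using \<sigma>_T_child[OF iI(1) _ ql(2,1)] ql(3) by simp
  qed
  then obtain k where k: "k \<in> V" "a i k \<noteq> 0" by blast
  show *: "\<forall>j\<in>V. \<sigma> i j = \<nu> i * a i j" using \<nu>_ex[OF iI(1) k] iI not_E_not_T by blast
  thus "\<nu> i \<noteq> 0" using nz rk0 by auto
qed

text \<open>For \<open>J1\<close> the product is taken with \<open>\<sigma> i\<close>, which agrees
  with \<open>\<nu> i * a i\<close> on \<open>V\<close>: the exponents in a fundamental system are
  the common row of the children in \<open>T\<close> minus \<open>b\<close>, and this difference is
  \<open>\<sigma> i\<close>.\<close>

definition G :: "'i \<Rightarrow> ('i, 'k) mps" where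
  "G i = (if i \<in> V then prod_series (a i)
     else if i \<in> I1 then
       if \<nu> i \<noteq> 0 then mps_const (1 / \<nu> i) * prod_series (\<lambda>j. \<nu> i * a i j) + 1 - mps_const (1 / \<nu> i) else log_series (a i)
     else mps_const (1 / \<nu> i) * prod_series (\<sigma> i) + (\<Sum>j\<in>{j \<in> T. a i j \<noteq> 0}. mps_const (a i j) * mps_var j) +
       1 - mps_const (1 / \<nu> i))"

lemma phi_T:
  assumes i: "i \<in> I" and l: "l \<in> T" and q: "p \<noteq> {#}"
  shows "\<phi> i (add_mset l p) = 0"
proof (rule ccontr)
  assume nz: "\<phi> i (add_mset l p) \<noteq> 0"
  have al: "a i l \<noteq> 0" using support_children[OF i nz] by simp
  have "p \<noteq> {#} \<Longrightarrow> \<phi> i (add_mset l p) \<noteq> 0 \<Longrightarrow> False"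
  proof (induction p)
    case (add q p)
    have q: "q \<in> I" using over[OF i add.prems(2)] by auto
    have st: "\<phi> i (add_mset q (add_mset l p)) = (\<sigma> i q + (\<Sum>l\<in>#add_mset l p. c q l)) * \<phi> i (add_mset l p)"
      using i q by (intro step) auto
    hence "\<phi> i (add_mset l p) \<noteq> 0" using add.prems by (auto simp: add_mset_commute)
    hence "p = {#}" using add.IH by blast
    thus False using st add.prems \<sigma>_T_child[OF i l al q] by (auto simp: add_mset_commute)
  qed simp
  thus False using q nz by blast
qed

lemma E_row:
  assumes "x \<in> E - T" "j \<in> V"
  shows "a x j = b j - (if j = r x then \<gamma> j else 0)"
proof -
  have "c j x = (if j = r x then \<gamma> j else 0)"
    using c_formula[of j x] assms V_I V_r by auto
  thus ?thesis by (simp add: c_eq algebra_simps)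
qed

lemma Pr_T: "l \<in> T \<Longrightarrow> l \<in># m \<Longrightarrow> prod_coeff y (image_mset r m) = 0"
  by (rule prod_coeff_outside) (use r_T in \<open>force simp: V_def\<close>)

text \<open>At level 0 the first variable enters with the same factor as the later ones, so the
  product formula needs no constant correction.\<close>

lemma phi_E:
  assumes x: "x \<in> E" and m: "set_mset m \<subseteq> I"
  shows "\<phi> x m = prod_coeff (a x) (image_mset r m)"
proof (cases "m = {#}")
  case True
  thus ?thesis using one x E_I by auto
next
  case ne: False
  have xI: "x \<in> I" using x E_I by blast
  show ?thesis
  proof (cases "set_mset m \<inter> T = {}")
    case True
    show ?thesis
      by (rule phi_recursion[OF xI _ _ ne]) (use m True V_I \<sigma>_E[OF x] in \<open>auto simp: prod_coeff_add prod_coeff_single\<close>)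
  next
    case False
    then obtain l where l: "l \<in># m" "l \<in> T" by blast
    have "a x l = 0" using not_S_a[of l x] l T_not_S x T_E E_I by blast
    hence "\<phi> x m = 0" using support_children[OF xI _ l(1)] by blast
    thus ?thesis using Pr_T[OF l(2,1)] by simp
  qed
qed

text \<open>The coefficients depend only on the classes of \<open>i\<close> and of the variables;
  this is what makes the normalised system a dilatation of \<open>G\<close> on the
  representatives.\<close>

lemma phi_G:
  assumes i: "i \<in> I" and m: "set_mset m \<subseteq> I"
  shows "\<phi> i m = dpc (G (r i)) (image_mset r m)"
proof -
  consider "i \<in> E - T" | "i \<in> T" | "i \<in> I - E" "\<forall>l\<in>T. a i l = 0" | "i \<in> I - E" "i \<in> J1"
    using i by (auto simp: J1_def)
  thus ?thesis
  proof cases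
    case 1
    have ri: "r i \<in> V" using r_V[OF i] 1 by blast
    \<comment> \<open>By \<open>E_row\<close> a row on \<open>V\<close> depends on its vertex only
      through the representative.\<close>
    have "a (r i) j = a i j" if "j \<in> V" for j
      using E_row[of "r i" j] E_row[of i j] 1 ri that by (auto simp: V_def)
    hence "prod_coeff (a (r i)) n = prod_coeff (a i) n" for n by (rule prod_coeff_cong)
    thus ?thesis using phi_E[of i m] 1 m ri by (simp add: G_def dpc_prod_series)
  next
    case 2
    hence "r i = i" "i \<in> I1" "i \<notin> V" "\<nu> i = 1" using r_T by (auto simp: I1_def V_def \<nu>_def)
    thus ?thesis using phi_E[of i m] 2 T_E m by (auto simp: G_def dpc_prod_series)
  next
    case 3
    have "i \<notin> S" using 3 S_E by blast
    hence ri: "r i = i" by (rule r_not_S)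
    have iV: "i \<notin> V" "i \<in> I1" using 3 by (auto simp: V_def I1_def)
    note \<nu> = \<nu>_I1[OF 3]
    show ?thesis
    proof (cases "m = {#}")
      case True
      thus ?thesis using one[OF i] by (simp add: ri G_def iV dpc_prod_series dpc_log_series)
    next
      case ne: False
      show ?thesis
      proof (cases "set_mset m \<inter> T = {}")
        case True
        hence mT: "set_mset m \<subseteq> I - T" using m by blast
        show ?thesis
        proof (cases "\<nu> i = 0")
          case z: True
          have "\<phi> i m = log_coeff (a i) (image_mset r m)"
            by (rule phi_recursion[OF i _ _ ne mT]) (use \<nu> z in \<open>auto simp: log_coeff_add log_coeff_single\<close>)
          thus ?thesis using z ne by (simp add: ri G_def iV dpc_log_series)
        next
          case nz: False
          have "\<phi> i m = 1 / \<nu> i * prod_coeff (\<lambda>j. \<nu> i * a i j) (image_mset r m)"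
            by (rule phi_recursion[OF i _ _ ne mT]) (use \<nu> nz in \<open>auto simp: prod_coeff_add prod_coeff_single\<close>)
          thus ?thesis using nz ne by (simp add: ri G_def iV dpc_prod_series)
        qed
      next
        case False
        then obtain l where l: "l \<in># m" "l \<in> T" by blast
        hence "\<phi> i m = 0" using support_children[OF i _ l(1)] 3 by blast
        moreover have "log_coeff (a i) (image_mset r m) = 0"
          by (rule log_coeff_outside) (use ne l r_T in \<open>force simp: V_def\<close>)+
        ultimately show ?thesis using Pr_T[OF l(2,1)] ne by (simp add: ri G_def iV dpc_prod_series dpc_log_series)
      qed
    qed
  next
    case 4
    have "i \<notin> S" using 4 S_E by blast
    hence ri: "r i = i" by (rule r_not_S)
    have iV: "i \<notin> V" "i \<notin> I1" using 4 T_E by (auto simp: V_def I1_def J1_def)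
    let ?D = "{j \<in> T. a i j \<noteq> 0}"
    have finD: "finite ?D" using finite_subset[of ?D I] finite_I T_E E_I by blast
    note \<nu> = \<nu>_J1[OF 4(2)]
    have dG: "dpc (G (r i)) n = 1 / \<nu> i * prod_coeff (\<sigma> i) n + (\<Sum>j\<in>?D. if n = {#j#} then a i j else 0)" if "n \<noteq> {#}" for n
      using that by (simp add: ri G_def iV dpc_prod_series if_distrib[of "\<lambda>x. _ * x"] cong: if_cong)
    show ?thesis
    proof (cases "m = {#}")
      case True
      thus ?thesis using one[OF i] by (simp add: ri G_def iV dpc_prod_series)
    next
      case ne: False
      show ?thesis
      proof (cases "set_mset m \<inter> T = {}")
        case True
        hence mT: "set_mset m \<subseteq> I - T" using m by blast
        have "\<phi> i m = 1 / \<nu> i * prod_coeff (\<sigma> i) (image_mset r m)"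
        proof (rule phi_recursion[OF i _ _ ne mT])
          fix j
          show "1 / \<nu> i * prod_coeff (\<sigma> i) {#j#} = (if j \<in> V then a i j else 0)"
            using \<nu>(1)[rule_format, of j] \<nu>(2) by (simp add: prod_coeff_single)
        qed (simp add: prod_coeff_add)
        moreover have "(\<Sum>j\<in>?D. if image_mset r m = {#j#} then a i j else 0) = 0"
        proof (rule sum.neutral, intro ballI)
          fix j assume j: "j \<in> ?D"
          have "image_mset r m \<noteq> {#j#}"
          proof
            assume "image_mset r m = {#j#}"
            hence "size m = 1" by (metis size_image_mset size_single)
            then obtain j' where "m = {#j'#}" using size_1_singleton_mset by blast
            hence j': "m = {#j'#}" "r j' = j" using \<open>image_mset r m = {#j#}\<close> by auto
            thus False using j mT m r_eq_T[of j'] by auto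
          qed
          thus "(if image_mset r m = {#j#} then a i j else 0) = 0" by simp
        qed
        ultimately show ?thesis using dG[of "image_mset r m"] ne by simp
      next
        case False
        then obtain l p where l: "l \<in> T" "m = add_mset l p" by (metis disjoint_iff multi_member_split)
        have P0: "prod_coeff (\<sigma> i) (image_mset r m) = 0" using Pr_T[OF l(1), of m] l(2) by auto
        show ?thesis
        proof (cases "p = {#}")
          case True
          have "(\<Sum>j\<in>?D. if {#l#} = {#j#} then a i j else 0) = (\<Sum>j\<in>?D. if j = l then a i l else 0)"
            by (intro sum.cong) auto
          also have "\<dots> = a i l" using finD l(1) by (simp add: sum.delta)
          finally show ?thesis using dG[of "image_mset r m"] P0 True l by (simp add: r_T a_def)
        next
          case False
          have "image_mset r m \<noteq> {#j#}" for j using l False by simp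
          hence "dpc (G (r i)) (image_mset r m) = 0" using dG[of "image_mset r m"] P0 ne by simp
          thus ?thesis using phi_T[OF i l(1) False] l(2) by simp
        qed
      qed
    qed
  qed
qed

lemma R_split: "R = I0 \<union> J0 \<union> K0 \<union> I1 \<union> J1"
proof -
  have "R = V \<union> (R \<inter> T) \<union> (R - E)" using T_E by (auto simp: V_def)
  moreover have "R \<inter> T = T" using T_E E_I r_T by (auto simp: R_iff)
  moreover have "r x = x" if "x \<notin> E" for x using that S_E r_not_S by blast
  hence "R - E = I - E" by (auto simp: R_iff)
  ultimately have "R = V \<union> T \<union> (I - E)" by simp
  also have "\<dots> = V \<union> I1 \<union> J1" by (auto simp: I1_def J1_def)
  finally show ?thesis by (simp add: V_split(1))
qed

lemma G_over: "mps_over R (G i)"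
proof -
  have VR: "V \<subseteq> R" "T \<subseteq> R" using R_split V_split(1) by (auto simp: I1_def)
  have "set_mset n \<subseteq> R" if nz: "dpc (G i) n \<noteq> 0" for n
  proof (rule ccontr)
    assume no: "\<not> set_mset n \<subseteq> R"
    hence n: "n \<noteq> {#}" "\<not> set_mset n \<subseteq> V" using VR by auto
    have "n \<noteq> {#j#}" if "j \<in> T" for j using no that VR by auto
    thus False using nz n by (auto simp: G_def dpc_prod_series dpc_log_series prod_coeff_outside log_coeff_outside split: if_splits)
  qed
  thus ?thesis by (auto simp: mps_over_def simp flip: dpc_eq_0_iff)
qed

lemma basic_system_G: "basic_system R G"
proof -
  have V_I1: "V \<inter> I1 = {}" "V \<inter> J1 = {}" "I1 \<inter> J1 = {}" using T_E
    by (auto simp: V_def I1_def J1_def)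
  have VI: "I0 \<subseteq> V" "J0 \<subseteq> V" "K0 \<subseteq> V" using V_split(1) by auto
  have RI: "R \<subseteq> I" by (auto simp: R_iff)
  have G_V: "G i = prod_series (a i)" if "i \<in> V" for i using that by (simp add: G_def)
  have row: "a i j = b j - (if j = i then \<gamma> j else 0)" if "i \<in> V" "j \<in> V" for i j
    using E_row[of i j] that V_r[of i] by (auto simp: V_def)
  have nonconst: "mps_nonconstant (G i)" if "i \<in> R" for i
  proof -
    have i: "i \<in> I" "r i = i" using that by (auto simp: R_iff)
    obtain k where k: "a i k \<noteq> 0" using has_child[OF i(1)] by blast
    have "k \<in> I" using child_E[OF i(1) k] E_I by blast
    hence "dpc (G i) {#r k#} \<noteq> 0" using phi_G[OF i(1), of "{#k#}"] k i(2) by (simp add: a_def)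
    thus ?thesis unfolding mps_nonconstant_def dpc_eq_0_iff by (intro exI[of _ "{#r k#}"]) simp
  qed
  have c1: "G i = mps_in (fser (\<gamma> i) 1) i * (\<Prod>j\<in>I0 - {i}. mps_in (fser (\<gamma> j) (1 + \<gamma> j)) j) * (\<Prod>j\<in>J0. mps_in (fser 1 1) j)"
    if i: "i \<in> I0" for i
  proof -
    have "prod_series (a i) = (\<Prod>j\<in>I0. mps_in (fser (\<gamma> j) (if j = i then 1 else 1 + \<gamma> j)) j) * (\<Prod>j\<in>J0. mps_in (fser 1 1) j) *
        (\<Prod>j\<in>K0. mps_in (fser 0 0) j)"
      unfolding prod_series_def using i VI V_data V_split
      by (intro arg_cong2[of _ _ _ _ "(*)"] prod.cong refl arg_cong2[of _ _ _ _ mps_in] arg_cong2[of _ _ _ _ fser])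
         (auto simp: row subset_iff)
    also have "(\<Prod>j\<in>I0. mps_in (fser (\<gamma> j) (if j = i then 1 else 1 + \<gamma> j)) j) =
        mps_in (fser (\<gamma> i) 1) i * (\<Prod>j\<in>I0 - {i}. mps_in (fser (\<gamma> j) (1 + \<gamma> j)) j)"
      using i finite_parts(1) by (subst prod.remove[of _ i]) (auto intro!: prod.cong)
    finally show ?thesis using G_V i VI by auto
  qed
  have c2: "G i = (\<Prod>j\<in>I0. mps_in (fser (\<gamma> j) (1 + \<gamma> j)) j) * (\<Prod>j\<in>J0 - {i}. mps_in (fser 1 1) j)"
    if i: "i \<in> J0" for i
  proof -
    have "prod_series (a i) = (\<Prod>j\<in>I0. mps_in (fser (\<gamma> j) (1 + \<gamma> j)) j) * (\<Prod>j\<in>J0. mps_in (fser 1 (if j = i then 0 else 1)) j) *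
        (\<Prod>j\<in>K0. mps_in (fser 0 0) j)"
      unfolding prod_series_def using i VI V_data V_split
      by (intro arg_cong2[of _ _ _ _ "(*)"] prod.cong refl arg_cong2[of _ _ _ _ mps_in] arg_cong2[of _ _ _ _ fser])
         (auto simp: row subset_iff)
    also have "(\<Prod>j\<in>J0. mps_in (fser 1 (if j = i then 0 else 1)) j) = (\<Prod>j\<in>J0 - {i}. mps_in (fser 1 1) j :: ('i, 'k) mps)"
      using i finite_parts(2) by (subst prod.remove[of _ i]) (auto intro!: prod.cong)
    finally show ?thesis using G_V i VI by auto
  qed
  have c3: "G i = (\<Prod>j\<in>I0. mps_in (fser (\<gamma> j) (1 + \<gamma> j)) j) * (\<Prod>j\<in>J0. mps_in (fser 1 1) j)"
    if i: "i \<in> K0" for i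
  proof -
    have "prod_series (a i) = (\<Prod>j\<in>I0. mps_in (fser (\<gamma> j) (1 + \<gamma> j)) j) * (\<Prod>j\<in>J0. mps_in (fser 1 1) j) *
        (\<Prod>j\<in>K0. mps_in (fser 0 0) j)"
      unfolding prod_series_def using i VI V_data V_split
      by (intro arg_cong2[of _ _ _ _ "(*)"] prod.cong refl arg_cong2[of _ _ _ _ mps_in] arg_cong2[of _ _ _ _ fser])
         (auto simp: row subset_iff)
    thus ?thesis using G_V i VI by auto
  qed
  have c4a: "\<nu> i \<noteq> 1 \<or> (\<exists>j\<in>I0. a i j \<noteq> 1 + \<gamma> j) \<or> (\<exists>j\<in>J0. a i j \<noteq> 1) \<or> (\<exists>j\<in>K0. a i j \<noteq> 0)" if i: "i \<in> I1" for i
  proof (cases "i \<in> T")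
    case True
    obtain k where k: "k \<in> S" "c k i \<noteq> 0" using T_witness[OF True] .
    have kI: "k \<in> I" using k S_E E_I by blast
    have "r k \<in> V" using r_V[OF kI] k S_E T_not_S by blast
    moreover have "c (r k) i \<noteq> 0" using r_cols(3)[OF kI, of i] True T_E k by auto
    \<comment> \<open>The values of \<open>b\<close> on \<open>I0\<close>, \<open>J0\<close> and
      \<open>K0\<close> are one plus \<beta>, \<open>1\<close> and \<open>0\<close>, exactly the
      pattern that a member of \<open>I1\<close> must violate.\<close>
    hence "a i (r k) \<noteq> b (r k)" by (simp add: c_eq)
    ultimately show ?thesis using V_split(1) V_data by (metis UnE)
  next
    case False
    hence iN: "i \<in> I - E" "\<forall>l\<in>T. a i l = 0" using i by (auto simp: I1_def)
    \<comment> \<open>Otherwise the rows of \<open>\<sigma>\<close> and \<open>a\<close> agree on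
      \<open>V\<close> and then on all of \<open>I\<close>, which would put \<open>i\<close> into
      \<open>E\<close>.\<close>
    have "\<nu> i \<noteq> 1"
    proof
      assume "\<nu> i = 1"
      hence eq: "\<sigma> i j = a i j" if "j \<in> V" for j using \<nu>_I1[OF iN] that by simp
      have "\<sigma> i j = a i j" if j: "j \<in> I" for j
      proof -
        consider "j \<in> E - T" | "j \<in> T" | "j \<notin> E" by blast
        thus ?thesis
        proof cases
          case 1
          thus ?thesis using eq[of "r j"] r_V[OF j] r_cols(4)[OF j, of i] a_r[of i j] j iN by auto
        next
          case 2
          thus ?thesis using T_\<sigma>[of j i] iN by auto
        next
          case 3
          thus ?thesis using not_E_\<sigma>[of i j] not_E_a[of i j] iN j by auto
        qed
      qed
      thus False using iN by (auto simp: E_def)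
    qed
    thus ?thesis by blast
  qed
  have c4b: "G i = mps_const (1 / \<nu> i) * ((\<Prod>j\<in>I0. mps_in (fser (\<gamma> j) (\<nu> i * a i j)) j) *
              (\<Prod>j\<in>J0. mps_in (fser 1 (\<nu> i * a i j)) j) * (\<Prod>j\<in>K0. mps_in (fser 0 (\<nu> i * a i j)) j)) + 1 - mps_const (1 / \<nu> i)"
    if "i \<in> I1" "\<nu> i \<noteq> 0" for i
    using that V_I1 by (auto simp: G_def prod_series_def)
  have c4c: "G i = 1 + (\<Sum>j\<in>I0. mps_in (lser (a i j) (\<gamma> j)) j) + (\<Sum>j\<in>J0. mps_in (lser (a i j) 1) j) +
             (\<Sum>j\<in>K0. mps_const (a i j) * mps_var j)"
    if "i \<in> I1" "\<nu> i = 0" for i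
    using that V_I1 by (auto simp: G_def log_series_def)
  have c5: "let D = {j \<in> I1. a i j \<noteq> 0} in
        \<nu> i \<noteq> 0 \<and> D \<noteq> {} \<and> (\<forall>j\<in>D. \<nu> j = 1) \<and> (\<forall>j\<in>D. \<forall>k\<in>D. G j = G k) \<and>
        (\<exists>b. (\<forall>j\<in>D. \<forall>t\<in>I0 \<union> J0 \<union> K0. b t = a j t) \<and>
           G i = mps_const (1 / \<nu> i) *
             ((\<Prod>j\<in>I0. mps_in (fser (\<gamma> j) (b j - 1 - \<gamma> j)) j) *
              (\<Prod>j\<in>J0. mps_in (fser 1 (b j - 1)) j) *
              (\<Prod>j\<in>K0. mps_in (fser 0 (b j)) j)) +
             (\<Sum>j\<in>D. mps_const (a i j) * mps_var j) + 1 - mps_const (1 / \<nu> i))"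
    if i: "i \<in> J1" for i
  proof -
    let ?D = "{j \<in> I1. a i j \<noteq> 0}"
    have iI: "i \<in> I" using i by (auto simp: J1_def)
    have D: "?D = {j \<in> T. a i j \<noteq> 0}" using not_E_a[OF iI] by (auto simp: I1_def)
    have Dne: "?D \<noteq> {}" using i by (auto simp: D J1_def)
    have \<nu>D: "\<nu> j = 1" if "j \<in> ?D" for j using that unfolding D by (simp add: \<nu>_def)
    \<comment> \<open>Since \<open>\<sigma> i t\<close> is minus \<open>c t j\<close>, the left side
      does not depend on the child \<open>j\<close>: all children in \<open>T\<close> share one row,
      and hence one series.\<close>
    have rowD: "b t + \<sigma> i t = a j t" if "j \<in> ?D" "t \<in> V" for j t
      using \<sigma>_T_child[OF iI, of j t] that V_I unfolding D by (auto simp: c_eq)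
    have GD: "G j = G k" if "j \<in> ?D" "k \<in> ?D" for j k
    proof -
      have "prod_series (\<lambda>t. 1 * a j t) = prod_series (\<lambda>t. 1 * a k t)"
      proof (rule dpc_eqI)
        fix m
        have "1 * a j t = 1 * a k t" if "t \<in> V" for t
          using rowD[OF \<open>j \<in> ?D\<close> that] rowD[OF \<open>k \<in> ?D\<close> that] by simp
        thus "dpc (prod_series (\<lambda>t. 1 * a j t)) m = dpc (prod_series (\<lambda>t. 1 * a k t)) m"
          unfolding dpc_prod_series by (rule prod_coeff_cong)
      qed
      moreover have "j \<in> I1" "k \<in> I1" "j \<notin> V" "k \<notin> V" using that V_I1 by auto
      ultimately show ?thesis using \<nu>D that by (simp add: G_def)
    qed
    have Gi: "G i = mps_const (1 / \<nu> i) *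
             ((\<Prod>j\<in>I0. mps_in (fser (\<gamma> j) ((b j + \<sigma> i j) - 1 - \<gamma> j)) j) *
              (\<Prod>j\<in>J0. mps_in (fser 1 ((b j + \<sigma> i j) - 1)) j) *
              (\<Prod>j\<in>K0. mps_in (fser 0 (b j + \<sigma> i j)) j)) +
             (\<Sum>j\<in>?D. mps_const (a i j) * mps_var j) + 1 - mps_const (1 / \<nu> i)"
    proof -
      have "prod_series (\<sigma> i) = (\<Prod>j\<in>I0. mps_in (fser (\<gamma> j) ((b j + \<sigma> i j) - 1 - \<gamma> j)) j) *
              (\<Prod>j\<in>J0. mps_in (fser 1 ((b j + \<sigma> i j) - 1)) j) * (\<Prod>j\<in>K0. mps_in (fser 0 (b j + \<sigma> i j)) j)"
        unfolding prod_series_def using V_data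
        by (intro arg_cong2[of _ _ _ _ "(*)"] prod.cong refl arg_cong2[of _ _ _ _ mps_in] arg_cong2[of _ _ _ _ fser]) auto
      moreover have "i \<notin> V" "i \<notin> I1" using i V_I1 by auto
      ultimately show ?thesis unfolding D by (simp add: G_def)
    qed
    show ?thesis
      unfolding Let_def
    proof (intro conjI exI[of _ "\<lambda>t. b t + \<sigma> i t"] ballI)
      fix j t assume "j \<in> ?D" "t \<in> I0 \<union> J0 \<union> K0"
      thus "b t + \<sigma> i t = a j t" using V_split(1) by (intro rowD) simp_all
    next
      fix j k assume "j \<in> ?D" "k \<in> ?D"
      thus "G j = G k" by (rule GD)
    next
      fix j assume "j \<in> ?D"
      thus "\<nu> j = 1" by (rule \<nu>D)
    qed (rule \<nu>_J1(2)[OF i] Dne Gi)+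
  qed
  show ?thesis
    unfolding basic_system_def
  proof (rule exI[of _ I0], rule exI[of _ J0], rule exI[of _ K0], rule exI[of _ I1], rule exI[of _ J1],
      rule exI[of _ "\<lambda>j. \<gamma> j"], rule exI[of _ \<nu>], rule exI[of _ a], intro conjI)
    show "finite R" using finite_subset[OF RI finite_I] .
    show "R = I0 \<union> J0 \<union> K0 \<union> I1 \<union> J1" by (rule R_split)
    show "I0 \<inter> J0 = {}" "(I0 \<union> J0) \<inter> K0 = {}" by (rule V_split)+
    show "(I0 \<union> J0 \<union> K0) \<inter> I1 = {}" "(I0 \<union> J0 \<union> K0 \<union> I1) \<inter> J1 = {}"
      using V_I1 V_split(1) by auto
    show "I0 \<union> J0 \<noteq> {}" by (rule I0_J0_nonempty)
    show "\<forall>i\<in>R. mps_nonconstant (G i)" using nonconst by blast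
    show "\<forall>i\<in>I0. G i = mps_in (fser (\<gamma> i) 1) i * (\<Prod>j\<in>I0 - {i}. mps_in (fser (\<gamma> j) (1 + \<gamma> j)) j) * (\<Prod>j\<in>J0. mps_in (fser 1 1) j)"
      using c1 by blast
    show "\<forall>i\<in>J0. G i = (\<Prod>j\<in>I0. mps_in (fser (\<gamma> j) (1 + \<gamma> j)) j) * (\<Prod>j\<in>J0 - {i}. mps_in (fser 1 1) j)"
      using c2 by blast
    show "\<forall>i\<in>K0. G i = (\<Prod>j\<in>I0. mps_in (fser (\<gamma> j) (1 + \<gamma> j)) j) * (\<Prod>j\<in>J0. mps_in (fser 1 1) j)"
      using c3 by blast
  qed ((intro ballI conjI impI; (rule c4a | rule c4b | rule c4c | rule c5); assumption)+)
qed

end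

section \<open>Normalisation\<close>

theorem fundamental_of_level_le_one:
  fixes F :: "'i \<Rightarrow> ('i, 'k :: field_char_0) mps"
  assumes "level_le_one I (\<lambda>i. dpc (F i)) \<sigma> b"
  shows "fundamental I F"
proof -
  define \<phi> where "\<phi> i = dpc (F i)" for i
  define a where "a i j = \<phi> i {#j#}" for i j
  define c where "c j l = b j - a l j" for j l
  define E where "E = {i \<in> I. \<forall>j\<in>I. \<sigma> i j = a i j}"
  have "level_le_one I \<phi> \<sigma> b" using assms by (simp add: \<phi>_def [abs_def])
  then interpret L: level_le_one I \<phi> \<sigma> b a c E
    by (simp_all add: a_def [abs_def] c_def [abs_def] E_def)
  \<comment> \<open>Dividing by \<open>l j\<close> makes \<open>a j j\<close>, or failing that
    \<open>b j\<close>, equal to \<open>1\<close>. Each index of a coefficient is divided by its own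
    factor, so the recursion and the set \<open>E\<close> are preserved.\<close>
  define l where "l j = (if a j j \<noteq> 0 then a j j else if b j \<noteq> 0 then b j else 1)" for j
  have l0: "l j \<noteq> 0" for j by (simp add: l_def)
  define P where "P m = (\<Prod>v\<in>#m. l v)" for m
  have P0: "P m \<noteq> 0" for m by (auto simp: P_def l0)
  define \<phi>' where "\<phi>' i m = \<phi> i m / P m" for i m
  define \<sigma>' where "\<sigma>' i j = \<sigma> i j / l j" for i j
  define b' where "b' j = b j / l j" for j
  define a' where "a' i j = \<phi>' i {#j#}" for i j
  define c' where "c' j k = b' j - a' k j" for j k
  define E' where "E' = {i \<in> I. \<forall>j\<in>I. \<sigma>' i j = a' i j}"
  have a': "a' i j = a i j / l j" for i j by (simp add: a'_def \<phi>'_def P_def a_def)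
  have c': "c' j k = c j k / l j" for j k by (simp add: c'_def c_def a' b'_def diff_divide_distrib)
  have E': "E' = E" using l0 by (auto simp: E'_def E_def a' \<sigma>'_def)
  have loc: "normalized_level_le_one I \<phi>' \<sigma>' b'"
  proof (unfold_locales, fold a'_def c'_def, fold E'_def)
    fix i j and p :: "'i multiset" assume "i \<in> I" "j \<in> I" "p \<noteq> {#}"
    hence "\<phi> i (add_mset j p) = (\<sigma> i j + (\<Sum>l\<in>#p. c j l)) * \<phi> i p" by (rule L.step)
    moreover have "(\<Sum>l\<in>#p. c' j l) = (\<Sum>l\<in>#p. c j l) / l j"
      by (induction p) (auto simp: c' add_divide_distrib)
    moreover have "P (add_mset j p) = l j * P p" by (simp add: P_def)
    ultimately show "\<phi>' i (add_mset j p) = (\<sigma>' i j + (\<Sum>l\<in>#p. c' j l)) * \<phi>' i p"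
      using l0[of j] P0[of p] by (simp add: \<phi>'_def \<sigma>'_def add_divide_distrib[symmetric])
  next
    fix j assume "j \<in> E'"
    show "a' j j = 1 \<or> a' j j = 0 \<and> (b' j = 1 \<or> b' j = 0)"
      by (auto simp: a' b'_def l_def)
  qed (use L.finite_I L.I_nonempty L.one L.over L.child_E L.has_child L.nonlinear l0 P0
       in \<open>auto simp: E' a' \<phi>'_def P_def\<close>)
  then interpret N: normalized_level_le_one I \<phi>' \<sigma>' b' a' c' E'
    by (simp_all add: a'_def [abs_def] c'_def [abs_def] E'_def)
  \<comment> \<open>The classes of related vertices are the parts of the dilatation.\<close>
  define Q where "Q i = {x \<in> I. N.r x = i}" for i
  define H where "H x = mps_subst (N.G (N.r x)) (\<lambda>j. \<Sum>y\<in>Q j. mps_var y)" for x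
  have H: "dpc (H x) m = (if set_mset m \<subseteq> I then \<phi>' x m else 0)" if "x \<in> I" for x m
    unfolding H_def using N.phi_G[OF that, of m] L.finite_I
    by (subst dpc_subst_merge_vars[OF N.G_over, of _ Q I N.r]) (auto simp: Q_def)
  have "dilatation N.R N.G I H"
    unfolding dilatation_def
  proof (intro conjI exI[of _ Q] ballI)
    show "finite I" by (rule L.finite_I)
    show "Q i \<noteq> {}" if "i \<in> N.R" for i using that by (auto simp: Q_def N.R_iff)
    show "disjoint_family_on Q N.R" by (auto simp: disjoint_family_on_def Q_def)
    show "(\<Union>i\<in>N.R. Q i) = I" using N.r_I by (auto simp: Q_def N.R_iff)
    show "H x = mps_subst (N.G i) (\<lambda>j. \<Sum>y\<in>Q j. mps_var y)" if "i \<in> N.R" "x \<in> Q i" for i x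
      using that by (auto simp: H_def Q_def)
  qed
  moreover have "change_of_variables I H F"
    unfolding change_of_variables_def
  proof (intro exI[of _ l] conjI ballI)
    fix i assume i: "i \<in> I"
    show "F i = mps_subst (H i) (\<lambda>j. mps_const (l j) * mps_var j)"
    proof (rule dpc_eqI)
      fix m
      have "dpc (mps_subst (H i) (\<lambda>j. mps_const (l j) * mps_var j)) m = dpc (H i) m * P m"
        unfolding P_def by (rule dpc_subst_scale_vars[of UNIV]) (auto simp: mps_over_def)
      also have "\<dots> = \<phi> i m"
        using P0[of m] L.over[OF i, of m] by (auto simp: H[OF i] \<phi>'_def)
      finally show "dpc (F i) m = dpc (mps_subst (H i) (\<lambda>j. mps_const (l j) * mps_var j)) m"
        by (simp add: \<phi>_def)
    qed
  qed (simp add: l0)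
  ultimately show ?thesis
    unfolding fundamental_def using N.basic_system_G by blast
qed

section \<open>Levels\<close>

text \<open>\<open>lam\<close> is a parameter instead of \<open>level_coeff I F\<close>: after the
  removal of a vertex the old numbers still satisfy \<open>star\<close>, with no need to compare
  them with those of the smaller system.\<close>

locale leaf_coefficients =
  fixes I :: "'i set" and F :: "'i \<Rightarrow> ('i, 'k :: field_char_0) mps" and lam :: "'i \<Rightarrow> 'i \<Rightarrow> nat \<Rightarrow> 'k"
  assumes sdse: "sdse I F"
    and one: "i \<in> I \<Longrightarrow> mcoeff (F i) {#} = 1"
    and star: "i \<in> I \<Longrightarrow> j \<in> I \<Longrightarrow> \<forall>(r, m)\<in>#q. r \<in> I \<and> m \<ge> 1 \<Longrightarrow>
      dpc (F i) (add_mset j (image_mset fst q)) =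
        (lam i j (Suc (\<Sum>(r, m)\<in>#q. m)) - (\<Sum>(r, m)\<in>#q. lam r j m)) * dpc (F i) (image_mset fst q)"
begin

abbreviation "a i j \<equiv> dpc (F i) {#j#}"

lemma finite_I: "finite I" using sdse by (simp add: sdse_def)

lemma dpc_one: "i \<in> I \<Longrightarrow> dpc (F i) {#} = 1"
  using one by (simp add: dpc_def)

lemma over: "i \<in> I \<Longrightarrow> dpc (F i) m \<noteq> 0 \<Longrightarrow> set_mset m \<subseteq> I"
  using sdse by (auto simp: sdse_def mps_over_def dpc_eq_0_iff)

lemma lam_1: "i \<in> I \<Longrightarrow> j \<in> I \<Longrightarrow> lam i j 1 = a i j"
  using star[of i j "{#}"] by (simp add: dpc_one)

text \<open>All branches are single leaves here, so the numbers of the children are entries of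
  \<open>a\<close> by \<open>lam_1\<close>.\<close>

lemma corolla:
  assumes "i \<in> I" "j \<in> I" "set_mset p \<subseteq> I"
  shows "dpc (F i) (add_mset j p) = (lam i j (Suc (size p)) - (\<Sum>l\<in>#p. a l j)) * dpc (F i) p"
proof -
  let ?q = "image_mset (\<lambda>l. (l, 1 :: nat)) p"
  have "(\<Sum>(r, m)\<in>#?q. lam r j m) = (\<Sum>l\<in>#p. a l j)"
    using assms lam_1 by (auto simp: image_mset.compositionality o_def intro!: arg_cong[of _ _ sum_mset] image_mset_cong)
  moreover have "image_mset fst ?q = p" by (simp add: image_mset.compositionality o_def)
  moreover have "(\<Sum>(r, m)\<in>#?q. m) = size p" by (simp add: image_mset.compositionality o_def)
  moreover have "\<forall>(r, m)\<in>#?q. r \<in> I \<and> m \<ge> 1" using assms by auto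
  ultimately show ?thesis using star[OF assms(1,2), of ?q] by simp
qed

lemma strip: "i \<in> I \<Longrightarrow> dpc (F i) (add_mset j p) \<noteq> 0 \<Longrightarrow> dpc (F i) p \<noteq> 0"
  using over[of i "add_mset j p"] corolla[of i j p] by auto

lemma strip_submultiset:
  assumes "i \<in> I" "dpc (F i) m \<noteq> 0" "p \<subseteq># m"
  shows "dpc (F i) p \<noteq> 0"
proof -
  have "dpc (F i) (q + p) \<noteq> 0 \<Longrightarrow> dpc (F i) p \<noteq> 0" for q
    using strip[OF assms(1)] by (induction q) auto
  moreover obtain q where "m = q + p" using assms(3) by (metis subset_mset.diff_add)
  ultimately show ?thesis using assms(2) by blast
qed

lemma support_a: "i \<in> I \<Longrightarrow> dpc (F i) m \<noteq> 0 \<Longrightarrow> l \<in># m \<Longrightarrow> a i l \<noteq> 0"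
  by (rule strip_submultiset) auto

lemma has_child:
  assumes "i \<in> I"
  shows "\<exists>k\<in>I. a i k \<noteq> 0"
proof -
  have "mps_nonconstant (F i)" using sdse assms by (simp add: sdse_def)
  then obtain m where m: "m \<noteq> {#}" "dpc (F i) m \<noteq> 0"
    unfolding mps_nonconstant_def dpc_eq_0_iff by (elim exE conjE)
  then obtain k where "k \<in># m" by blast
  thus ?thesis using support_a[OF assms m(2)] over[OF assms m(2)] by blast
qed

text \<open>The coefficient of \<open>{#j, k#}\<close> does not depend on the size chosen for the
  branch \<open>k\<close>; comparing sizes \<open>n\<close> and \<open>1\<close> gives the shift. It
  transports slopes along edges and lowers the level by one.\<close>

lemma lam_child:
  assumes "i \<in> I" "j \<in> I" "k \<in> I" "a i k \<noteq> 0" "n \<ge> 1"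
  shows "lam i j (Suc n) = lam k j n + (lam i j 2 - a k j)"
proof -
  have "dpc (F i) {#j, k#} = (lam i j (Suc n) - lam k j n) * a i k"
    using star[of i j "{#(k, n)#}"] assms by simp
  moreover have "dpc (F i) {#j, k#} = (lam i j 2 - a k j) * a i k"
    using corolla[of i j "{#k#}"] assms by (simp add: numeral_2_eq_2)
  ultimately have "lam i j (Suc n) - lam k j n = lam i j 2 - a k j"
    using assms(4) by (metis mult_right_cancel)
  thus ?thesis by (simp add: algebra_simps)
qed

text \<open>A nonzero quadratic term admits branches of sizes \<open>1\<close> and \<open>n\<close>.
  Comparing with sizes \<open>1\<close> and \<open>1\<close> shows that the increments are constant
  from index \<open>2\<close> on, so the level is at most one.\<close>

lemma quadratic:
  assumes "i \<in> I" "j \<in> I" "dpc (F i) {#k, l#} \<noteq> 0" "n \<ge> 1"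
  shows "lam i j (Suc (Suc n)) = lam i j (Suc n) + (lam i j 3 - lam i j 2)"
proof -
  have kl: "k \<in> I" "l \<in> I" using over[OF assms(1,3)] by auto
  have al: "a i l \<noteq> 0" using support_a[OF assms(1,3)] by simp
  have "dpc (F i) {#j, k, l#} = (lam i j (Suc (Suc n)) - (lam k j 1 + lam l j n)) * dpc (F i) {#k, l#}"
    using star[of i j "{#(k, 1), (l, n)#}"] assms kl by simp
  moreover have "dpc (F i) {#j, k, l#} = (lam i j 3 - (a k j + a l j)) * dpc (F i) {#k, l#}"
    using corolla[of i j "{#k, l#}"] assms kl by (simp add: numeral_3_eq_3)
  ultimately have "lam i j (Suc (Suc n)) - (lam k j 1 + lam l j n) = lam i j 3 - (a k j + a l j)"
    using assms(3) by (metis mult_right_cancel)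
  hence "lam i j (Suc (Suc n)) = lam i j 3 - (a k j + a l j) + (lam k j 1 + lam l j n)"
    by (simp only: diff_eq_eq)
  moreover have "lam k j 1 = a k j" using lam_1 kl assms by blast
  moreover have "lam l j n = lam i j (Suc n) - (lam i j 2 - a l j)"
    using lam_child[OF assms(1,2) kl(2) al assms(4)] by simp
  ultimately show ?thesis by (simp add: algebra_simps)
qed

lemma quadratic_exists:
  assumes "i \<in> I" "size m \<ge> 2" "dpc (F i) m \<noteq> 0"
  shows "\<exists>k l. dpc (F i) {#k, l#} \<noteq> 0"
proof -
  obtain k p where m: "m = add_mset k p" using assms(2) by (cases m) auto
  obtain l p' where p: "p = add_mset l p'" using assms(2) m by (cases p) auto
  have "dpc (F i) {#k, l#} \<noteq> 0" by (rule strip_submultiset[OF assms(1,3)]) (simp add: m p)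
  thus ?thesis by blast
qed

lemma linear_children:
  assumes z: "z \<in> I" and lin: "\<And>m. size m \<ge> 2 \<Longrightarrow> dpc (F z) m = 0"
    and kl: "k \<in> I" "l \<in> I" "a z k \<noteq> 0" "a z l \<noteq> 0"
  shows "F k = F l"
proof -
  \<comment> \<open>The vanishing quadratic coefficients remove the shift in
    \<open>lam_child\<close>; thus all children of \<open>z\<close> have the same numbers, and
    \<open>corolla\<close> rebuilds their series from these.\<close>
  have lam: "lam x j n = lam z j (Suc n)" if "x \<in> I" "a z x \<noteq> 0" "j \<in> I" "n \<ge> 1" for x j n
  proof -
    have "(lam z j 2 - a x j) * a z x = 0"
      using corolla[of z j "{#x#}"] lin[of "{#j, x#}"] that z by (simp add: numeral_2_eq_2)
    thus ?thesis using lam_child[OF z that(3,1,2,4)] that(2) by simp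
  qed
  have "dpc (F k) m = dpc (F l) m" if "set_mset m \<subseteq> I" for m
    using that
  proof (induction m)
    case (add j m)
    thus ?case using kl by (simp add: corolla lam)
  qed (use kl dpc_one in auto)
  moreover have "dpc (F k) m = dpc (F l) m" if "\<not> set_mset m \<subseteq> I" for m
    using over kl that by metis
  ultimately show ?thesis by (intro dpc_eqI) blast
qed

lemma extension_step:
  assumes z: "z \<in> I" and lin: "\<And>m. size m \<ge> 2 \<Longrightarrow> dpc (F z) m = 0"
    and no_parent: "\<And>i. i \<in> I \<Longrightarrow> a i z = 0" and hopf: "hopf_sdse I F"
  shows "hopf_sdse (I - {z}) F" "extension (I - {z}) F I F" "leaf_coefficients (I - {z}) F lam"
proof -
  let ?J = "I - {z}"
  have I: "I = insert z ?J" using z by blast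
  obtain k where k: "k \<in> I" "a z k \<noteq> 0" using has_child[OF z] by blast
  hence J: "?J \<noteq> {}" using no_parent[OF z] by blast
  have over_J: "mps_over ?J (F i)" if "i \<in> I" for i
    unfolding mps_over_def dpc_eq_0_iff[symmetric]
    using over[OF that] support_a[OF that] no_parent[OF that] by blast
  show hJ: "hopf_sdse ?J F"
  proof (rule hopf_sdse_restrict[OF _ J])
    show "hopf_sdse (insert z ?J) F" using hopf I by simp
  qed (use over_J z in auto)
  show "leaf_coefficients ?J F lam"
  proof
    show "sdse ?J F" using hJ by (simp add: hopf_sdse_def)
  next
    fix i j and q :: "('i \<times> nat) multiset" assume "i \<in> ?J" "j \<in> ?J" "\<forall>(r, m)\<in>#q. r \<in> ?J \<and> m \<ge> 1"
    thus "dpc (F i) (add_mset j (image_mset fst q)) =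
        (lam i j (Suc (\<Sum>(r, m)\<in>#q. m)) - (\<Sum>(r, m)\<in>#q. lam r j m)) * dpc (F i) (image_mset fst q)"
      by (intro star) auto
  qed (use one in auto)
  have Fz: "F z = 1 + (\<Sum>i\<in>?J. mps_const (a z i) * mps_var i)"
  proof (rule dpc_eqI)
    fix m
    have sum: "(\<Sum>i\<in>?J. dpc (mps_const (a z i) * mps_var i) m) = (\<Sum>i\<in>?J. if m = {#i#} then a z i else 0)"
      by (intro sum.cong) auto
    show "dpc (F z) m = dpc (1 + (\<Sum>i\<in>?J. mps_const (a z i) * mps_var i)) m"
    proof (cases "size m \<ge> 2")
      case True
      hence "m \<noteq> {#i#}" "m \<noteq> {#}" for i by auto
      thus ?thesis using lin[OF True] by simp
    next
      case False
      show ?thesis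
      proof (cases "m = {#}")
        case ne: False
        hence "size m \<noteq> 0" by simp
        hence "size m = 1" using False by linarith
        then obtain k where m: "m = {#k#}" using size_1_singleton_mset by blast
        have "(\<Sum>i\<in>?J. if m = {#i#} then a z i else 0) = (\<Sum>i\<in>?J. if i = k then a z k else 0)"
          by (intro sum.cong) (auto simp: m)
        also have "\<dots> = (if k \<in> ?J then a z k else 0)" using finite_I by (simp add: sum.delta)
        also have "\<dots> = a z k" using over[OF z, of "{#k#}"] no_parent[OF z] by auto
        finally show ?thesis using sum by (simp add: m)
      qed (use dpc_one[OF z] in simp)
    qed
  qed
  show "extension ?J F I F"
    unfolding extension_def
  proof (intro conjI exI[of _ z] exI[of _ "a z"])
    show "mps_nonconstant (F z)" using sdse z by (simp add: sdse_def)
    show "\<forall>i\<in>?J. \<forall>j\<in>?J. a z i \<noteq> 0 \<and> a z j \<noteq> 0 \<longrightarrow> F i = F j"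
      using linear_children[OF z lin] by blast
  qed (use hJ Fz I in auto)
qed

end

lemma add_shift_eq_iff: "(x :: 'a :: ab_group_add) + z = y + z + w \<longleftrightarrow> x = y + w"
  by (auto simp: algebra_simps)

theorem fundamental_extended_of_levels:
  fixes F :: "'i \<Rightarrow> ('i, 'k :: field_char_0) mps"
  assumes "leaf_coefficients I F lam" and "hopf_sdse I F"
    and "\<forall>i\<in>I. \<exists>M. \<forall>j\<in>I. \<forall>n>M. lam i j (Suc n) = lam i j n + b j"
  shows "fundamental_extended I F"
  using assms
proof (induction "card I" arbitrary: I rule: less_induct)
  case less
  interpret leaf_coefficients I F lam by (rule less.prems)
  \<comment> \<open>\<open>LV M i\<close> says that \<open>i\<close> has level at most
    \<open>M\<close>, with the prescribed slopes.\<close>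
  define LV where "LV M i \<longleftrightarrow> (\<forall>j\<in>I. \<forall>n>M. lam i j (Suc n) = lam i j n + b j)" for M i
  define lev where "lev i = (LEAST M. LV M i)" for i
  have lev: "LV (lev i) i" if "i \<in> I" for i
  proof -
    from less.prems(3) that have "\<exists>M. LV M i" unfolding LV_def by (rule bspec)
    thus ?thesis unfolding lev_def by (rule LeastI_ex)
  qed
  have lev_le: "lev i \<le> M" if "LV M i" for i M
    unfolding lev_def using that by (rule Least_le)
  have mono: "LV N i" if "LV M i" "M \<le> N" for i M N using that by (auto simp: LV_def)
  have child: "LV (Suc M) i \<longleftrightarrow> LV M k" if "i \<in> I" "k \<in> I" "a i k \<noteq> 0" for i k M
  proof -
    have "(\<forall>n>Suc M. lam i j (Suc n) = lam i j n + b j) \<longleftrightarrow> (\<forall>n>M. lam k j (Suc n) = lam k j n + b j)"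
      if j: "j \<in> I" for j
    proof -
      note lc = lam_child[OF \<open>i \<in> I\<close> j \<open>k \<in> I\<close> \<open>a i k \<noteq> 0\<close>]
      have *: "lam i j (Suc (Suc n)) = lam i j (Suc n) + b j \<longleftrightarrow> lam k j (Suc n) = lam k j n + b j" if "n > M" for n
      proof -
        have n: "n \<ge> 1" "Suc n \<ge> 1" using that by auto
        show ?thesis unfolding lc[OF n(1)] lc[OF n(2)] by (rule add_shift_eq_iff)
      qed
      show ?thesis
      proof (intro iffI allI impI)
        fix n assume L: "\<forall>n>Suc M. lam i j (Suc n) = lam i j n + b j" "n > M"
        hence "lam i j (Suc (Suc n)) = lam i j (Suc n) + b j" by (intro L(1)[rule_format]) simp
        thus "lam k j (Suc n) = lam k j n + b j" using *[OF L(2)] by blast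
      next
        fix n assume L: "\<forall>n>M. lam k j (Suc n) = lam k j n + b j" "n > Suc M"
        then obtain n' where n': "n = Suc n'" "n' > M" by (cases n) auto
        show "lam i j (Suc n) = lam i j n + b j" using *[OF n'(2)] L(1) n' by blast
      qed
    qed
    thus ?thesis by (simp add: LV_def)
  qed
  have remove: ?case if z: "z \<in> I" and lin: "\<And>m. size m \<ge> 2 \<Longrightarrow> dpc (F z) m = 0"
    and np: "\<And>i. i \<in> I \<Longrightarrow> a i z = 0" for z
  proof -
    note ext = extension_step[OF z lin np less.prems(2)]
    have "fundamental_extended (I - {z}) F"
    proof (rule less.hyps[OF _ ext(3,1)])
      show "card (I - {z}) < card I" by (rule card_Diff1_less[OF finite_I z])
      show "\<forall>i\<in>I - {z}. \<exists>M. \<forall>j\<in>I - {z}. \<forall>n>M. lam i j (Suc n) = lam i j n + b j"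
        using less.prems(3) by blast
    qed
    thus ?thesis using ext(2) by (rule fundamental_extended.extension)
  qed
  have linear: "dpc (F z) m = 0" if z: "z \<in> I" "\<not> LV 1 z" and m: "size m \<ge> 2" for z m
  proof (rule ccontr)
    assume "dpc (F z) m \<noteq> 0"
    then obtain k l where kl: "dpc (F z) {#k, l#} \<noteq> 0" using quadratic_exists[OF z(1) m] by blast
    have "LV 1 z"
      unfolding LV_def
    proof (intro ballI allI impI)
      fix j n assume j: "j \<in> I" and n: "(1::nat) < n"
      \<comment> \<open>Far enough out for the slope to be \<open>b j\<close>; the increment, being
        constant from index \<open>2\<close> on, is then \<open>b j\<close> everywhere in that
        range.\<close>
      define N where "N = Suc (lev z)"
      have "lam z j (Suc (Suc N)) = lam z j (Suc N) + (lam z j 3 - lam z j 2)"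
        using quadratic[OF z(1) j kl] by (simp add: N_def)
      moreover have "lam z j (Suc (Suc N)) = lam z j (Suc N) + b j"
        using lev[OF z(1)] j by (simp add: LV_def N_def)
      ultimately have "lam z j 3 - lam z j 2 = b j" by simp
      moreover obtain n' where "n = Suc n'" "n' \<ge> 1" using n by (cases n) auto
      ultimately show "lam z j (Suc n) = lam z j n + b j"
        using quadratic[OF z(1) j kl, of n'] by simp
    qed
    thus False using z by blast
  qed
  show ?case
  proof (cases "\<forall>i\<in>I. LV 1 i")
    case False
    then obtain y where y: "y \<in> I" "\<not> LV 1 y" by blast
    have "finite (lev ` I)" "lev ` I \<noteq> {}" using finite_I y by auto
    then obtain z where z: "z \<in> I" "lev z = Max (lev ` I)" by (metis Max_in imageE)
    have max: "lev i \<le> lev z" if "i \<in> I" for i using that finite_I by (simp add: z(2))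
    have "lev z \<ge> 2"
    proof (rule ccontr)
      assume "\<not> lev z \<ge> 2"
      hence "lev y \<le> 1" using max[OF y(1)] by simp
      thus False using mono[OF lev[OF y(1)]] y(2) by blast
    qed
    hence nz: "\<not> LV 1 z" using lev_le[of 1 z] by fastforce
    have "a i z = 0" if i: "i \<in> I" for i
    proof (rule ccontr)
      assume az: "a i z \<noteq> 0"
      \<comment> \<open>The truncated subtraction is harmless: for \<open>lev i = 0\<close> this
        still holds by monotonicity.\<close>
      have "LV (Suc (lev i - 1)) i" by (rule mono[OF lev[OF i]]) simp
      hence "LV (lev i - 1) z" using child[OF i z(1) az] by blast
      hence "lev z \<le> lev i - 1" by (rule lev_le)
      thus False using max[OF i] \<open>lev z \<ge> 2\<close> by linarith
    qed
    thus ?thesis using remove[OF z(1) linear[OF z(1) nz]] by blast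
  next
    case LV1: True
    have child0: "LV 0 k" if "i \<in> I" "k \<in> I" "a i k \<noteq> 0" for i k
      using child[OF that, of 0] LV1 that(1) by simp
    show ?thesis
    proof (cases "\<exists>z\<in>I. \<not> LV 0 z \<and> (\<forall>m. size m \<ge> 2 \<longrightarrow> dpc (F z) m = 0)")
      case True
      then obtain z where z: "z \<in> I" "\<not> LV 0 z" "\<And>m. size m \<ge> 2 \<Longrightarrow> dpc (F z) m = 0" by blast
      \<comment> \<open>Once no level exceeds one, children have level 0, so a vertex of level one
        has no parent.\<close>
      have "a i z = 0" if "i \<in> I" for i using child0[OF that z(1)] z(2) by blast
      thus ?thesis using remove[OF z(1,3)] by blast
    next
      case False
      define \<sigma> where "\<sigma> i j = lam i j 2 - b j" for i j
      \<comment> \<open>The affine formula starts at index \<open>2\<close>. At index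
        \<open>1\<close> the number is \<open>a i j\<close>, and its agreement with
        \<open>\<sigma> i j\<close> for all \<open>j\<close> is exactly level 0.\<close>
      have lamS: "lam i j (Suc n) = \<sigma> i j + of_nat n * b j" if "i \<in> I" "j \<in> I" "n \<ge> 1" for i j n
        using that(3)
      proof (induction n rule: dec_induct)
        case base
        show ?case by (simp add: \<sigma>_def numeral_2_eq_2)
      next
        case (step n)
        have "lam i j (Suc (Suc n)) = lam i j (Suc n) + b j" using LV1 that step.hyps by (auto simp: LV_def)
        thus ?case using step.IH by (simp add: algebra_simps)
      qed
      have LV0: "LV 0 i" if "i \<in> I" "\<forall>j\<in>I. \<sigma> i j = a i j" for i
        unfolding LV_def
      proof (intro ballI allI impI)
        fix j n assume j: "j \<in> I" and n: "(0::nat) < n"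
        show "lam i j (Suc n) = lam i j n + b j"
        proof (cases "n = 1")
          case True
          thus ?thesis using that j lam_1[of i j] by (simp add: \<sigma>_def numeral_2_eq_2 algebra_simps)
        next
          case False
          thus ?thesis using LV1 that j n by (auto simp: LV_def)
        qed
      qed
      have E0: "\<sigma> i j = a i j" if "i \<in> I" "j \<in> I" "LV 0 i" for i j
        using that lam_1[of i j] by (auto simp: \<sigma>_def LV_def numeral_2_eq_2 algebra_simps)
      have "level_le_one I (\<lambda>i. dpc (F i)) \<sigma> b"
      proof
        show "finite I" "I \<noteq> {}" using sdse by (auto simp: sdse_def)
        fix i assume i: "i \<in> I"
        show "dpc (F i) {#} = 1" using dpc_one[OF i] .
        show "\<exists>k. a i k \<noteq> 0" using has_child[OF i] by blast
        show "set_mset m \<subseteq> I" if "dpc (F i) m \<noteq> 0" for m using over[OF i that] .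
        show "k \<in> {i \<in> I. \<forall>j\<in>I. \<sigma> i j = a i j}" if "a i k \<noteq> 0" for k
        proof -
          have k: "k \<in> I" using over[OF i that] by simp
          thus ?thesis using E0[OF k] child0[OF i k that] by blast
        qed
        show "\<exists>m. size m \<ge> 2 \<and> dpc (F i) m \<noteq> 0" if "i \<notin> {i \<in> I. \<forall>j\<in>I. \<sigma> i j = a i j}"
          using that E0[OF i] False i by blast
        fix j p assume j: "j \<in> I" and p: "p \<noteq> ({#} :: 'i multiset)"
        show "dpc (F i) (add_mset j p) = (\<sigma> i j + (\<Sum>l\<in>#p. b j - a l j)) * dpc (F i) p"
        proof (cases "dpc (F i) p = 0")
          case True
          thus ?thesis using strip[OF i] by auto
        next
          case nz: False
          have sum: "(\<Sum>l\<in>#p. b j - a l j) = of_nat (size p) * b j - (\<Sum>l\<in>#p. a l j)"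
            by (induction p) (auto simp: algebra_simps)
          have "size p \<ge> 1" using p by (cases p) auto
          thus ?thesis
            unfolding corolla[OF i j over[OF i nz]] sum by (simp only: lamS[OF i j] add_diff_eq)
        qed
      qed
      thus ?thesis by (intro fundamental_extended.fundamental fundamental_of_level_le_one)
    qed
  qed
qed

theorem theorem52:
  fixes I :: "'i set" and F :: "'i \<Rightarrow> ('i, 'k :: field_char_0) mps"
  assumes "hopf_sdse I F"
    and "\<forall>i\<in>I. mcoeff (F i) {#} = 1"
    and "sdse_connected I F"
    and "\<forall>i\<in>I. finite_level I F i"
  shows "fundamental_extended I F"
proof -
  define lam where "lam = level_coeff I F"
  have sdse: "sdse I F" using assms(1) by (simp add: hopf_sdse_def)
  have loc: "leaf_coefficients I F lam"
    using sdse assms(2) hopf_level_coeff[OF assms(1,2)] unfolding lam_def by unfold_locales auto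
  then interpret leaf_coefficients I F lam .
  \<comment> \<open>Separating the slope from its threshold lets it pass along edges, which shift
    the threshold.\<close>
  define slope where "slope i j x \<longleftrightarrow> (\<exists>M. \<forall>n>M. lam i j (Suc n) = lam i j n + x)" for i j x
  have slope_unique: "x = y" if xy: "slope i j x" "slope i j y" for i j x y
  proof -
    obtain M N where M: "\<forall>n>M. lam i j (Suc n) = lam i j n + x" and N: "\<forall>n>N. lam i j (Suc n) = lam i j n + y"
      using xy unfolding slope_def by blast
    have "lam i j (Suc (Suc (max M N))) = lam i j (Suc (max M N)) + x" using M by simp
    moreover have "lam i j (Suc (Suc (max M N))) = lam i j (Suc (max M N)) + y" using N by simp
    ultimately show ?thesis by simp
  qed
  have affine: "\<exists>M. \<forall>j\<in>I. \<exists>x. \<forall>n>M. lam i j (Suc n) = lam i j n + x" if i: "i \<in> I" for i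
  proof -
    have "finite_level I F i" using assms(4) i by blast
    hence "\<exists>M. \<forall>j\<in>I. \<exists>b a. \<forall>n>M. lam i j n = b * (of_nat n - 1) + a"
      by (simp only: finite_level_def lam_def)
    then obtain M where M: "\<forall>j\<in>I. \<exists>b a. \<forall>n>M. lam i j n = b * (of_nat n - 1) + a"
      by (rule exE)
    have "\<exists>x. \<forall>n>M. lam i j (Suc n) = lam i j n + x" if j: "j \<in> I" for j
    proof -
      obtain y z where yz: "\<forall>n>M. lam i j n = y * (of_nat n - 1) + z" using bspec[OF M j] by (elim exE)
      have "lam i j (Suc n) = lam i j n + y" if "n > M" for n
        using yz[rule_format, of n] yz[rule_format, of "Suc n"] that by (simp add: algebra_simps)
      thus ?thesis by blast
    qed
    thus ?thesis by blast
  qed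
  have edge: "slope i j x \<longleftrightarrow> slope k j x" if ik: "(i, k) \<in> sdse_graph I F" and j: "j \<in> I" for i k j x
  proof -
    have i: "i \<in> I" and k: "k \<in> I" and d: "mps_deriv k (F i) \<noteq> 0" using ik by (auto simp: sdse_graph_def)
    have "\<exists>m. mcoeff (mps_deriv k (F i)) m \<noteq> 0" using d mps_eqI[of "mps_deriv k (F i)" 0] by (auto simp: zero_mps.rep_eq)
    then obtain m where "mcoeff (F i) (add_mset k m) \<noteq> 0" by (auto simp: mps_deriv.rep_eq)
    hence "a i k \<noteq> 0" using support_a[OF i, of "add_mset k m" k] by (simp add: dpc_eq_0_iff)
    note lc = lam_child[OF i j k this]
    have *: "lam i j (Suc (Suc n)) = lam i j (Suc n) + x \<longleftrightarrow> lam k j (Suc n) = lam k j n + x" if "n \<ge> 1" for n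
    proof -
      have n: "n \<ge> 1" "Suc n \<ge> 1" using that by auto
      show ?thesis unfolding lc[OF n(1)] lc[OF n(2)] by (rule add_shift_eq_iff)
    qed
    show ?thesis
    proof
      assume "slope i j x"
      then obtain M where M: "\<forall>n>M. lam i j (Suc n) = lam i j n + x" by (auto simp: slope_def)
      have "lam k j (Suc n) = lam k j n + x" if "n > M" for n
        using *[of n] M[rule_format, of "Suc n"] that by simp
      thus "slope k j x" by (auto simp: slope_def)
    next
      assume "slope k j x"
      then obtain M where M: "\<forall>n>M. lam k j (Suc n) = lam k j n + x" by (auto simp: slope_def)
      have "lam i j (Suc n) = lam i j n + x" if n: "n > Suc M" for n
      proof -
        obtain n' where "n = Suc n'" using n by (cases n) auto
        thus ?thesis using *[of n'] M n by auto
      qed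
      thus "slope i j x" by (auto simp: slope_def)
    qed
  qed
  obtain i0 where i0: "i0 \<in> I" using sdse by (auto simp: sdse_def)
  have "\<forall>j\<in>I. \<exists>x. slope i0 j x" using affine[OF i0] unfolding slope_def by blast
  from bchoice[OF this] obtain b where b: "\<forall>j\<in>I. slope i0 j (b j)" by (elim exE)
  have all: "slope i j (b j)" if "i \<in> I" "j \<in> I" for i j
  \<comment> \<open>Slopes agree at both ends of an edge, hence along undirected paths from
    \<open>i0\<close>; this is where connectedness enters.\<close>
  proof -
    have "(i0, i) \<in> (sdse_graph I F \<union> (sdse_graph I F)\<inverse>)\<^sup>*"
      using assms(3) i0 that(1) by (simp add: sdse_connected_def)
    thus ?thesis
      by (induction rule: rtrancl_induct) (use b edge that(2) in auto)
  qed
  \<comment> \<open>\<open>slope\<close> hides a threshold for each \<open>j\<close>; the uniform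
    one comes back from \<open>affine\<close>, whose slope must be \<open>b j\<close> by
    uniqueness.\<close>
  have "\<exists>M. \<forall>j\<in>I. \<forall>n>M. lam i j (Suc n) = lam i j n + b j" if i: "i \<in> I" for i
  proof -
    obtain M where M: "\<forall>j\<in>I. \<exists>x. \<forall>n>M. lam i j (Suc n) = lam i j n + x" using affine[OF i] by blast
    have "\<forall>n>M. lam i j (Suc n) = lam i j n + b j" if j: "j \<in> I" for j
    proof -
      obtain x where x: "\<forall>n>M. lam i j (Suc n) = lam i j n + x" using M j by blast
      hence "slope i j x" by (auto simp: slope_def)
      hence "x = b j" using slope_unique all[OF i j] by blast
      thus ?thesis using x by simp
    qed
    thus ?thesis by blast
  qed
  thus ?thesis using fundamental_extended_of_levels[OF loc assms(1)] by blast
qed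

end
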